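(* Let $\alpha\in(1,\infty)$ and let $B:\mathbb R\setminus\{0\}\to\mathbb R$ be an even function that is positive, decreasing and convex on $(0,\infty)$ and satisfies, for some $\varepsilon>0$, $B(t)=\dfrac1{t\ln^\alpha(1/t)}$ for all $t\in(0,\varepsilon)$. For $-\infty<a<b<\infty$ let $G_{a,b}$ be the completion of (real) $L_2(a,b)$ with respect to $\langle f,g\rangle=\iint f(s)g(t)B(s-t)\,ds\,dt$, regarded as an FHS-space. Then for every $T\in(0,\infty)$ $$G_{-T,T}=G_{-T,0}\oplus G_{0,T}\quad\text{in the FHS sense.}$$
   Context: "Positive" and "decreasing" are understood in the weak sense; under the hypotheses the scalar product is well defined and positive definite. $G_{-T,0}$ and $G_{0,T}$ are regarded as subspaces of $G_{-T,T}$ (closures of $L_2(-T,0)$ and $L_2(0,T)$). Two norms $\|\cdot\|_1,\|\cdot\|_2$ on a real linear space $H$, each turning $H$ into a separable Hilbert space, are FHS-equivalent if they define the same topology and there is a (finite or countable) sequence $(e_k)$ that is an orthogonal basis for both norms with $\sum_k(\lambda_k-1)^2<\infty$, where $\lambda_k=\|e_k\|_2/\|e_k\|_1$. An FHS-space is a real linear space with a full FHS-equivalence class of such norms, called admissible norms; the admissible norms on $G_{a,b}$ are those FHS-equivalent to its Hilbert norm. $H=H_1\oplus H_2$ in the FHS sense means: the closed linear subspaces $H_1,H_2$ span $H$ and are orthogonal with respect to some admissible norm on $H$. *)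

theory Defs
  imports "HOL-Analysis.Analysis"
begin

section \<open>FHS-equivalence of Hilbert norms\<close>

abbreviation norm_dist :: "('h::real_vector \<Rightarrow> real) \<Rightarrow> 'h \<Rightarrow> 'h \<Rightarrow> real" where
  "norm_dist N \<equiv> (\<lambda>x y. N (x - y))"

abbreviation norm_topology :: "('h::real_vector \<Rightarrow> real) \<Rightarrow> 'h topology" where
  "norm_topology N \<equiv> Metric_space.mtopology UNIV (norm_dist N)"

definition separable_hilbert_norm :: "('h::real_vector \<Rightarrow> real) \<Rightarrow> bool" where
  "separable_hilbert_norm N \<longleftrightarrow>
     (\<exists>ip. bilinear ip \<and> (\<forall>x y. ip x y = ip y x) \<and> (\<forall>x. x \<noteq> 0 \<longrightarrow> 0 < ip x x) \<and>
           (\<forall>x. N x = sqrt (ip x x))) \<and>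
     Metric_space.mcomplete UNIV (norm_dist N) \<and>
     (\<exists>C. countable C \<and> norm_topology N closure_of C = UNIV)"

text \<open>The inner product of a Hilbert norm, recovered by polarization.\<close>

definition norm_inner :: "('h::real_vector \<Rightarrow> real) \<Rightarrow> 'h \<Rightarrow> 'h \<Rightarrow> real" where
  "norm_inner N x y = ((N (x + y))\<^sup>2 - (N x)\<^sup>2 - (N y)\<^sup>2) / 2"

text \<open>Finite or countable sequences are families indexed by a set \<open>K\<close> of natural numbers.
  Basis vectors are nonzero but not normalized.\<close>

definition orthogonal_basis :: "('h::real_vector \<Rightarrow> real) \<Rightarrow> nat set \<Rightarrow> (nat \<Rightarrow> 'h) \<Rightarrow> bool" where
  "orthogonal_basis N K e \<longleftrightarrow>
     (\<forall>k\<in>K. e k \<noteq> 0) \<and>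
     (\<forall>k\<in>K. \<forall>l\<in>K. k \<noteq> l \<longrightarrow> norm_inner N (e k) (e l) = 0) \<and>
     norm_topology N closure_of (span (e ` K)) = UNIV"

definition fhs_equivalent :: "('h::real_vector \<Rightarrow> real) \<Rightarrow> ('h \<Rightarrow> real) \<Rightarrow> bool" where
  "fhs_equivalent N1 N2 \<longleftrightarrow>
     separable_hilbert_norm N1 \<and> separable_hilbert_norm N2 \<and>
     norm_topology N1 = norm_topology N2 \<and>
     (\<exists>K e. orthogonal_basis N1 K e \<and> orthogonal_basis N2 K e \<and>
            (\<lambda>k. (N2 (e k) / N1 (e k) - 1)\<^sup>2) summable_on K)"

text \<open>The FHS-structure generated by a Hilbert norm: its set of admissible norms.\<close>

definition fhs_class :: "('h::real_vector \<Rightarrow> real) \<Rightarrow> ('h \<Rightarrow> real) set" where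
  "fhs_class N = {N'. fhs_equivalent N N'}"

text \<open>\<open>H = H1 \<oplus> H2\<close> in the FHS sense, where \<open>H\<close> is the whole type \<open>'h\<close> with the set \<open>\<A>\<close> of
  admissible norms. All admissible norms define the same topology, so it is immaterial which of
  them is used to express closedness.\<close>

definition fhs_direct_sum ::
    "('h::real_vector \<Rightarrow> real) set \<Rightarrow> 'h set \<Rightarrow> 'h set \<Rightarrow> bool" where
  "fhs_direct_sum \<A> H1 H2 \<longleftrightarrow>
     subspace H1 \<and> subspace H2 \<and> span (H1 \<union> H2) = UNIV \<and>
     (\<exists>N\<in>\<A>. closedin (norm_topology N) H1 \<and> closedin (norm_topology N) H2 \<and>
            (\<forall>x\<in>H1. \<forall>y\<in>H2. norm_inner N x y = 0))"


section \<open>The spaces \<open>G\<^sub>a\<^sub>,\<^sub>b\<close>\<close>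

text \<open>Real \<open>L\<^sub>2(a,b)\<close>, represented by square-integrable functions extended by zero outside
  \<open>(a,b)\<close>, so that \<open>L\<^sub>2(c,d) \<subseteq> L\<^sub>2(a,b)\<close> literally when \<open>(c,d) \<subseteq> (a,b)\<close>. Functions that agree
  almost everywhere are not identified here; an isometric map as in \<open>is_G\<close> below
  identifies them.\<close>

definition L2 :: "real \<Rightarrow> real \<Rightarrow> (real \<Rightarrow> real) set" where
  "L2 a b = {f \<in> borel_measurable borel.
     integrable lborel (\<lambda>x. (f x)\<^sup>2) \<and> (\<forall>x. x \<notin> {a<..<b} \<longrightarrow> f x = 0)}"

text \<open>The value \<open>B 0\<close> is irrelevant, since the diagonal is a null set.\<close>

definition B_form :: "(real \<Rightarrow> real) \<Rightarrow> (real \<Rightarrow> real) \<Rightarrow> (real \<Rightarrow> real) \<Rightarrow> real" where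
  "B_form B f g = (\<integral>(s, t). f s * g t * B (s - t) \<partial>(lborel \<Otimes>\<^sub>M lborel))"

text \<open>A completion is only determined up to a unique isometry: \<open>is_G B a b J\<close> says that the
  Hilbert space \<open>'h\<close>, with the canonical map \<open>J\<close> from \<open>L\<^sub>2(a,b)\<close>, is a completion of \<open>L\<^sub>2(a,b)\<close>
  with respect to the scalar product \<open>B_form B\<close>.\<close>

definition is_G ::
    "(real \<Rightarrow> real) \<Rightarrow> real \<Rightarrow> real \<Rightarrow> ((real \<Rightarrow> real) \<Rightarrow> 'h::{real_inner, complete_space}) \<Rightarrow> bool" where
  "is_G B a b J \<longleftrightarrow>
     (\<forall>f\<in>L2 a b. \<forall>g\<in>L2 a b. J (\<lambda>x. f x + g x) = J f + J g) \<and>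
     (\<forall>f\<in>L2 a b. \<forall>c. J (\<lambda>x. c * f x) = c *\<^sub>R J f) \<and>
     (\<forall>f\<in>L2 a b. \<forall>g\<in>L2 a b. J f \<bullet> J g = B_form B f g) \<and>
     closure (J ` L2 a b) = UNIV"

text \<open>\<open>G\<^sub>c\<^sub>,\<^sub>d\<close> as a subspace of the completion \<open>G\<^sub>a\<^sub>,\<^sub>b\<close> with canonical map \<open>J\<close>,
  for \<open>(c,d) \<subseteq> (a,b)\<close>.\<close>

definition G_sub ::
    "((real \<Rightarrow> real) \<Rightarrow> 'h::{real_inner, complete_space}) \<Rightarrow> real \<Rightarrow> real \<Rightarrow> 'h set" where
  "G_sub J c d = closure (J ` L2 c d)"

end

theory Submission
  imports Defs "HOL-Real_Asymp.Real_Asymp"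
begin

text \<open>Let \<open>H1\<close>, \<open>H2\<close> be the two subspaces of \<open>H = G\<^sub>a\<^sub>,\<^sub>b\<close>, \<open>a < 0 < b\<close>. A pair of closed subspaces
  with dense sum is an FHS decomposition as soon as \<open>H1 \<inter> H2 = 0\<close> and the restriction of the
  scalar product to \<open>H1 \<times> H2\<close> is Hilbert-Schmidt.

  Lower bound for the norm: near \<open>0\<close> the kernel is a mixture of triangles \<open>(r - |t|)\<^sup>+\<close> with density \<open>B''\<close>,
  up to a bounded remainder that is positive definite by Polya's criterion. Hence the squared norm of \<open>f\<close>
  dominates the integral of \<open>B''(r)\<close> times the squared integral of \<open>f\<close> over \<open>[x, x + r]\<close>, and tensors
  \<open>\<Sum>\<^sub>i f\<^sub>i \<otimes> g\<^sub>i\<close> satisfy the two-dimensional analogue. By duality, a Lipschitz kernel on the plane that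
  lives on scale \<open>v\<close> pairs with such tensors at the cost of one factor \<open>ln(1/v)\<^bsup>\<alpha>-1\<^esup>\<close>: approximate it by
  averages over windows of length at most \<open>v\<close>, then the error by averages over much shorter windows,
  and so on; the errors decay geometrically while the cost grows only polynomially.

  For \<open>s < 0 < t\<close> the cross kernel \<open>B(t - s)\<close> is cut into dyadic annuli. The piece at distance
  \<open>2\<^bsup>-n\<^esup>\<close> has dual norm \<open>O(n\<^bsup>-\<alpha>\<^esup> n\<^bsup>\<alpha>-1\<^esup>) = O(1/n)\<close>, and the pieces are almost orthogonal, so that
  the total is square summable: this is the Hilbert-Schmidt property. A vector \<open>x\<close> of \<open>H1 \<inter> H2\<close> is a limit
  both of functions on the left and of functions on the right half; every single piece annihilates
  \<open>x \<otimes> x\<close>, because the line \<open>s = 0\<close> has capacity zero. Hence the squared norm of \<open>x\<close> vanishes.\<close>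

section \<open>Hilbert-Schmidt operators on closed subspaces\<close>

text \<open>Whatever \<alpha> is, the pieces have the critical size: \<open>1/n\<close> is square
  summable but not summable. The triangle inequality over the pieces therefore fails, and the
  estimate closes only because the energy of a tensor is an integral over the plane, so that annuli
  with bounded overlap share it. No tensor product space is built. The squared norm of a tensor is
  replaced throughout by its Gram expression, the double sum of
  \<open>(f i \<bullet> f j) * (g i \<bullet> g j)\<close>, and the Hilbert-Schmidt property reads:
  the pairing is at most a constant times the square root of this expression. The lower bound for
  the norm sees window integrals only, never point values, so a Lipschitz kernel cannot be paired
  with a tensor directly. This is what forces the iterated smoothing. The Hilbert-Schmidt property
  alone does not make the sum map injective: a compact symmetric \<open>S\<close> may have the
  eigenvalue -1. Triviality of the intersection excludes it, and compactness then gives a positive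
  lower bound. Both facts come from one tail estimate for the series of pieces, with an error that
  tends to 0.\<close>

lemma closed_subspace_projection:
  fixes V :: "'a::{real_inner,complete_space} set"
  assumes V: "subspace V" "closed V"
  obtains p where "p \<in> V" "\<And>v. v \<in> V \<Longrightarrow> (x - p) \<bullet> v = 0"
proof -
  define D where "D = (\<lambda>v. (norm (x - v))\<^sup>2) ` V"
  have V0: "0 \<in> V" using V(1) subspace_0 by blast
  have Dne: "D \<noteq> {}" using V0 by (auto simp: D_def)
  have Dbd: "bdd_below D" unfolding D_def by (rule bdd_belowI[of _ 0]) auto
  define d where "d = Inf D"
  have dle: "d \<le> (norm (x - v))\<^sup>2" if "v \<in> V" for v
    unfolding d_def by (rule cInf_lower) (use that Dbd in \<open>auto simp: D_def\<close>)
  have "\<exists>v\<in>V. (norm (x - v))\<^sup>2 < d + 1 / Suc n" for n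
    using cInf_lessD[OF Dne, of "d + 1 / Suc n"] by (auto simp: D_def d_def)
  then obtain v where v: "\<And>n. v n \<in> V" "\<And>n. (norm (x - v n))\<^sup>2 < d + 1 / Suc n" by metis
  \<comment> \<open>The midpoint of two almost minimizing points lies in \<open>V\<close>, so the
    parallelogram identity converts almost minimality into the Cauchy property.\<close>
  have par: "(norm (v m - v n))\<^sup>2 \<le> 2 / Suc m + 2 / Suc n" for m n
  proof -
    have "(1/2) *\<^sub>R (v m + v n) \<in> V" using V v by (simp add: subspace_add subspace_scale)
    from dle[OF this] have 1: "d \<le> (norm (x - (1/2) *\<^sub>R (v m + v n)))\<^sup>2" .
    have "(norm (v m - v n))\<^sup>2 + 4 * (norm (x - (1/2) *\<^sub>R (v m + v n)))\<^sup>2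
        = 2 * (norm (x - v m))\<^sup>2 + 2 * (norm (x - v n))\<^sup>2"
      by (simp add: power2_norm_eq_inner inner_simps inner_commute algebra_simps)
    with 1 v(2)[of m] v(2)[of n] show ?thesis by linarith
  qed
  have "Cauchy v"
  proof (rule metric_CauchyI)
    fix e :: real assume e: "0 < e"
    obtain N where N: "inverse (real (Suc N)) < e\<^sup>2 / 4"
      using reals_Archimedean[of "e\<^sup>2/4"] e by auto
    show "\<exists>M. \<forall>m\<ge>M. \<forall>n\<ge>M. dist (v m) (v n) < e"
    proof (intro exI allI impI)
      fix m n assume mn: "m \<ge> N" "n \<ge> N"
      have "1 / real (Suc k) \<le> 1 / real (Suc N)" if "k \<ge> N" for k
        using that by (simp add: frac_le)
      from this[OF mn(1)] this[OF mn(2)] have "(norm (v m - v n))\<^sup>2 < e\<^sup>2"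
        using par[of m n] N by (simp add: inverse_eq_divide)
      then show "dist (v m) (v n) < e"
        using e by (simp add: dist_norm power_less_imp_less_base)
    qed
  qed
  then obtain p where p: "v \<longlonglongrightarrow> p" using Cauchy_convergent_iff convergent_def by blast
  have pV: "p \<in> V" using closed_sequentially[OF V(2) _ p] v by blast
  have "(norm (x - p))\<^sup>2 \<le> d"
  proof (rule LIMSEQ_le)
    show "(\<lambda>n. (norm (x - v n))\<^sup>2) \<longlonglongrightarrow> (norm (x - p))\<^sup>2" by (intro tendsto_intros p)
    show "(\<lambda>n. d + 1 / real (Suc n)) \<longlonglongrightarrow> d"
      using tendsto_add[OF tendsto_const[of d] LIMSEQ_Suc[OF lim_inverse_n']] by simp
    show "\<exists>N. \<forall>n\<ge>N. (norm (x - v n))\<^sup>2 \<le> d + 1 / real (Suc n)" using v(2) less_imp_le by blast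
  qed
  then have pm: "(norm (x - p))\<^sup>2 \<le> (norm (x - w))\<^sup>2" if "w \<in> V" for w using dle[OF that] by linarith
  have "(x - p) \<bullet> w = 0" if w: "w \<in> V" for w
  proof (cases "w = 0")
    case False
    define t where "t = ((x - p) \<bullet> w) / (w \<bullet> w)"
    have "p + t *\<^sub>R w \<in> V" using V pV w by (simp add: subspace_add subspace_scale)
    from pm[OF this] have "(norm (x - p))\<^sup>2 \<le> (norm ((x - p) - t *\<^sub>R w))\<^sup>2" by (simp add: algebra_simps)
    also have "\<dots> = (norm (x - p))\<^sup>2 - 2 * t * ((x - p) \<bullet> w) + t * t * (w \<bullet> w)"
      unfolding power2_norm_eq_inner inner_diff_left[of "x-p" "t *\<^sub>R w"]
        inner_diff_right[of _ "x-p" "t *\<^sub>R w"] by (simp add: inner_commute algebra_simps)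
    also have "\<dots> = (norm (x - p))\<^sup>2 - ((x - p) \<bullet> w)\<^sup>2 / (w \<bullet> w)"
      using False by (simp add: t_def field_simps power2_eq_square)
    finally have "((x - p) \<bullet> w)\<^sup>2 / (w \<bullet> w) \<le> 0" by simp
    moreover have "w \<bullet> w > 0" using False by simp
    ultimately show ?thesis by (simp add: divide_le_0_iff)
  qed simp
  with pV that show thesis by blast
qed

definition orth_proj :: "'a::{real_inner,complete_space} set \<Rightarrow> 'a \<Rightarrow> 'a" where
  "orth_proj V x = (SOME p. p \<in> V \<and> (\<forall>v\<in>V. (x - p) \<bullet> v = 0))"

context
  fixes V :: "'a::{real_inner,complete_space} set"
  assumes V: "subspace V" "closed V"
begin

lemma orth_proj: "orth_proj V x \<in> V" "v \<in> V \<Longrightarrow> (x - orth_proj V x) \<bullet> v = 0"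
proof -
  have "\<exists>p. p \<in> V \<and> (\<forall>v\<in>V. (x - p) \<bullet> v = 0)" using closed_subspace_projection[OF V, of x] by metis
  from someI_ex[OF this] show "orth_proj V x \<in> V" "v \<in> V \<Longrightarrow> (x - orth_proj V x) \<bullet> v = 0"
    unfolding orth_proj_def by auto
qed

lemma orth_proj_inner: "v \<in> V \<Longrightarrow> orth_proj V x \<bullet> v = x \<bullet> v"
  using orth_proj(2)[of v x] by (simp add: inner_diff_left)

lemma orth_proj_unique:
  assumes "p \<in> V" "\<And>v. v \<in> V \<Longrightarrow> p \<bullet> v = x \<bullet> v"
  shows "orth_proj V x = p"
proof -
  have "orth_proj V x - p \<in> V" using assms orth_proj V by (simp add: subspace_diff)
  then have "(orth_proj V x - p) \<bullet> (orth_proj V x - p) = 0"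
    using assms(2) orth_proj_inner by (simp add: inner_diff_left)
  then show ?thesis by simp
qed

lemma linear_orth_proj: "linear (orth_proj V)"
proof (rule linearI)
  fix x y c
  show "orth_proj V (x + y) = orth_proj V x + orth_proj V y"
    by (rule orth_proj_unique) (use V orth_proj orth_proj_inner in \<open>auto simp: subspace_add inner_add_left\<close>)
  show "orth_proj V (c *\<^sub>R x) = c *\<^sub>R orth_proj V x"
    by (rule orth_proj_unique) (use V orth_proj orth_proj_inner in \<open>auto simp: subspace_scale\<close>)
qed

end

text \<open>The induction splits off the direction of one of the vectors.\<close>

lemma gram_factorization:
  fixes x :: "'i \<Rightarrow> 'a::real_inner"
  assumes "finite I"
  shows "\<exists>c :: 'i \<Rightarrow> 'i \<Rightarrow> real. \<forall>i\<in>I. \<forall>j\<in>I. x i \<bullet> x j = (\<Sum>a\<in>I. c a i * c a j)"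
  using assms
proof (induction I arbitrary: x rule: finite_induct)
  case empty then show ?case by simp
next
  case (insert k I)
  \<comment> \<open>Since \<open>sgn 0 = 0\<close>, a vanishing \<open>x k\<close> needs no separate
    case: then \<open>y\<close> is \<open>x\<close> and the new row of \<open>c'\<close> is
    zero.\<close>
  define w where "w = sgn (x k)"
  define y where "y i = x i - (x i \<bullet> w) *\<^sub>R w" for i
  obtain c where c: "\<forall>i\<in>I. \<forall>j\<in>I. y i \<bullet> y j = (\<Sum>a\<in>I. c a i * c a j)" using insert.IH by blast
  have ww: "w \<bullet> w = (if x k = 0 then 0 else 1)" by (auto simp: w_def norm_sgn power2_norm_eq_inner[symmetric])
  have yw: "x k \<noteq> 0 \<or> w = 0" by (auto simp: w_def)
  have yk: "y k = 0"
  proof (cases "x k = 0")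
    case False
    then have "x k \<bullet> w = norm (x k)"
      by (simp add: w_def sgn_div_norm power2_norm_eq_inner[symmetric] power2_eq_square)
    then show ?thesis using False by (simp add: y_def w_def sgn_div_norm)
  qed (auto simp: y_def w_def)
  have xy: "x i \<bullet> x j = y i \<bullet> y j + (x i \<bullet> w) * (x j \<bullet> w)" for i j
    using yw ww unfolding y_def by (auto simp: inner_simps inner_commute algebra_simps)
  define c' where "c' a i = (if a = k then x i \<bullet> w else if i = k then 0 else c a i)" for a i
  have "x i \<bullet> x j = (\<Sum>a\<in>insert k I. c' a i * c' a j)" if "i \<in> insert k I" "j \<in> insert k I" for i j
  proof -
    have "(\<Sum>a\<in>I. c' a i * c' a j) = y i \<bullet> y j"
    proof (cases "i = k \<or> j = k")
      case True
      then have "(\<Sum>a\<in>I. c' a i * c' a j) = 0"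
        using insert.hyps(2) by (intro sum.neutral) (auto simp: c'_def)
      with True yk show ?thesis by auto
    next
      case False
      then show ?thesis using c that insert.hyps(2)
        by (auto simp: c'_def intro!: sum.cong)
    qed
    then show ?thesis using insert.hyps xy by (simp add: c'_def)
  qed
  then show ?case by blast
qed

text \<open>Schur's product theorem: the sum is the squared norm of the tensor built from the pairs
  \<open>x i\<close>, \<open>y i\<close>. Factoring one of the two Gram matrices turns it into a sum
  of squares.\<close>

lemma gram_product_nonneg:
  fixes x :: "'i \<Rightarrow> 'a::real_inner" and y :: "'i \<Rightarrow> 'b::real_inner"
  assumes "finite I"
  shows "0 \<le> (\<Sum>i\<in>I. \<Sum>j\<in>I. (x i \<bullet> x j) * (y i \<bullet> y j))"
proof -
  obtain c :: "'i \<Rightarrow> 'i \<Rightarrow> real" where c: "\<forall>i\<in>I. \<forall>j\<in>I. x i \<bullet> x j = (\<Sum>a\<in>I. c a i * c a j)"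
    using gram_factorization[OF assms] by blast
  have "(\<Sum>i\<in>I. \<Sum>j\<in>I. (x i \<bullet> x j) * (y i \<bullet> y j))
      = (\<Sum>i\<in>I. \<Sum>j\<in>I. \<Sum>a\<in>I. (c a i *\<^sub>R y i) \<bullet> (c a j *\<^sub>R y j))"
    using c by (intro sum.cong refl) (simp add: sum_distrib_left mult_ac)
  also have "\<dots> = (\<Sum>i\<in>I. \<Sum>a\<in>I. \<Sum>j\<in>I. (c a i *\<^sub>R y i) \<bullet> (c a j *\<^sub>R y j))"
    by (intro sum.cong refl sum.swap)
  also have "\<dots> = (\<Sum>a\<in>I. \<Sum>i\<in>I. \<Sum>j\<in>I. (c a i *\<^sub>R y i) \<bullet> (c a j *\<^sub>R y j))"
    by (rule sum.swap)
  also have "\<dots> = (\<Sum>a\<in>I. (\<Sum>i\<in>I. c a i *\<^sub>R y i) \<bullet> (\<Sum>i\<in>I. c a i *\<^sub>R y i))"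
    by (simp add: inner_sum_left inner_sum_right sum_distrib_left mult_ac inner_commute)
  also have "\<dots> \<ge> 0" by (intro sum_nonneg) simp
  finally show ?thesis .
qed

section \<open>Hilbert-Schmidt bounds, compactness and the spectral theorem\<close>

definition orthonormal_family :: "nat \<Rightarrow> (nat \<Rightarrow> 'a::real_inner) \<Rightarrow> bool" where
  "orthonormal_family n z \<longleftrightarrow> (\<forall>i<n. \<forall>j<n. z i \<bullet> z j = (if i = j then 1 else 0))"

text \<open>\<open>M\<close> bounds the squared Hilbert-Schmidt norm of \<open>S\<close> on
  \<open>V\<close>. Testing finite orthonormal systems requires no choice of a basis, and the same
  \<open>M\<close> serves every smaller subspace.\<close>

definition hs_on :: "'a::real_inner set \<Rightarrow> ('a \<Rightarrow> 'a) \<Rightarrow> real \<Rightarrow> bool" where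
  "hs_on V S M \<longleftrightarrow> (\<forall>n z. (\<forall>i<n. z i \<in> V) \<and> orthonormal_family n z \<longrightarrow> (\<Sum>i<n. (norm (S (z i)))\<^sup>2) \<le> M)"

lemma hs_on_subset: "hs_on V S M \<Longrightarrow> W \<subseteq> V \<Longrightarrow> hs_on W S M"
  unfolding hs_on_def by blast

lemma hs_on_bound:
  assumes "hs_on V S M" "subspace V" "linear S" "x \<in> V"
  shows "(norm (S x))\<^sup>2 \<le> M * (norm x)\<^sup>2"
proof (cases "x = 0")
  case True then show ?thesis using linear_0[OF assms(3)] by simp
next
  case False
  have "(\<Sum>i<1. (norm (S ((\<lambda>_::nat. sgn x) i)))\<^sup>2) \<le> M"
    using assms(1) unfolding hs_on_def
    by (elim allE[of _ "1::nat"] allE[of _ "\<lambda>_. sgn x"] impE)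
      (use False assms in \<open>auto simp: orthonormal_family_def norm_sgn sgn_div_norm subspace_scale
        power2_norm_eq_inner[symmetric] power2_eq_square\<close>)
  then have "(norm (S (sgn x)))\<^sup>2 \<le> M" by simp
  moreover have "S x = norm x *\<^sub>R S (sgn x)"
    using False by (simp add: linear_cmul[OF assms(3), symmetric] sgn_div_norm)
  ultimately show ?thesis
    using mult_left_mono[of "(norm (S (sgn x)))\<^sup>2" M "(norm x)\<^sup>2"] by (simp add: power_mult_distrib mult_ac)
qed

text \<open>A system whose sum is within \<open>\<delta>^2\<close> of the supremum leaves at most
  \<open>\<delta>^2\<close> for any further unit vector orthogonal to it. In effect \<open>S\<close>
  is approximated by operators of finite rank.\<close>

lemma hs_on_approx:
  assumes hs: "hs_on V S M" and V: "subspace V" and S: "linear S" and d: "\<delta> > 0"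
  obtains n z where "\<forall>i<n. z i \<in> V" "orthonormal_family n z"
    "\<And>x. x \<in> V \<Longrightarrow> (\<And>i. i < n \<Longrightarrow> x \<bullet> z i = 0) \<Longrightarrow> norm (S x) \<le> \<delta> * norm x"
proof -
  define A where "A = {(\<Sum>i<n. (norm (S (z i)))\<^sup>2) | n z. (\<forall>i<n. z i \<in> V) \<and> orthonormal_family n z}"
  have "0 \<in> A" unfolding A_def by (rule CollectI, rule exI[of _ 0]) (auto simp: orthonormal_family_def)
  have bdd: "bdd_above A" unfolding A_def by (rule bdd_aboveI[of _ M]) (use hs in \<open>auto simp: hs_on_def\<close>)
  have "\<exists>a\<in>A. Sup A - \<delta>\<^sup>2 < a"
    using less_cSupD[of A "Sup A - \<delta>\<^sup>2"] \<open>0 \<in> A\<close> d by auto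
  then obtain n z where nz: "\<forall>i<n. z i \<in> V" "orthonormal_family n z"
    "Sup A - \<delta>\<^sup>2 < (\<Sum>i<n. (norm (S (z i)))\<^sup>2)" unfolding A_def by blast
  have "norm (S x) \<le> \<delta> * norm x" if x: "x \<in> V" "\<And>i. i < n \<Longrightarrow> x \<bullet> z i = 0" for x
  proof (cases "x = 0")
    case True then show ?thesis using linear_0[OF S] by simp
  next
    case False
    define z' where "z' i = (if i = n then sgn x else z i)" for i
    have "sgn x \<in> V" using V x by (simp add: sgn_div_norm subspace_scale)
    then have "\<forall>i<Suc n. z' i \<in> V" using nz by (auto simp: z'_def less_Suc_eq)
    moreover have "orthonormal_family (Suc n) z'"
    proof -
      have *: "sgn x \<bullet> z i = 0" "z i \<bullet> sgn x = 0" if "i < n" for i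
        using x(2)[OF that] by (auto simp: sgn_div_norm inner_commute)
      have "sgn x \<bullet> sgn x = 1" using False by (simp add: norm_sgn power2_norm_eq_inner[symmetric])
      with nz(2) * show ?thesis by (auto simp: orthonormal_family_def z'_def less_Suc_eq)
    qed
    ultimately have "(\<Sum>i<Suc n. (norm (S (z' i)))\<^sup>2) \<in> A" unfolding A_def by blast
    then have "(\<Sum>i<Suc n. (norm (S (z' i)))\<^sup>2) \<le> Sup A" using bdd by (rule cSup_upper)
    moreover have "(\<Sum>i<n. (norm (S (z' i)))\<^sup>2) = (\<Sum>i<n. (norm (S (z i)))\<^sup>2)"
      by (intro sum.cong) (auto simp: z'_def)
    moreover have "z' n = sgn x" by (simp add: z'_def)
    ultimately have "(norm (S (sgn x)))\<^sup>2 \<le> \<delta>\<^sup>2" using nz(3) unfolding sum.lessThan_Suc by simp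
    then have "norm (S (sgn x)) \<le> \<delta>" using d by (auto intro: power2_le_imp_le)
    moreover have "S x = norm x *\<^sub>R S (sgn x)"
      using False by (simp add: linear_cmul[OF S, symmetric] sgn_div_norm)
    ultimately show ?thesis
      using mult_left_mono[of "norm (S (sgn x))" \<delta> "norm x"] by (simp add: mult_ac)
  qed
  with nz that show thesis by blast
qed

text \<open>Such sets contain the finite-rank part of \<open>S\<close> on the unit ball. Each new
  vector adds a segment, and sums of compact sets are compact.\<close>

lemma compact_coefficient_sums:
  fixes v :: "nat \<Rightarrow> 'a::real_normed_vector"
  shows "compact {\<Sum>i<n. c i *\<^sub>R v i | c. \<forall>i<n. \<bar>c i\<bar> \<le> 1}"
proof (induction n)
  case 0
  have "{\<Sum>i<0. c i *\<^sub>R v i | c. \<forall>i<0::nat. \<bar>c i::real\<bar> \<le> 1} = {0}" by auto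
  then show ?case by simp
next
  case (Suc n)
  let ?A = "{\<Sum>i<n. c i *\<^sub>R v i | c. \<forall>i<n. \<bar>c i\<bar> \<le> 1}"
  let ?B = "(\<lambda>t. t *\<^sub>R v n) ` {-1..1}"
  have "compact ?B" by (intro compact_continuous_image continuous_intros) auto
  then have "compact {x + y | x y. x \<in> ?A \<and> y \<in> ?B}" using Suc.IH by (intro compact_sums)
  also have "{x + y | x y. x \<in> ?A \<and> y \<in> ?B} = {\<Sum>i<Suc n. c i *\<^sub>R v i | c. \<forall>i<Suc n. \<bar>c i\<bar> \<le> 1}"
  proof (intro equalityI subsetI)
    fix w assume "w \<in> {x + y | x y. x \<in> ?A \<and> y \<in> ?B}"
    then obtain c t where ct: "w = (\<Sum>i<n. c i *\<^sub>R v i) + t *\<^sub>R v n" "\<forall>i<n. \<bar>c i\<bar> \<le> 1" "t \<in> {-1..1}" by auto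
    have "w = (\<Sum>i<Suc n. (c(n := t)) i *\<^sub>R v i)"
      unfolding ct(1) sum.lessThan_Suc by (intro arg_cong2[where f = "(+)"] sum.cong) auto
    moreover have "\<forall>i<Suc n. \<bar>(c(n := t)) i\<bar> \<le> 1" using ct by (auto simp: less_Suc_eq)
    ultimately show "w \<in> {\<Sum>i<Suc n. c i *\<^sub>R v i | c. \<forall>i<Suc n. \<bar>c i\<bar> \<le> 1}" by blast
  next
    fix w assume "w \<in> {\<Sum>i<Suc n. c i *\<^sub>R v i | c. \<forall>i<Suc n. \<bar>c i\<bar> \<le> 1}"
    then obtain c where c: "w = (\<Sum>i<Suc n. c i *\<^sub>R v i)" "\<forall>i<Suc n. \<bar>c i\<bar> \<le> 1" by blast
    then have "(\<Sum>i<n. c i *\<^sub>R v i) \<in> ?A" "c n *\<^sub>R v n \<in> ?B" by (auto simp: abs_le_iff)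
    with c(1) show "w \<in> {x + y | x y. x \<in> ?A \<and> y \<in> ?B}" by auto
  qed
  finally show ?case .
qed

lemma hs_on_compact:
  fixes S :: "'a::{real_inner,complete_space} \<Rightarrow> 'a"
  assumes hs: "hs_on V S M" and V: "subspace V" and S: "linear S"
  shows "compact (closure (S ` (V \<inter> cball 0 1)))"
  unfolding compact_eq_totally_bounded
proof (intro conjI allI impI)
  show "complete (closure (S ` (V \<inter> cball 0 1)))" by (simp add: complete_eq_closed)
  fix e :: real assume "0 < e"
  \<comment> \<open>Image points come within \<open>2 * d\<close> of a finite net: \<open>d\<close>
    for the finite-rank part, \<open>d\<close> for the rest. Closed balls of radius
    \<open>3 * d\<close> absorb the closure and still fit into open balls of radius
    \<open>e\<close>.\<close>
  define d where "d = e / 4"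
  have d: "0 < d" using \<open>0 < e\<close> by (simp add: d_def)
  obtain n z where z: "\<forall>i<n. z i \<in> V" "orthonormal_family n z"
    "\<And>x. x \<in> V \<Longrightarrow> (\<And>i. i < n \<Longrightarrow> x \<bullet> z i = 0) \<Longrightarrow> norm (S x) \<le> d * norm x"
    using hs_on_approx[OF hs V S d] by blast
  let ?C = "{\<Sum>i<n. c i *\<^sub>R S (z i) | c. \<forall>i<n. \<bar>c i\<bar> \<le> 1}"
  obtain k where k: "finite k" "?C \<subseteq> (\<Union>x\<in>k. ball x d)"
    using compact_coefficient_sums[where n = n and v = "\<lambda>i. S (z i)"] d unfolding compact_eq_totally_bounded by blast
  have sub: "S ` (V \<inter> cball 0 1) \<subseteq> (\<Union>x\<in>k. cball x (3 * d))"
  proof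
    fix y assume "y \<in> S ` (V \<inter> cball 0 1)"
    then obtain x where x: "y = S x" "x \<in> V" "norm x \<le> 1" by auto
    define p where "p = (\<Sum>i<n. (x \<bullet> z i) *\<^sub>R z i)"
    have zz: "z i \<bullet> z j = (if i = j then 1 else 0)" if "i < n" "j < n" for i j
      using z(2) that by (auto simp: orthonormal_family_def)
    have px: "p \<bullet> z j = x \<bullet> z j" if "j < n" for j
    proof -
      have "p \<bullet> z j = (\<Sum>i<n. (x \<bullet> z i) * (if i = j then 1 else 0))"
        unfolding p_def inner_sum_left using that zz by (intro sum.cong) auto
      then show ?thesis using that by (simp add: if_distrib cong: if_cong)
    qed
    have "p \<in> V" unfolding p_def using V z by (intro subspace_sum subspace_scale) auto
    then have xpV: "x - p \<in> V" using V x by (simp add: subspace_diff)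
    have 1: "norm (S (x - p)) \<le> d * norm (x - p)"
      by (rule z(3)[OF xpV]) (simp add: inner_diff_left px)
    have "(x - p) \<bullet> p = 0" unfolding p_def inner_sum_right
      by (intro sum.neutral) (auto simp: inner_diff_left px p_def[symmetric])
    then have "(norm x)\<^sup>2 = (norm (x - p))\<^sup>2 + (norm p)\<^sup>2"
      by (simp add: power2_norm_eq_inner inner_simps inner_commute)
    then have "(norm (x - p))\<^sup>2 \<le> (norm x)\<^sup>2" by simp
    then have "norm (x - p) \<le> norm x" by (rule power2_le_imp_le) simp
    then have "norm (S (x - p)) \<le> d" using 1 x(3) d mult_left_mono[of "norm (x - p)" 1 d] by linarith
    moreover have "S p = (\<Sum>i<n. (x \<bullet> z i) *\<^sub>R S (z i))"
      by (simp add: p_def linear_sum[OF S] linear_cmul[OF S])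
    moreover have "\<bar>x \<bullet> z i\<bar> \<le> 1" if "i < n" for i
    proof -
      have "norm (z i) = 1" using zz[OF that that] by (simp add: norm_eq_sqrt_inner)
      then show ?thesis using Cauchy_Schwarz_ineq2[of x "z i"] x by simp
    qed
    ultimately have "S p \<in> ?C" by (intro CollectI exI[of _ "\<lambda>i. x \<bullet> z i"]) auto
    then obtain c where c: "c \<in> k" "dist c (S p) < d" using k by auto
    have "dist c y \<le> dist c (S p) + norm (S (x - p))"
      using dist_triangle[of c y "S p"] by (simp add: x(1) linear_diff[OF S] dist_norm norm_minus_commute)
    then have "dist c y \<le> 3 * d" using c \<open>norm (S (x - p)) \<le> d\<close> d by linarith
    with c show "y \<in> (\<Union>x\<in>k. cball x (3 * d))" by auto
  qed
  have "closed (\<Union>x\<in>k. cball x (3 * d))" using k by (intro closed_UN) auto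
  then have "closure (S ` (V \<inter> cball 0 1)) \<subseteq> (\<Union>x\<in>k. cball x (3 * d))" by (rule closure_minimal[OF sub])
  also have "\<dots> \<subseteq> (\<Union>x\<in>k. ball x e)" using d by (auto simp: d_def)
  finally show "\<exists>k. finite k \<and> closure (S ` (V \<inter> cball 0 1)) \<subseteq> (\<Union>x\<in>k. ball x e)" using k by blast
qed

text \<open>The Rayleigh quotient is maximized. With \<open>m\<close> its supremum,
  \<open>m - S\<close> defines a positive semidefinite form on \<open>V\<close>, and Cauchy-Schwarz
  for this form makes a maximizing sequence consist of approximate eigenvectors. Compactness gives a
  limit of the images, and \<open>m > 0\<close> allows the vectors themselves to be recovered from
  it.\<close>

lemma hs_on_max_eigenvector:
  fixes S :: "'a::{real_inner,complete_space} \<Rightarrow> 'a"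
  assumes hs: "hs_on V S M" and V: "subspace V" "closed V" and S: "linear S"
    and SV: "\<And>z. z \<in> V \<Longrightarrow> S z \<in> V"
    and sym: "\<And>z w. z \<in> V \<Longrightarrow> w \<in> V \<Longrightarrow> S z \<bullet> w = z \<bullet> S w"
    and pos: "z0 \<in> V" "S z0 \<bullet> z0 > 0"
  obtains m z where "m > 0" "z \<in> V" "norm z = 1" "S z = m *\<^sub>R z"
    "\<And>w. w \<in> V \<Longrightarrow> S w \<bullet> w \<le> m * (norm w)\<^sup>2"
proof -
  have M: "(norm (S x))\<^sup>2 \<le> M * (norm x)\<^sup>2" if "x \<in> V" for x using hs_on_bound[OF hs V(1) S that] .
  define A where "A = {S z \<bullet> z | z. z \<in> V \<and> norm z = 1}"
  have z0: "z0 \<noteq> 0" using pos linear_0[OF S] by auto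
  have nS: "norm (S z) \<le> sqrt M * norm z" if "z \<in> V" for z
    using M[OF that] by (metis norm_ge_zero real_sqrt_le_mono real_sqrt_mult real_sqrt_unique)
  have a0: "S (sgn z0) \<bullet> sgn z0 \<in> A"
  proof -
    have "sgn z0 \<in> V" "norm (sgn z0) = 1"
      using z0 pos V by (simp_all add: sgn_div_norm subspace_scale)
    then show ?thesis unfolding A_def by blast
  qed
  have a0p: "S (sgn z0) \<bullet> sgn z0 > 0"
    using pos z0 by (simp add: sgn_div_norm linear_cmul[OF S])
  have bdd: "bdd_above A"
  proof (rule bdd_aboveI[of _ "sqrt M"])
    fix a assume "a \<in> A"
    then obtain z where z: "a = S z \<bullet> z" "z \<in> V" "norm z = 1" by (auto simp: A_def)
    then show "a \<le> sqrt M" using nS[of z] Cauchy_Schwarz_ineq2[of "S z" z] by auto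
  qed
  define m where "m = Sup A"
  have m: "m > 0" using cSup_upper[OF a0 bdd] a0p by (simp add: m_def)
  have mle: "S w \<bullet> w \<le> m * (norm w)\<^sup>2" if w: "w \<in> V" for w
  proof (cases "w = 0")
    case True then show ?thesis using linear_0[OF S] by simp
  next
    case False
    have "S (sgn w) \<bullet> sgn w \<in> A"
    proof -
      have "sgn w \<in> V" "norm (sgn w) = 1"
        using w False V by (simp_all add: sgn_div_norm subspace_scale)
      then show ?thesis unfolding A_def by blast
    qed
    then have "S (sgn w) \<bullet> sgn w \<le> m" unfolding m_def using bdd by (rule cSup_upper)
    then show ?thesis using False
      by (simp add: sgn_div_norm linear_cmul[OF S] field_simps power2_eq_square)
  qed
  have "\<exists>a\<in>A. m - 1 / Suc n < a" for n
    using less_cSupD[of A "m - 1 / Suc n"] a0 by (auto simp: m_def)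
  then have "\<exists>z. z \<in> V \<and> norm z = 1 \<and> m - 1 / Suc n < S z \<bullet> z" for n unfolding A_def by blast
  then obtain z where z: "\<And>n. z n \<in> V" "\<And>n. norm (z n) = 1" "\<And>n. m - 1 / Suc n < S (z n) \<bullet> z n" by metis
  define C where "C = m + sqrt M"
  have key: "(norm (m *\<^sub>R z n - S (z n)))\<^sup>2 \<le> C * (1 / Suc n)" for n
  proof -
    define q where "q x y = m * (x \<bullet> y) - S x \<bullet> y" for x y
    define w where "w = m *\<^sub>R z n - S (z n)"
    have wV: "w \<in> V" unfolding w_def using V z SV by (simp add: subspace_diff subspace_scale)
    have q0: "q x x \<ge> 0" if "x \<in> V" for x using mle[OF that] by (simp add: q_def power2_norm_eq_inner)
    have cs: "(q (z n) w)\<^sup>2 \<le> q (z n) (z n) * q w w"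
    proof -
      have "0 \<le> q (z n + t *\<^sub>R w) (z n + t *\<^sub>R w)" for t
        using q0 V z wV by (simp add: subspace_add subspace_scale)
      moreover have "q (z n + t *\<^sub>R w) (z n + t *\<^sub>R w)
          = q (z n) (z n) + 2 * t * q (z n) w + t\<^sup>2 * q w w" for t
        using sym[OF z(1)[of n] wV]
        by (simp add: q_def linear_add[OF S] linear_cmul[OF S] inner_simps inner_commute
            algebra_simps power2_eq_square)
      ultimately have quad: "0 \<le> q (z n) (z n) + 2 * t * q (z n) w + t\<^sup>2 * q w w" for t by metis
      show ?thesis
      proof (cases "q w w = 0")
        case True
        have "q (z n) w = 0"
        proof (rule ccontr)
          assume "q (z n) w \<noteq> 0"
          \<comment> \<open>The form is only semidefinite. For \<open>q w w = 0\<close> the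
            quadratic polynomial is affine in \<open>t\<close>, and this argument gives it the value
            -1.\<close>
          with quad[of "- (q (z n) (z n) + 1) / (2 * q (z n) w)"] True show False by (simp add: divide_simps)
        qed
        with True show ?thesis by simp
      next
        case False
        with q0[OF wV] have p: "q w w > 0" by simp
        from quad[of "- q (z n) w / q w w"] show ?thesis
          using p by (simp add: field_simps power2_eq_square)
      qed
    qed
    have qzw: "q (z n) w = (norm w)\<^sup>2" by (simp add: q_def w_def power2_norm_eq_inner inner_simps inner_commute algebra_simps)
    have qww: "q w w \<le> C * (norm w)\<^sup>2"
    proof -
      have "- (S w \<bullet> w) \<le> norm (S w) * norm w" using Cauchy_Schwarz_ineq2[of "S w" w] by linarith
      also have "\<dots> \<le> sqrt M * norm w * norm w" using nS[OF wV] by (intro mult_right_mono) auto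
      finally show ?thesis by (simp add: q_def C_def algebra_simps power2_norm_eq_inner[symmetric] power2_eq_square)
    qed
    have qz: "0 \<le> q (z n) (z n)" "q (z n) (z n) \<le> 1 / Suc n"
      using q0[OF z(1)[of n]] z(2)[of n] z(3)[of n] by (simp_all add: q_def power2_norm_eq_inner[symmetric])
    have "((norm w)\<^sup>2)\<^sup>2 \<le> q (z n) (z n) * (C * (norm w)\<^sup>2)"
      using cs unfolding qzw using mult_left_mono[OF qww qz(1)] by linarith
    then have *: "(norm w)\<^sup>2 * (norm w)\<^sup>2 \<le> (C * q (z n) (z n)) * (norm w)\<^sup>2"
      by (simp add: power2_eq_square[of "(norm w)\<^sup>2"] mult_ac)
    have C0: "C \<ge> 0"
      using m order_trans[OF norm_ge_zero nS[OF z(1)[of 0]]] z(2)[of 0] unfolding C_def by simp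
    have "(norm w)\<^sup>2 \<le> C * q (z n) (z n)"
    proof (cases "w = 0")
      case False
      with * show ?thesis by (simp only: mult_le_cancel_right) simp
    qed (use C0 qz in simp)
    also have "C * q (z n) (z n) \<le> C * (1 / Suc n)" using C0 qz by (intro mult_left_mono) auto
    finally show ?thesis unfolding w_def .
  qed
  have "S (z n) \<in> closure (S ` (V \<inter> cball 0 1))" for n
    by (rule subsetD[OF closure_subset]) (use z in auto)
  then obtain l r where lr: "strict_mono r" "((\<lambda>n. S (z n)) \<circ> r) \<longlonglongrightarrow> l"
    using hs_on_compact[OF hs V(1) S] unfolding compact_eq_seq_compact_metric seq_compact_def by metis
  have g0: "(\<lambda>n. C * (1 / real (Suc n))) \<longlonglongrightarrow> 0"
    using tendsto_mult[OF tendsto_const[of C] LIMSEQ_Suc[OF lim_inverse_n']] by simp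
  have "(\<lambda>n. (norm (m *\<^sub>R z n - S (z n)))\<^sup>2) \<longlonglongrightarrow> 0"
    by (rule Lim_null_comparison[OF _ g0]) (use key in auto)
  then have "(\<lambda>n. norm (m *\<^sub>R z n - S (z n))) \<longlonglongrightarrow> 0"
    using tendsto_real_sqrt[of _ 0] by fastforce
  then have d0: "(\<lambda>n. m *\<^sub>R z n - S (z n)) \<longlonglongrightarrow> 0" by (rule tendsto_norm_zero_cancel)
  have "(\<lambda>n. (1/m) *\<^sub>R ((m *\<^sub>R z (r n) - S (z (r n))) + S (z (r n)))) \<longlonglongrightarrow> (1/m) *\<^sub>R (0 + l)"
    using LIMSEQ_subseq_LIMSEQ[OF d0 lr(1)] lr(2) by (intro tendsto_intros) (auto simp: o_def)
  then have zl: "(\<lambda>n. z (r n)) \<longlonglongrightarrow> (1/m) *\<^sub>R l" using m by simp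
  define y where "y = (1/m) *\<^sub>R l"
  have yV: "y \<in> V" using closed_sequentially[OF V(2) _ zl] z by (simp add: y_def)
  have ny: "norm y = 1" using tendsto_norm[OF zl] z(2) unfolding y_def by (metis LIMSEQ_const_iff LIMSEQ_unique tendsto_const ext)
  have "(\<lambda>n. S (z (r n)) - S y) \<longlonglongrightarrow> 0"
  proof (rule Lim_null_comparison[where g = "\<lambda>n. sqrt M * norm (z (r n) - y)"])
    show "\<forall>\<^sub>F n in sequentially. norm (S (z (r n)) - S y) \<le> sqrt M * norm (z (r n) - y)"
      using nS V yV z by (auto simp: linear_diff[OF S, symmetric] subspace_diff)
    have "(\<lambda>n. sqrt M * norm (z (r n) - y)) \<longlonglongrightarrow> sqrt M * norm (y - y)"
      using zl unfolding y_def by (intro tendsto_intros)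
    then show "(\<lambda>n. sqrt M * norm (z (r n) - y)) \<longlonglongrightarrow> 0" by simp
  qed
  then have "(\<lambda>n. S (z (r n))) \<longlonglongrightarrow> S y" by (rule LIM_zero_cancel)
  then have "S y = l" using lr(2) LIMSEQ_unique by (auto simp: o_def)
  then have "S y = m *\<^sub>R y" using m by (simp add: y_def)
  then show thesis by (rule that[OF m yV ny _ mle])
qed

lemma subspace_closure_of_subspace:
  fixes S :: "'a::real_normed_vector set"
  assumes "subspace S"
  shows "subspace (closure S)"
proof (rule subspaceI)
  show "0 \<in> closure S" using assms closure_subset subspace_0 by blast
  fix x y :: 'a and c :: real assume "x \<in> closure S" "y \<in> closure S"
  then obtain f g where f: "\<And>n. f n \<in> S" "f \<longlonglongrightarrow> x" and g: "\<And>n. g n \<in> S" "g \<longlonglongrightarrow> y"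
    unfolding closure_sequential by metis
  show "x + y \<in> closure S" unfolding closure_sequential
    by (rule exI[of _ "\<lambda>n. f n + g n"]) (use f g assms in \<open>auto intro: tendsto_add subspace_add\<close>)
  show "c *\<^sub>R x \<in> closure S" unfolding closure_sequential
    by (rule exI[of _ "\<lambda>n. c *\<^sub>R f n"]) (use f assms in \<open>auto intro: tendsto_scaleR subspace_scale\<close>)
qed

text \<open>Zorn's lemma gives a maximal orthonormal set of eigenvectors. Its orthogonal complement
  \<open>W\<close> in \<open>V\<close> is invariant; by maximality neither \<open>S\<close> nor
  \<open>-S\<close> takes a positive Rayleigh value there, so \<open>S\<close> vanishes on
  \<open>W\<close>, and then every unit vector of \<open>W\<close> would be an eigenvector for
  0.\<close>

lemma hs_on_eigenbasis:
  fixes S :: "'a::{real_inner,complete_space} \<Rightarrow> 'a"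
  assumes hs: "hs_on V S M" and V: "subspace V" "closed V" and S: "linear S"
    and SV: "\<And>z. z \<in> V \<Longrightarrow> S z \<in> V"
    and sym: "\<And>z w. z \<in> V \<Longrightarrow> w \<in> V \<Longrightarrow> S z \<bullet> w = z \<bullet> S w"
  obtains E where "E \<subseteq> V" "\<And>e. e \<in> E \<Longrightarrow> norm e = 1"
    "\<And>e f. e \<in> E \<Longrightarrow> f \<in> E \<Longrightarrow> e \<noteq> f \<Longrightarrow> e \<bullet> f = 0"
    "\<And>e. e \<in> E \<Longrightarrow> \<exists>m. S e = m *\<^sub>R e" "closure (span E) = V"
proof -
  define P where "P E \<longleftrightarrow> E \<subseteq> V \<and> (\<forall>e\<in>E. norm e = 1 \<and> (\<exists>m. S e = m *\<^sub>R e)) \<and>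
    (\<forall>e\<in>E. \<forall>f\<in>E. e \<noteq> f \<longrightarrow> e \<bullet> f = 0)" for E
  have "\<exists>E\<in>Collect P. \<forall>X\<in>Collect P. E \<subseteq> X \<longrightarrow> X = E"
  proof (rule subset_Zorn')
    fix C assume C: "subset.chain (Collect P) C"
    then have CP: "\<And>X. X \<in> C \<Longrightarrow> P X" and tot: "\<And>X Y. X \<in> C \<Longrightarrow> Y \<in> C \<Longrightarrow> X \<subseteq> Y \<or> Y \<subseteq> X"
      by (auto simp: subset.chain_def)
    have "e \<bullet> f = 0" if ef: "e \<in> \<Union>C" "f \<in> \<Union>C" "e \<noteq> f" for e f
    proof -
      obtain X Y where "e \<in> X" "X \<in> C" "f \<in> Y" "Y \<in> C" using ef by auto
      with tot[of X Y] obtain Z where "Z \<in> C" "e \<in> Z" "f \<in> Z" by blast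
      with CP[of Z] \<open>e \<noteq> f\<close> show ?thesis by (auto simp: P_def)
    qed
    moreover have "\<Union>C \<subseteq> V" using CP unfolding P_def by (metis Union_least)
    moreover have "\<forall>e\<in>\<Union>C. norm e = 1 \<and> (\<exists>m. S e = m *\<^sub>R e)"
      using CP unfolding P_def by (metis UnionE)
    ultimately have "P (\<Union>C)" unfolding P_def by blast
    then show "\<Union>C \<in> Collect P" by simp
  qed
  then obtain E where E: "P E" and max: "\<And>X. P X \<Longrightarrow> E \<subseteq> X \<Longrightarrow> X = E" by auto
  define W where "W = {z \<in> V. \<forall>e\<in>E. z \<bullet> e = 0}"
  have subW: "subspace W" using V unfolding W_def
    by (auto simp: subspace_def inner_add_left)
  have "W = V \<inter> (\<Inter>e\<in>E. {z. z \<bullet> e = 0})" by (auto simp: W_def)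
  moreover have "closed {z. z \<bullet> e = 0}" for e :: 'a by (intro closed_Collect_eq continuous_intros)
  ultimately have clW: "closed W" using V by (auto intro!: closed_Int closed_INT)
  have SW: "S z \<in> W" if "z \<in> W" for z
  proof -
    have "S z \<bullet> e = 0" if e: "e \<in> E" for e
    proof -
      obtain m where "S e = m *\<^sub>R e" using E e unfolding P_def by blast
      moreover have "S z \<bullet> e = z \<bullet> S e" using sym \<open>z \<in> W\<close> E e by (auto simp: W_def P_def)
      ultimately show ?thesis using \<open>z \<in> W\<close> e by (simp add: W_def)
    qed
    then show ?thesis using SV \<open>z \<in> W\<close> by (auto simp: W_def)
  qed
  have noeig: False if w: "w \<in> W" "norm w = 1" "S w = m *\<^sub>R w" for w m
  proof -
    have "P (insert w E)" using E w by (auto simp: P_def W_def inner_commute)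
    then have "w \<in> E" using max[of "insert w E"] by auto
    then have "w \<bullet> w = 0" using w by (auto simp: W_def)
    then show False using w by auto
  qed
  have hsW: "hs_on W S M" using hs_on_subset[OF hs] by (auto simp: W_def)
  have symW: "\<And>z w. z \<in> W \<Longrightarrow> w \<in> W \<Longrightarrow> S z \<bullet> w = z \<bullet> S w" using sym by (auto simp: W_def)
  have le: "S z \<bullet> z \<le> 0" if "z \<in> W" for z
    using hs_on_max_eigenvector[OF hsW subW clW S SW symW \<open>z \<in> W\<close>] noeig by (metis not_le)
  have hsW': "hs_on W (\<lambda>z. - S z) M" using hsW by (simp add: hs_on_def)
  have S': "linear (\<lambda>z. - S z)" using S by (rule linear_compose_neg)
  have ge: "S z \<bullet> z \<ge> 0" if "z \<in> W" for z
  proof (rule ccontr)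
    assume "\<not> S z \<bullet> z \<ge> 0"
    then have pos: "(- S z) \<bullet> z > 0" by simp
    have SW': "- S z \<in> W" if "z \<in> W" for z using SW[OF that] subW by (simp add: subspace_neg)
    have symW': "(- S z) \<bullet> w = z \<bullet> (- S w)" if "z \<in> W" "w \<in> W" for z w using symW[OF that] by simp
    obtain m y where y: "y \<in> W" "norm y = 1" "- S y = m *\<^sub>R y"
      using hs_on_max_eigenvector[OF hsW' subW clW S' SW' symW' \<open>z \<in> W\<close> pos] by metis
    have "S y = (- m) *\<^sub>R y" using y(3) by (metis minus_minus scaleR_minus_left)
    with noeig y show False by blast
  qed
  have W0: "z = 0" if z: "z \<in> W" for z
  proof (rule ccontr)
    assume "z \<noteq> 0"
    have zero: "S x \<bullet> x = 0" if "x \<in> W" for x using le ge that by force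
    \<comment> \<open>Polarization of the vanishing quadratic form at the pair \<open>z\<close>,
      \<open>S z\<close> leaves only twice the squared norm of \<open>S z\<close>.\<close>
    have "S (z + S z) \<bullet> (z + S z) = 0" using zero SW z subW by (simp add: subspace_add)
    then have "2 * (S z \<bullet> S z) = 0"
      using zero[OF z] zero[OF SW[OF z]] symW[OF SW[OF z] z]
      by (simp add: linear_add[OF S] inner_simps inner_commute)
    then have "S z = 0" by simp
    have "sgn z \<in> W" "norm (sgn z) = 1" using z \<open>z \<noteq> 0\<close> subW
      by (simp_all add: norm_sgn sgn_div_norm subspace_scale)
    moreover have "S (sgn z) = 0 *\<^sub>R sgn z" using \<open>S z = 0\<close> by (simp add: sgn_div_norm linear_cmul[OF S])
    ultimately show False using noeig by blast
  qed
  have sp: "span E \<subseteq> V" using E V by (auto simp: P_def intro: span_minimal[THEN subsetD])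
  then have cl: "closure (span E) \<subseteq> V" using V by (simp add: closure_minimal)
  have "V \<subseteq> closure (span E)"
  proof
    fix v assume v: "v \<in> V"
    have cs: "subspace (closure (span E))" "closed (closure (span E))"
      by (simp_all add: subspace_closure_of_subspace)
    let ?p = "orth_proj (closure (span E)) v"
    have p: "?p \<in> closure (span E)" using orth_proj(1)[OF cs] .
    have "v - ?p \<in> W"
    proof -
      have "(v - ?p) \<bullet> e = 0" if "e \<in> E" for e
        using orth_proj(2)[OF cs] that closure_subset span_base by blast
      then show ?thesis using v p cl V by (auto simp: W_def subspace_diff)
    qed
    from W0[OF this] show "v \<in> closure (span E)" using p by simp
  qed
  with cl have "closure (span E) = V" by blast
  with E that[of E] show thesis unfolding P_def by blast
qed

text \<open>Distinct orthonormal vectors have distance \<open>sqrt 2\<close>, so points of the dense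
  set chosen within 1/2 of them are distinct.\<close>

lemma countable_orthonormal_set:
  fixes C E :: "'a::real_inner set"
  assumes C: "countable C" "closure C = UNIV"
    and E: "\<And>e. e \<in> E \<Longrightarrow> norm e = 1" "\<And>e f. e \<in> E \<Longrightarrow> f \<in> E \<Longrightarrow> e \<noteq> f \<Longrightarrow> e \<bullet> f = 0"
  shows "countable E"
proof -
  have "\<exists>c\<in>C. dist c e < 1/2" for e
    using C(2) closure_approachable[of e C] by (metis UNIV_I half_gt_zero zero_less_one)
  then obtain c where c: "\<And>e. c e \<in> C" "\<And>e. dist (c e) e < 1/2" by metis
  have "inj_on c E"
  proof (rule inj_onI, rule ccontr)
    fix e f assume ef: "e \<in> E" "f \<in> E" "c e = c f" "e \<noteq> f"
    have "dist e f \<le> dist (c e) e + dist (c f) f"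
      using dist_triangle[of e f "c e"] ef(3) by (simp add: dist_commute)
    then have "dist e f < 1" using c(2)[of e] c(2)[of f] by linarith
    moreover have "(norm (e - f))\<^sup>2 = 2"
      using E(1)[OF ef(1)] E(1)[OF ef(2)] E(2)[OF ef(1,2,4)]
      by (simp add: power2_norm_eq_inner inner_simps inner_commute norm_eq_1)
    ultimately show False
      by (metis dist_norm norm_ge_zero not_one_less_zero one_less_numeral_iff order_less_asym
          power2_eq_square mult_le_one less_eq_real_def not_le semiring_norm(76))
  qed
  then show ?thesis using C(1) c(1) by (meson countable_subset image_subsetI countable_image_inj_on)
qed

section \<open>Hilbert norms transported by a linear embedding\<close>

context
  fixes D :: "'h::{real_inner,complete_space} \<Rightarrow> 'k::real_inner" and c C :: real
  assumes D: "linear D" and c: "c > 0" "\<And>x. c * norm x \<le> norm (D x)" and C: "\<And>x. norm (D x) \<le> C * norm x"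
begin

lemma transported_eq_0: "norm (D x) = 0 \<longleftrightarrow> x = 0"
proof
  assume "norm (D x) = 0"
  then have "c * norm x \<le> 0" using c(2)[of x] by simp
  then show "x = 0" using c(1) by (simp add: mult_le_0_iff)
qed (simp add: linear_0[OF D])

text \<open>Admissible norms are plain functions rather than type class norms, hence the abstract
  metric spaces. This context is used twice: with the identity for the given norm, and with the
  inverse of the sum map for the new one.\<close>

lemma transported_metric: "Metric_space UNIV (norm_dist (\<lambda>x. norm (D x)))"
proof
  fix x y z :: 'h
  show "norm (D (x - y)) = norm (D (y - x))" by (simp add: linear_diff[OF D] norm_minus_commute)
  show "norm (D (x - y)) = 0 \<longleftrightarrow> x = y" using transported_eq_0[of "x - y"] by simp
  show "norm (D (x - z)) \<le> norm (D (x - y)) + norm (D (y - z))"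
    using norm_triangle_ineq[of "D x - D y" "D y - D z"] by (simp add: linear_diff[OF D])
qed simp

lemma transported_topology: "norm_topology (\<lambda>x. norm (D x)) = euclidean"
proof -
  interpret Metric_space UNIV "norm_dist (\<lambda>x. norm (D x))" by (rule transported_metric)
  have C0: "C \<ge> 0 \<or> (\<forall>x::'h. x = 0)"
  proof (rule disjCI)
    assume "\<not> (\<forall>x::'h. x = 0)"
    then obtain x :: 'h where "x \<noteq> 0" by blast
    then show "C \<ge> 0" using C[of x] norm_ge_zero[of "D x"] by (metis mult_less_0_iff norm_le_zero_iff not_le order_trans)
  qed
  \<comment> \<open>If the space is trivial, \<open>C\<close> may be zero or negative; the radius
    below needs a positive constant.\<close>
  define C' where "C' = \<bar>C\<bar> + 1"
  have C': "C' > 0" "norm (D x) \<le> C' * norm x" for x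
    using order_trans[OF C[of x] mult_right_mono[of C "\<bar>C\<bar> + 1" "norm x"]] unfolding C'_def by simp_all
  have "openin mtopology U \<longleftrightarrow> open U" for U
  proof
    assume U: "openin mtopology U"
    show "open U" unfolding open_dist
    proof
      fix x assume "x \<in> U"
      then obtain r where r: "r > 0" "mball x r \<subseteq> U" using U by (auto simp: openin_mtopology)
      show "\<exists>e>0. \<forall>y. dist y x < e \<longrightarrow> y \<in> U"
      proof (intro exI conjI allI impI)
        show "r / C' > 0" using r C' by simp
        fix y assume "dist y x < r / C'"
        then have "C' * norm (x - y) < r" using C' by (simp add: dist_norm norm_minus_commute field_simps)
        then have "norm (D (x - y)) < r" using C'(2)[of "x - y"] by linarith
        then show "y \<in> U" using r(2) by (auto simp: mball_def)
      qed
    qed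
  next
    assume U: "open U"
    show "openin mtopology U" unfolding openin_mtopology
    proof (intro conjI allI impI)
      fix x assume "x \<in> U"
      then obtain e where e: "e > 0" "\<And>y. dist y x < e \<Longrightarrow> y \<in> U" using U unfolding open_dist by blast
      have "mball x (c * e) \<subseteq> U"
      proof
        fix y assume "y \<in> mball x (c * e)"
        then have "norm (D (x - y)) < c * e" by (simp add: mball_def)
        then have "c * norm (x - y) < c * e" using c(2)[of "x - y"] by linarith
        then show "y \<in> U" using c(1) by (intro e(2)) (simp add: dist_norm norm_minus_commute)
      qed
      then show "\<exists>r>0. mball x r \<subseteq> U" using e c by (intro exI[of _ "c * e"]) auto
    qed simp
  qed
  then show ?thesis by (simp add: topology_eq)
qed

lemma transported_separable_hilbert_norm:
  fixes A :: "'h set"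
  assumes "countable A" "closure A = UNIV"
  shows "separable_hilbert_norm (\<lambda>x. norm (D x))"
  unfolding separable_hilbert_norm_def transported_topology
proof (intro conjI)
  have "bilinear (\<lambda>x y. D x \<bullet> D y)"
    unfolding bilinear_def
    by (auto intro!: linearI simp: linear_add[OF D] linear_cmul[OF D] inner_simps)
  moreover have "0 < D x \<bullet> D x" if "x \<noteq> 0" for x using transported_eq_0[of x] that by auto
  ultimately show "\<exists>ip. bilinear ip \<and> (\<forall>x y. ip x y = ip y x) \<and> (\<forall>x. x \<noteq> 0 \<longrightarrow> 0 < ip x x) \<and>
           (\<forall>x. norm (D x) = sqrt (ip x x))"
    by (intro exI[of _ "\<lambda>x y. D x \<bullet> D y"]) (auto simp: inner_commute norm_eq_sqrt_inner)
  interpret Metric_space UNIV "norm_dist (\<lambda>x. norm (D x))" by (rule transported_metric)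
  show "mcomplete" unfolding mcomplete_def
  proof (intro allI impI)
    fix s assume s: "MCauchy s"
    have "Cauchy s"
    proof (rule metric_CauchyI)
      fix e :: real assume "0 < e"
      then have "c * e > 0" using c by simp
      then obtain N where N: "\<And>n n'. N \<le> n \<Longrightarrow> N \<le> n' \<Longrightarrow> norm (D (s n - s n')) < c * e"
        using s unfolding MCauchy_def by metis
      show "\<exists>M. \<forall>m\<ge>M. \<forall>n\<ge>M. dist (s m) (s n) < e"
      proof (intro exI[of _ N] allI impI)
        fix m n assume "m \<ge> N" "n \<ge> N"
        from N[OF this] c(2)[of "s m - s n"] have "c * norm (s m - s n) < c * e" by linarith
        then show "dist (s m) (s n) < e" using c by (simp add: dist_norm)
      qed
    qed
    then obtain l where "s \<longlonglongrightarrow> l" using Cauchy_convergent_iff convergent_def by blast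
    then show "\<exists>x. limitin mtopology s x sequentially" unfolding transported_topology by auto
  qed
  show "\<exists>C. countable C \<and> euclidean closure_of C = (UNIV :: 'h set)" using assms by auto
qed

lemma transported_norm_inner: "norm_inner (\<lambda>x. norm (D x)) x y = D x \<bullet> D y"
  by (simp add: norm_inner_def power2_norm_eq_inner linear_add[OF D] inner_simps inner_commute)

end

section \<open>A criterion for orthogonal decompositions in the FHS sense\<close>

text \<open>On \<open>H1 \<times> H2\<close> with the product norm, the scalar product pulled back along the sum map is
  \<open>1 + S\<close> with \<open>S (x, y) = (P1 y, P2 x)\<close>. An orthonormal eigenbasis of the Hilbert-Schmidt operator
  \<open>S\<close> is mapped to a common orthogonal basis for the given norm and the transported product norm.\<close>

theorem fhs_direct_sum_if_hilbert_schmidt: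
  fixes H1 H2 :: "'h::{real_inner,complete_space} set"
  assumes H1: "subspace H1" "closed H1" and H2: "subspace H2" "closed H2"
    and A: "countable A" "closure A = (UNIV :: 'h set)"
    and dense: "closure {x + y | x y. x \<in> H1 \<and> y \<in> H2} = UNIV"
    and triv: "H1 \<inter> H2 \<subseteq> {0}"
    and hs: "\<And>(n::nat) x y. (\<And>i. i < n \<Longrightarrow> x i \<in> H1) \<Longrightarrow> (\<And>i. i < n \<Longrightarrow> y i \<in> H2) \<Longrightarrow>
       \<bar>\<Sum>i<n. x i \<bullet> y i\<bar> \<le> M * sqrt (\<Sum>i<n. \<Sum>j<n. (x i \<bullet> x j) * (y i \<bullet> y j))"
  shows "fhs_direct_sum (fhs_class (norm :: 'h \<Rightarrow> real)) H1 H2"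
proof -
  define V where "V = H1 \<times> H2"
  define s :: "'h \<times> 'h \<Rightarrow> 'h" where "s z = fst z + snd z" for z
  define S where "S z = (orth_proj H1 (snd z), orth_proj H2 (fst z))" for z
  note P1 = orth_proj[OF H1] orth_proj_inner[OF H1] linear_orth_proj[OF H1]
  note P2 = orth_proj[OF H2] orth_proj_inner[OF H2] linear_orth_proj[OF H2]
  have V: "subspace V" "closed V"
    using H1 H2 unfolding V_def by (auto intro: closed_Times simp: subspace_Times)
  have lins: "linear s" by (rule linearI) (auto simp: s_def algebra_simps)
  have linS: "linear S"
    by (rule linearI) (auto simp: S_def linear_add[OF P1(4)] linear_add[OF P2(4)]
        linear_cmul[OF P1(4)] linear_cmul[OF P2(4)])
  have SV: "S z \<in> V" for z using P1(1) P2(1) by (auto simp: S_def V_def)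
  have Sip: "S z \<bullet> w = snd z \<bullet> fst w + fst z \<bullet> snd w" if "w \<in> V" for z w
    using that P1(3) P2(3) by (auto simp: S_def V_def inner_prod_def)
  have sym: "S z \<bullet> w = z \<bullet> S w" if "z \<in> V" "w \<in> V" for z w
    using Sip[OF that(2), of z] Sip[OF that(1), of w] by (simp add: inner_commute)
  have s_ip: "s z \<bullet> s w = z \<bullet> w + S z \<bullet> w" if "w \<in> V" for z w
    unfolding Sip[OF that] by (simp add: s_def inner_prod_def inner_simps inner_commute)

  \<comment> \<open>A self-improving estimate. \<open>u\<close> and \<open>v\<close> are the
    components of an orthonormal system of the product, so by Schur positivity the Gram expression
    is at most the sum of the \<open>w i \<bullet> w i\<close>, which is the sum \<open>t\<close> to
    be bounded. The hypothesis gives \<open>t <= |M| * sqrt t\<close>, hence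
    \<open>t <= M^2\<close>.\<close>
  have half: "(\<Sum>i<n. x i \<bullet> y i) \<le> M\<^sup>2"
    if x: "\<And>i. i < n \<Longrightarrow> x i \<in> H1" and y: "\<And>i. i < n \<Longrightarrow> y i \<in> H2"
      and on: "\<And>i j. i < n \<Longrightarrow> j < n \<Longrightarrow> u i \<bullet> u j + v i \<bullet> v j = (if i = j then 1 else 0)"
      and le: "(\<Sum>i<n. \<Sum>j<n. (x i \<bullet> x j) * (y i \<bullet> y j)) = (\<Sum>i<n. \<Sum>j<n. (u i \<bullet> u j) * (w i \<bullet> w j))"
      and ww: "\<And>i. i < n \<Longrightarrow> w i \<bullet> w i = x i \<bullet> y i" for n and x y u v w :: "nat \<Rightarrow> 'h"
  proof -
    let ?t = "\<Sum>i<n. x i \<bullet> y i"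
    have "(\<Sum>i<n. \<Sum>j<n. (u i \<bullet> u j) * (w i \<bullet> w j)) + (\<Sum>i<n. \<Sum>j<n. (v i \<bullet> v j) * (w i \<bullet> w j))
        = (\<Sum>i<n. \<Sum>j<n. (u i \<bullet> u j + v i \<bullet> v j) * (w i \<bullet> w j))"
      by (simp add: sum.distrib distrib_right)
    also have "\<dots> = (\<Sum>i<n. \<Sum>j<n. (if i = j then 1 else 0) * (w i \<bullet> w j))"
      using on by (intro sum.cong refl) auto
    also have "\<dots> = (\<Sum>i<n. w i \<bullet> w i)"
      by (intro sum.cong refl) (simp add: if_distrib if_distribR cong: if_cong)
    also have "\<dots> = ?t" using ww by (intro sum.cong) auto
    finally have "(\<Sum>i<n. \<Sum>j<n. (x i \<bullet> x j) * (y i \<bullet> y j)) \<le> ?t"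
      using gram_product_nonneg[of "{..<n}" v w] le by simp
    then have le': "sqrt (\<Sum>i<n. \<Sum>j<n. (x i \<bullet> x j) * (y i \<bullet> y j)) \<le> sqrt ?t" by simp
    have t0: "?t \<ge> 0" using ww[symmetric] by (intro sum_nonneg) simp
    show ?thesis
    proof (cases "?t = 0")
      case False
      then have tp: "?t > 0" using t0 by simp
      have "\<bar>?t\<bar> \<le> \<bar>M\<bar> * sqrt ?t"
      proof -
        have "\<bar>?t\<bar> \<le> M * sqrt (\<Sum>i<n. \<Sum>j<n. (x i \<bullet> x j) * (y i \<bullet> y j))" using hs[of n x y] x y by blast
        also have "\<dots> \<le> \<bar>M\<bar> * sqrt (\<Sum>i<n. \<Sum>j<n. (x i \<bullet> x j) * (y i \<bullet> y j))"
          using gram_product_nonneg[of "{..<n}" x y] by (intro mult_right_mono) auto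
        also have "\<dots> \<le> \<bar>M\<bar> * sqrt ?t" using le' by (intro mult_left_mono) auto
        finally show ?thesis .
      qed
      then have "sqrt ?t * sqrt ?t \<le> \<bar>M\<bar> * sqrt ?t" using tp by simp
      then have "sqrt ?t \<le> \<bar>M\<bar>" using tp by (simp only: mult_le_cancel_right) simp
      then have "(sqrt ?t)\<^sup>2 \<le> \<bar>M\<bar>\<^sup>2" by (rule power_mono) (use tp in simp)
      then show ?thesis using tp by simp
    qed simp
  qed
  have hsS: "hs_on V S (2 * M\<^sup>2)"
    unfolding hs_on_def
  proof (intro allI impI, elim conjE)
    fix n and z :: "nat \<Rightarrow> 'h \<times> 'h" assume zV: "\<forall>i<n. z i \<in> V" and z: "orthonormal_family n z"
    define x where "x i = fst (z i)" for i
    define y where "y i = snd (z i)" for i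
    have xy: "x i \<in> H1" "y i \<in> H2" if "i < n" for i using zV that by (auto simp: x_def y_def V_def)
    have on: "x i \<bullet> x j + y i \<bullet> y j = (if i = j then 1 else 0)" if "i < n" "j < n" for i j
      using z that by (auto simp: x_def y_def orthonormal_family_def inner_prod_def)
    have on': "y i \<bullet> y j + x i \<bullet> x j = (if i = j then 1 else 0)" if "i < n" "j < n" for i j
      using on[OF that] by simp
    let ?p = "\<lambda>i. orth_proj H2 (x i)" and ?q = "\<lambda>i. orth_proj H1 (y i)"
    have 1: "(\<Sum>i<n. x i \<bullet> ?p i) \<le> M\<^sup>2"
      by (rule half[of n x ?p x y ?p]) (use xy on P2 in auto)
    have 2: "(\<Sum>i<n. ?q i \<bullet> y i) \<le> M\<^sup>2"
      by (rule half[of n ?q y y x ?q]) (use xy on' P1 in \<open>auto simp: mult.commute inner_commute\<close>)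
    have "(norm (S (z i)))\<^sup>2 = x i \<bullet> ?p i + ?q i \<bullet> y i" for i
      using P1(1,3) P2(1,3)
      by (simp add: S_def x_def y_def power2_norm_eq_inner inner_prod_def inner_commute)
    then show "(\<Sum>i<n. (norm (S (z i)))\<^sup>2) \<le> 2 * M\<^sup>2" using 1 2 by (simp add: sum.distrib)
  qed

  have s0: "z = 0" if "z \<in> V" "s z = 0" for z
  proof -
    have "fst z = - snd z" using that(2) by (simp add: s_def eq_neg_iff_add_eq_0)
    moreover have "- snd z \<in> H2" using that(1) H2 by (auto simp: V_def subspace_neg)
    ultimately have "fst z \<in> H1 \<inter> H2" using that(1) by (auto simp: V_def)
    then have "fst z = 0" using triv by blast
    with \<open>fst z = - snd z\<close> show ?thesis by (simp add: prod_eq_iff)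
  qed
  \<comment> \<open>The squared norm of \<open>s z\<close> is the quadratic form of
    \<open>1 + S\<close>. If \<open>-S\<close> has a largest positive eigenvalue \<open>m\<close>,
    the constant is \<open>1 - m\<close>, which is positive because \<open>s\<close> does not
    annihilate the eigenvector. Otherwise 1 works.\<close>
  have "\<exists>c>0. \<forall>z\<in>V. c * (norm z)\<^sup>2 \<le> (norm (s z))\<^sup>2"
  proof (cases "\<exists>z\<in>V. (- S z) \<bullet> z > 0")
    case True
    then obtain z0 where z0: "z0 \<in> V" "(- S z0) \<bullet> z0 > 0" by blast
    have h': "hs_on V (\<lambda>z. - S z) (2 * M\<^sup>2)" using hsS by (simp add: hs_on_def)
    have l': "linear (\<lambda>z. - S z)" using linS by (rule linear_compose_neg)
    have SV': "- S z \<in> V" for z using SV V by (simp add: subspace_neg)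
    have sym': "(- S z) \<bullet> w = z \<bullet> (- S w)" if "z \<in> V" "w \<in> V" for z w using sym[OF that] by simp
    obtain m z where m: "m > 0" "z \<in> V" "norm z = 1" "- S z = m *\<^sub>R z"
      "\<And>w. w \<in> V \<Longrightarrow> (- S w) \<bullet> w \<le> m * (norm w)\<^sup>2"
      using hs_on_max_eigenvector[OF h' V l' SV' sym' z0] by blast
    have "S z \<bullet> z = - m" using m(3,4) by (metis inner_minus_left inner_scaleR_left minus_minus mult.right_neutral norm_eq_1)
    then have "(norm (s z))\<^sup>2 = 1 - m"
      using s_ip[OF m(2), of z] m(3) by (simp add: power2_norm_eq_inner[symmetric])
    moreover have "s z \<noteq> 0" using s0[OF m(2)] m(3) by auto
    ultimately have m1: "1 - m > 0" by (metis zero_less_norm_iff zero_less_power)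
    have "(1 - m) * (norm w)\<^sup>2 \<le> (norm (s w))\<^sup>2" if "w \<in> V" for w
      using m(5)[OF that] s_ip[OF that, of w] by (simp add: power2_norm_eq_inner algebra_simps)
    with m1 show ?thesis by blast
  next
    case False
    then have "1 * (norm w)\<^sup>2 \<le> (norm (s w))\<^sup>2" if "w \<in> V" for w
      using s_ip[OF that, of w] that by (force simp: power2_norm_eq_inner)
    then show ?thesis by (metis zero_less_one)
  qed
  then obtain c where c: "c > 0" "\<And>z. z \<in> V \<Longrightarrow> c * (norm z)\<^sup>2 \<le> (norm (s z))\<^sup>2" by blast
  have clow: "sqrt c * norm z \<le> norm (s z)" if "z \<in> V" for z
    using real_sqrt_le_mono[OF c(2)[OF that]] by (simp add: real_sqrt_mult)
  have sup: "norm (s z) \<le> 2 * norm z" for z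
    using norm_triangle_ineq[of "fst z" "snd z"] norm_fst_le[of "fst z" "snd z"]
      norm_snd_le[of "snd z" "fst z"] by (simp add: s_def)
  \<comment> \<open>A map bounded below on a complete space has closed range, and the range is
    dense.\<close>
  have surj: "\<exists>z\<in>V. s z = h" for h
  proof -
    have "h \<in> closure {x + y | x y. x \<in> H1 \<and> y \<in> H2}" using dense by simp
    moreover have "{x + y | x y. x \<in> H1 \<and> y \<in> H2} = s ` V" by (force simp: s_def V_def)
    ultimately obtain g where g: "\<And>n. g n \<in> s ` V" "g \<longlonglongrightarrow> h" unfolding closure_sequential by metis
    have "\<exists>z. \<forall>n. z n \<in> V \<and> s (z n) = g n" using g(1) by (intro choice) (metis imageE)
    then obtain z where "\<forall>n. z n \<in> V \<and> s (z n) = g n" by blast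
    then have z: "\<And>n. z n \<in> V" "(\<lambda>n. s (z n)) \<longlonglongrightarrow> h" using g(2) by simp_all
    have "Cauchy (\<lambda>n. s (z n))" using z(2) by (rule LIMSEQ_imp_Cauchy)
    have "Cauchy z"
    proof (rule metric_CauchyI)
      fix e :: real assume "0 < e"
      then have "sqrt c * e > 0" using c by simp
      then obtain N where N: "\<And>m n. m \<ge> N \<Longrightarrow> n \<ge> N \<Longrightarrow> dist (s (z m)) (s (z n)) < sqrt c * e"
        using \<open>Cauchy (\<lambda>n. s (z n))\<close> unfolding Cauchy_def by metis
      show "\<exists>M. \<forall>m\<ge>M. \<forall>n\<ge>M. dist (z m) (z n) < e"
      proof (intro exI[of _ N] allI impI)
        fix m n assume "m \<ge> N" "n \<ge> N"
        from N[OF this] have "norm (s (z m - z n)) < sqrt c * e" by (simp add: dist_norm linear_diff[OF lins])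
        moreover have "sqrt c * norm (z m - z n) \<le> norm (s (z m - z n))"
          using z(1) V by (intro clow) (simp add: subspace_diff)
        ultimately have "sqrt c * norm (z m - z n) < sqrt c * e" by linarith
        then show "dist (z m) (z n) < e" using c by (simp add: dist_norm)
      qed
    qed
    then obtain l where l: "z \<longlonglongrightarrow> l" using Cauchy_convergent_iff convergent_def by blast
    have "l \<in> V" using closed_sequentially[OF V(2) _ l] z(1) by blast
    moreover have "(\<lambda>n. s (z n)) \<longlonglongrightarrow> s l" unfolding s_def by (intro tendsto_intros l)
    ultimately show ?thesis using z(2) LIMSEQ_unique by blast
  qed
  define D where "D = inv_into V s"
  have DV: "D h \<in> V" and sD: "s (D h) = h" for h
    using surj[of h] inv_into_into[of h s V] f_inv_into_f[of h s V] by (auto simp: D_def)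
  have Duniq: "D h = z" if "z \<in> V" "s z = h" for z h
  proof -
    have "s (D h - z) = 0" using sD[of h] that by (simp add: linear_diff[OF lins])
    then have "D h - z = 0" using s0[of "D h - z"] V DV that by (simp add: subspace_diff)
    then show ?thesis by simp
  qed
  have linD: "linear D"
  proof (rule linearI)
    fix x y :: 'h and r :: real
    show "D (x + y) = D x + D y"
      by (rule Duniq) (use V DV sD in \<open>auto simp: subspace_add linear_add[OF lins]\<close>)
    show "D (r *\<^sub>R x) = r *\<^sub>R D x"
      by (rule Duniq) (use V DV sD in \<open>auto simp: subspace_scale linear_cmul[OF lins]\<close>)
  qed
  have Dlow: "1/2 * norm x \<le> norm (D x)" for x using sup[of "D x"] sD[of x] by simp
  have Dup: "norm (D x) \<le> (1 / sqrt c) * norm x" for x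
    using clow[OF DV, of x] sD[of x] c(1) by (simp add: field_simps)
  \<comment> \<open>The product norm of the two components: the most direct norm that makes
    \<open>H1\<close> and \<open>H2\<close> orthogonal.\<close>
  define N where "N = (\<lambda>x. norm (D x))"
  have N_top: "norm_topology N = euclidean"
    unfolding N_def using transported_topology[OF linD _ Dlow Dup] by simp
  have N_sep: "separable_hilbert_norm N"
    unfolding N_def using transported_separable_hilbert_norm[OF linD _ Dlow Dup A] by simp
  have N_ip: "norm_inner N x y = D x \<bullet> D y" for x y
    unfolding N_def using transported_norm_inner[OF linD _ Dlow Dup] by simp
  have id: "linear (\<lambda>x::'h. x)" by (rule linearI) auto
  have id_b: "1 * norm x \<le> norm x" "norm x \<le> 1 * norm x" for x :: 'h by auto
  have n_top: "norm_topology (norm :: 'h \<Rightarrow> real) = euclidean"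
    using transported_topology[OF id _ id_b] by simp
  have n_sep: "separable_hilbert_norm (norm :: 'h \<Rightarrow> real)"
    using transported_separable_hilbert_norm[OF id _ id_b A] by simp
  have n_ip: "norm_inner norm x y = x \<bullet> y" for x y :: 'h
    using transported_norm_inner[OF id _ id_b] by simp

  obtain E where E: "E \<subseteq> V" "\<And>e. e \<in> E \<Longrightarrow> norm e = 1"
    "\<And>e f. e \<in> E \<Longrightarrow> f \<in> E \<Longrightarrow> e \<noteq> f \<Longrightarrow> e \<bullet> f = 0"
    "\<And>e. e \<in> E \<Longrightarrow> \<exists>m. S e = m *\<^sub>R e" "closure (span E) = V"
    using hs_on_eigenbasis[OF hsS V linS SV sym] by blast
  have "countable (A \<times> A)" "closure (A \<times> A) = UNIV" using A by (auto simp: closure_Times)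
  then have cE: "countable E" using countable_orthonormal_set[of "A \<times> A" E] E(2,3) by blast
  \<comment> \<open>\<open>E\<close> may be finite or infinite; the index set is a set of naturals
    in both cases.\<close>
  define K where "K = to_nat_on E ` E"
  define g where "g = from_nat_into E"
  have gE: "g k \<in> E" if "k \<in> K" for k using that cE by (auto simp: K_def g_def)
  have ginj: "inj_on g K" using cE by (auto simp: K_def g_def intro!: inj_onI)
  have gim: "g ` K = E" using cE by (auto simp: K_def g_def image_iff)
  have gV: "g k \<in> V" if "k \<in> K" for k using gE[OF that] E(1) by blast
  define e where "e k = s (g k)" for k
  have De: "D (e k) = g k" if "k \<in> K" for k using Duniq[OF gV[OF that]] by (simp add: e_def)
  have e0: "e k \<noteq> 0" if "k \<in> K" for k
    using s0[OF gV[OF that]] E(2)[OF gE[OF that]] by (auto simp: e_def)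
  have orth: "g k \<bullet> g l = 0" if "k \<in> K" "l \<in> K" "k \<noteq> l" for k l
    using E(3)[OF gE gE] that ginj by (auto simp: inj_on_eq_iff)
  \<comment> \<open>On an eigenvector with eigenvalue \<open>m\<close> the pulled back product is
    \<open>1 + m\<close> times the original one, so orthogonality survives the sum map.\<close>
  have ip0: "e k \<bullet> e l = 0" if kl: "k \<in> K" "l \<in> K" "k \<noteq> l" for k l
  proof -
    obtain m where m: "S (g k) = m *\<^sub>R g k" using E(4) gE kl by blast
    show ?thesis unfolding e_def s_ip[OF gV[OF kl(2)]] m using orth[OF kl] by simp
  qed
  have clos: "closure (span (e ` K)) = UNIV"
  proof -
    have "e ` K = s ` E" using gim by (auto simp: e_def)
    then have sp: "span (e ` K) = s ` span E" by (simp add: linear_span_image[OF lins])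
    have "h \<in> closure (s ` span E)" for h
    proof -
      obtain z where "z \<in> V" "s z = h" using surj by blast
      then have "h \<in> s ` closure (span E)" using E(5) by blast
      moreover have "continuous_on (closure (span E)) s" unfolding s_def by (intro continuous_intros)
      then have "s ` closure (span E) \<subseteq> closure (s ` span E)"
        by (rule image_closure_subset) (auto intro: closure_subset[THEN subsetD])
      ultimately show ?thesis by blast
    qed
    then show ?thesis unfolding sp by blast
  qed
  have b1: "orthogonal_basis norm K e"
    unfolding orthogonal_basis_def n_ip n_top using e0 ip0 clos by auto
  have b2: "orthogonal_basis N K e"
    unfolding orthogonal_basis_def N_ip N_top using e0 orth De clos by auto
  \<comment> \<open>Here \<open>N (e k) = 1\<close> and \<open>r = norm (e k)\<close> satisfies
    \<open>r^2 = 1 + m\<close>. The deviation is \<open>(1 - r)^2 / r^2\<close>, where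
    \<open>r^2 >= c\<close> and \<open>|1 - r| <= |1 - r| * (1 + r) = |m|\<close>; finally
    \<open>m^2\<close> is the squared norm of \<open>S (g k)\<close>.\<close>
  have term_le: "(N (e k) / norm (e k) - 1)\<^sup>2 \<le> (norm (S (g k)))\<^sup>2 / c" if k: "k \<in> K" for k
  proof -
    obtain m where m: "S (g k) = m *\<^sub>R g k" using E(4) gE k by blast
    have n1: "norm (g k) = 1" using E(2) gE k by blast
    have Sm: "(norm (S (g k)))\<^sup>2 = m\<^sup>2" by (simp add: m n1)
    define r where "r = norm (e k)"
    have r2: "r\<^sup>2 = 1 + m"
      unfolding r_def e_def power2_norm_eq_inner s_ip[OF gV[OF k]] m using n1 by (simp add: norm_eq_1)
    have rp: "r > 0" using e0[OF k] by (simp add: r_def)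
    have rc: "c \<le> r\<^sup>2" using c(2)[OF gV[OF k]] n1 by (simp add: r_def e_def)
    have "(1 / r - 1)\<^sup>2 = (1 - r)\<^sup>2 / r\<^sup>2" using rp by (simp add: field_simps power2_eq_square)
    also have "\<dots> \<le> (1 - r)\<^sup>2 / c" using rc c(1) rp by (intro divide_left_mono mult_pos_pos) auto
    also have "\<dots> \<le> m\<^sup>2 / c"
    proof (intro divide_right_mono)
      have "(1 - r)\<^sup>2 * 1 \<le> (1 - r)\<^sup>2 * (1 + r)\<^sup>2" using rp by (intro mult_left_mono one_le_power) auto
      also have "\<dots> = (1 - r\<^sup>2)\<^sup>2" by (simp add: power2_eq_square algebra_simps)
      finally show "(1 - r)\<^sup>2 \<le> m\<^sup>2" using r2 by simp
    qed (use c in simp)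
    finally show ?thesis using De[OF k] n1 Sm by (simp add: N_def r_def)
  qed
  have "(\<lambda>k. (N (e k) / norm (e k) - 1)\<^sup>2) summable_on K"
  proof (rule nonneg_bdd_above_summable_on)
    show "bdd_above (sum (\<lambda>k. (N (e k) / norm (e k) - 1)\<^sup>2) ` {F. F \<subseteq> K \<and> finite F})"
    proof (rule bdd_aboveI[of _ "2 * M\<^sup>2 / c"])
      fix t assume "t \<in> sum (\<lambda>k. (N (e k) / norm (e k) - 1)\<^sup>2) ` {F. F \<subseteq> K \<and> finite F}"
      then obtain F where F: "F \<subseteq> K" "finite F" "t = (\<Sum>k\<in>F. (N (e k) / norm (e k) - 1)\<^sup>2)" by auto
      obtain b where b: "bij_betw b {..<card F} F"
        using ex_bij_betw_nat_finite[OF F(2)] by (auto simp: atLeast0LessThan)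
      have "t \<le> (\<Sum>k\<in>F. (norm (S (g k)))\<^sup>2 / c)" unfolding F(3) using F(1) term_le by (intro sum_mono) auto
      also have "\<dots> = (\<Sum>i<card F. (norm (S (g (b i))))\<^sup>2) / c"
        by (simp add: sum_divide_distrib sum.reindex_bij_betw[OF b, symmetric])
      also have "\<dots> \<le> 2 * M\<^sup>2 / c"
      proof (rule divide_right_mono)
        have bK: "b i \<in> K" if "i < card F" for i using b F(1) that by (auto dest: bij_betwE)
        have "orthonormal_family (card F) (\<lambda>i. g (b i))"
          unfolding orthonormal_family_def
        proof (intro allI impI)
          fix i j assume ij: "i < card F" "j < card F"
          have "b i = b j \<longleftrightarrow> i = j" using b ij by (auto simp: bij_betw_def inj_on_eq_iff)
          then show "g (b i) \<bullet> g (b j) = (if i = j then 1 else 0)"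
            using orth bK ij E(2)[OF gE[OF bK[OF ij(1)]]] by (auto simp: norm_eq_1)
        qed
        then show "(\<Sum>i<card F. (norm (S (g (b i))))\<^sup>2) \<le> 2 * M\<^sup>2"
          using hsS[unfolded hs_on_def, rule_format, of "card F" "\<lambda>i. g (b i)"] bK gV by blast
      qed (use c in simp)
      finally show "t \<le> 2 * M\<^sup>2 / c" .
    qed
  qed auto
  then have NA: "N \<in> fhs_class norm"
    unfolding fhs_class_def fhs_equivalent_def using n_sep N_sep n_top N_top b1 b2 by auto
  have sp: "span (H1 \<union> H2) = UNIV"
  proof -
    have "h \<in> span (H1 \<union> H2)" for h
    proof -
      obtain z where z: "z \<in> V" "s z = h" using surj by blast
      then have "fst z \<in> span (H1 \<union> H2)" "snd z \<in> span (H1 \<union> H2)"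
        by (auto simp: V_def intro: span_base)
      then show ?thesis using z(2) by (auto simp: s_def intro: span_add)
    qed
    then show ?thesis by blast
  qed
  have "norm_inner N x y = 0" if "x \<in> H1" "y \<in> H2" for x y
  proof -
    have "D x = (x, 0)" "D y = (0, y)"
      using that subspace_0[OF H1(1)] subspace_0[OF H2(1)] by (auto intro!: Duniq simp: V_def s_def)
    then show ?thesis by (simp add: N_ip inner_prod_def)
  qed
  then show ?thesis
    unfolding fhs_direct_sum_def using H1 H2 sp NA N_top by (auto intro!: bexI[of _ N])
qed

section \<open>Quadratic forms of difference kernels\<close>

lemma L2_measurable: "f \<in> L2 a b \<Longrightarrow> f \<in> borel_measurable borel"
  by (simp add: L2_def)

lemma L2_square_integrable: "f \<in> L2 a b \<Longrightarrow> integrable lborel (\<lambda>x. (f x)\<^sup>2)"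
  by (simp add: L2_def)

lemma L2_outside: "f \<in> L2 a b \<Longrightarrow> x \<notin> {a<..<b} \<Longrightarrow> f x = 0"
  by (simp add: L2_def)

lemma L2_mono: "f \<in> L2 c d \<Longrightarrow> a \<le> c \<Longrightarrow> d \<le> b \<Longrightarrow> f \<in> L2 a b"
  by (auto simp: L2_def)

lemma L2_zero: "(\<lambda>x. 0) \<in> L2 a b" by (simp add: L2_def)

lemma L2_scale: "f \<in> L2 a b \<Longrightarrow> (\<lambda>x. c * f x) \<in> L2 a b"
  by (auto simp: L2_def power_mult_distrib)

lemma L2_add: assumes "f \<in> L2 a b" "g \<in> L2 a b" shows "(\<lambda>x. f x + g x) \<in> L2 a b"
proof -
  have [measurable]: "f \<in> borel_measurable borel" "g \<in> borel_measurable borel" using assms by (auto simp: L2_def)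
  have "integrable lborel (\<lambda>x. (f x + g x)\<^sup>2)"
  proof (rule Bochner_Integration.integrable_bound)
    show "integrable lborel (\<lambda>x. 2 * (f x)\<^sup>2 + 2 * (g x)\<^sup>2)"
      using assms by (auto simp: L2_def)
    have "(f x + g x)\<^sup>2 \<le> 2 * (f x)\<^sup>2 + 2 * (g x)\<^sup>2" for x
      using zero_le_power2[of "f x - g x"] by (simp add: power2_eq_square algebra_simps)
    then show "AE x in lborel. norm ((f x + g x)\<^sup>2) \<le> norm (2 * (f x)\<^sup>2 + 2 * (g x)\<^sup>2)" by simp
  qed simp
  then show ?thesis using assms by (auto simp: L2_def)
qed

lemma L2_bounded: 
  assumes [measurable]: "f \<in> borel_measurable borel" and g: "g \<in> L2 a b" and le: "\<And>x. \<bar>f x\<bar> \<le> \<bar>g x\<bar>"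
  shows "f \<in> L2 a b"
proof -
  have [measurable]: "g \<in> borel_measurable borel" using g by (auto simp: L2_def)
  have "integrable lborel (\<lambda>x. (f x)\<^sup>2)"
    by (rule Bochner_Integration.integrable_bound[OF L2_square_integrable[OF g]])
      (use le in \<open>auto simp: abs_le_square_iff\<close>)
  moreover have "f x = 0" if "x \<notin> {a<..<b}" for x using le[of x] L2_outside[OF g that] by simp
  ultimately show ?thesis by (auto simp: L2_def)
qed

lemma L2_sum: "finite I \<Longrightarrow> (\<And>i. i \<in> I \<Longrightarrow> f i \<in> L2 a b) \<Longrightarrow> (\<lambda>x. \<Sum>i\<in>I. c i * f i x) \<in> L2 a b"
proof (induction I rule: finite_induct)
  case empty then show ?case by (simp add: L2_zero)
next
  case (insert i I)
  then show ?case using L2_add[OF L2_scale[of "f i" a b "c i"]] by simp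
qed

lemma L2_indicator: "A \<in> sets borel \<Longrightarrow> A \<subseteq> {a<..<b} \<Longrightarrow> (indicator A :: real \<Rightarrow> real) \<in> L2 a b"
proof -
  assume A: "A \<in> sets borel" "A \<subseteq> {a<..<b}"
  have "emeasure lborel A \<le> emeasure lborel {a<..<b}" using A by (intro emeasure_mono) auto
  also have "\<dots> < \<infinity>" by (cases "a \<le> b") (auto simp: emeasure_lborel_Ioo)
  finally have "integrable lborel (indicator A :: real \<Rightarrow> real)" using A by (simp add: integrable_indicator_iff)
  moreover have "(\<lambda>x. (indicator A x :: real)\<^sup>2) = indicator A" by (auto simp: indicator_def fun_eq_iff)
  ultimately show ?thesis using A by (auto simp: L2_def indicator_def)
qed

lemma L2_integrable: assumes "f \<in> L2 a b" shows "integrable lborel f"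
proof (rule Bochner_Integration.integrable_bound)
  have [measurable]: "f \<in> borel_measurable borel" using assms by (auto simp: L2_def)
  have "integrable lborel (indicator {a<..<b} :: real \<Rightarrow> real)"
    by (cases "a \<le> b") (auto simp: integrable_indicator_iff)
  then show "integrable lborel (\<lambda>x. (f x)\<^sup>2 + indicator {a<..<b} x)"
    using assms by (auto simp: L2_def)
  have "\<bar>f x\<bar> \<le> (f x)\<^sup>2 + indicator {a<..<b} x" for x
  proof (cases "x \<in> {a<..<b}")
    case True
    have "0 \<le> (\<bar>f x\<bar> - 1)\<^sup>2" by simp
    then have "2 * \<bar>f x\<bar> \<le> (f x)\<^sup>2 + 1" by (simp add: power2_eq_square algebra_simps)
    then show ?thesis using True by simp
  qed (use assms in \<open>simp add: L2_outside\<close>)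
  then show "AE x in lborel. norm (f x) \<le> norm ((f x)\<^sup>2 + indicator {a<..<b} x)" by simp
  show "f \<in> borel_measurable lborel" by simp
qed

section \<open>Absolute convergence for locally integrable kernels\<close>

lemma nn_integral_translate_kernel:
  fixes k :: "real \<Rightarrow> ennreal"
  assumes [measurable]: "k \<in> borel_measurable borel"
  shows "(\<integral>\<^sup>+t. k (s - t) \<partial>lborel) = (\<integral>\<^sup>+t. k t \<partial>lborel)" "(\<integral>\<^sup>+s. k (s - t) \<partial>lborel) = (\<integral>\<^sup>+t. k t \<partial>lborel)"
  using nn_integral_real_affine[of k "-1" s] nn_integral_real_affine[of k 1 "-t"] by (simp_all add: algebra_simps)

text \<open>Schur's test in its simplest form: \<open>|f s * g t|\<close> is at most half the sum of
  the squares, and in each summand the kernel integrates out by translation. Only differences up to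
  \<open>R\<close> occur, so local integrability of the kernel suffices.\<close>

lemma kernel_form_nn_bound:
  fixes k f g :: "real \<Rightarrow> real"
  assumes [measurable]: "k \<in> borel_measurable borel" "f \<in> borel_measurable borel" "g \<in> borel_measurable borel"
    and supp: "\<And>s t. f s \<noteq> 0 \<Longrightarrow> g t \<noteq> 0 \<Longrightarrow> \<bar>s - t\<bar> \<le> R"
  shows "(\<integral>\<^sup>+(s, t). ennreal \<bar>f s * g t * k (s - t)\<bar> \<partial>(lborel \<Otimes>\<^sub>M lborel))
    \<le> (\<integral>\<^sup>+s. ennreal ((f s)\<^sup>2 / 2) \<partial>lborel) * (\<integral>\<^sup>+t. ennreal (indicator {-R..R} t * \<bar>k t\<bar>) \<partial>lborel)
      + (\<integral>\<^sup>+s. ennreal ((g s)\<^sup>2 / 2) \<partial>lborel) * (\<integral>\<^sup>+t. ennreal (indicator {-R..R} t * \<bar>k t\<bar>) \<partial>lborel)"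
proof -
  define kk where "kk t = ennreal (indicator {-R..R} t * \<bar>k t\<bar>)" for t
  have [measurable]: "kk \<in> borel_measurable borel" unfolding kk_def by measurable
  have "(\<integral>\<^sup>+(s, t). ennreal \<bar>f s * g t * k (s - t)\<bar> \<partial>(lborel \<Otimes>\<^sub>M lborel))
      \<le> (\<integral>\<^sup>+(s, t). ennreal ((f s)\<^sup>2 / 2) * kk (s - t) + ennreal ((g t)\<^sup>2 / 2) * kk (s - t) \<partial>(lborel \<Otimes>\<^sub>M lborel))"
  proof (intro nn_integral_mono, clarify)
    fix s t
    show "ennreal \<bar>f s * g t * k (s - t)\<bar> \<le> ennreal ((f s)\<^sup>2 / 2) * kk (s - t) + ennreal ((g t)\<^sup>2 / 2) * kk (s - t)"
    proof (cases "f s \<noteq> 0 \<and> g t \<noteq> 0")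
      case True
      then have 1: "\<bar>s - t\<bar> \<le> R" using supp by blast
      have "0 \<le> (\<bar>f s\<bar> - \<bar>g t\<bar>)\<^sup>2" by simp
      then have "\<bar>f s * g t\<bar> \<le> (f s)\<^sup>2 / 2 + (g t)\<^sup>2 / 2"
        by (simp add: power2_eq_square algebra_simps abs_mult)
      then have "\<bar>f s * g t\<bar> * \<bar>k (s - t)\<bar> \<le> ((f s)\<^sup>2 / 2 + (g t)\<^sup>2 / 2) * \<bar>k (s - t)\<bar>"
        by (rule mult_right_mono) simp
      moreover have "-R \<le> s - t" "s - t \<le> R" using 1 by linarith+
      then have "indicator {-R..R} (s - t) = (1::real)" by simp
      ultimately show ?thesis
        by (simp add: kk_def abs_mult distrib_right flip: ennreal_mult ennreal_plus)
    qed auto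
  qed
  also have "\<dots> = (\<integral>\<^sup>+(s, t). ennreal ((f s)\<^sup>2 / 2) * kk (s - t) \<partial>(lborel \<Otimes>\<^sub>M lborel))
      + (\<integral>\<^sup>+(s, t). ennreal ((g t)\<^sup>2 / 2) * kk (s - t) \<partial>(lborel \<Otimes>\<^sub>M lborel))"
    unfolding split_beta' by (intro nn_integral_add) measurable
  also have "(\<integral>\<^sup>+(s, t). ennreal ((f s)\<^sup>2 / 2) * kk (s - t) \<partial>(lborel \<Otimes>\<^sub>M lborel))
      = (\<integral>\<^sup>+s. ennreal ((f s)\<^sup>2 / 2) \<partial>lborel) * (\<integral>\<^sup>+t. kk t \<partial>lborel)"
    by (subst lborel.nn_integral_fst[symmetric])
      (simp_all add: nn_integral_cmult nn_integral_translate_kernel nn_integral_multc)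
  also have "(\<integral>\<^sup>+(s, t). ennreal ((g t)\<^sup>2 / 2) * kk (s - t) \<partial>(lborel \<Otimes>\<^sub>M lborel))
      = (\<integral>\<^sup>+s. ennreal ((g s)\<^sup>2 / 2) \<partial>lborel) * (\<integral>\<^sup>+t. kk t \<partial>lborel)"
    by (subst lborel_pair.nn_integral_snd[symmetric])
      (simp_all add: nn_integral_cmult nn_integral_translate_kernel nn_integral_multc)
  finally show ?thesis unfolding kk_def .
qed

lemma kernel_form_bound:
  assumes k[measurable]: "k \<in> borel_measurable borel" and ki: "set_integrable lborel {-R..R} k"
    and fg: "f \<in> L2 a b" "g \<in> L2 a b" and R: "b - a \<le> R"
  shows "integrable (lborel \<Otimes>\<^sub>M lborel) (\<lambda>(s, t). f s * g t * k (s - t))"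
    and "(\<integral>(s, t). \<bar>f s * g t * k (s - t)\<bar> \<partial>(lborel \<Otimes>\<^sub>M lborel))
      \<le> ((\<integral>x. (f x)\<^sup>2 \<partial>lborel) + (\<integral>x. (g x)\<^sup>2 \<partial>lborel)) / 2 * (\<integral>t. indicator {-R..R} t * \<bar>k t\<bar> \<partial>lborel)"
proof -
  have [measurable]: "f \<in> borel_measurable borel" "g \<in> borel_measurable borel" using fg by (auto simp: L2_def)
  have supp: "\<bar>s - t\<bar> \<le> R" if "f s \<noteq> 0" "g t \<noteq> 0" for s t
    using L2_outside[OF fg(1), of s] L2_outside[OF fg(2), of t] that R by force
  have ki': "integrable lborel (\<lambda>t. indicator {-R..R} t * \<bar>k t\<bar>)"
    using integrable_abs[OF ki[unfolded set_integrable_def]] by (simp add: abs_mult)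
  let ?C = "\<integral>t. indicator {-R..R} t * \<bar>k t\<bar> \<partial>lborel"
  have C0: "?C \<ge> 0" by (intro integral_nonneg_AE) auto
  have kC: "(\<integral>\<^sup>+t. ennreal (indicator {-R..R} t * \<bar>k t\<bar>) \<partial>lborel) = ennreal ?C"
    by (rule nn_integral_eq_integral[OF ki']) auto
  have f2: "(\<integral>\<^sup>+s. ennreal ((h s)\<^sup>2 / 2) \<partial>lborel) = ennreal ((\<integral>x. (h x)\<^sup>2 \<partial>lborel) / 2)" if "h \<in> L2 a b" for h
    using L2_square_integrable[OF that] by (subst nn_integral_eq_integral) auto
  have le: "(\<integral>\<^sup>+(s, t). ennreal \<bar>f s * g t * k (s - t)\<bar> \<partial>(lborel \<Otimes>\<^sub>M lborel))
      \<le> ennreal (((\<integral>x. (f x)\<^sup>2 \<partial>lborel) + (\<integral>x. (g x)\<^sup>2 \<partial>lborel)) / 2 * ?C)"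
  proof -
    have "0 \<le> (\<integral>x. (h x)\<^sup>2 \<partial>lborel)" for h :: "real \<Rightarrow> real" by simp
    then show ?thesis
      using kernel_form_nn_bound[of k f g R, OF k _ _ supp] C0 unfolding kC f2[OF fg(1)] f2[OF fg(2)]
      by (simp add: distrib_right add_divide_distrib flip: ennreal_mult ennreal_plus)
  qed
  show int: "integrable (lborel \<Otimes>\<^sub>M lborel) (\<lambda>(s, t). f s * g t * k (s - t))"
  proof (rule integrableI_bounded)
    have "(\<integral>\<^sup>+x. ennreal (norm (case x of (s, t) \<Rightarrow> f s * g t * k (s - t))) \<partial>(lborel \<Otimes>\<^sub>M lborel))
        = (\<integral>\<^sup>+(s, t). ennreal \<bar>f s * g t * k (s - t)\<bar> \<partial>(lborel \<Otimes>\<^sub>M lborel))"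
      by (intro nn_integral_cong) (auto split: prod.split)
    then show "(\<integral>\<^sup>+x. ennreal (norm (case x of (s, t) \<Rightarrow> f s * g t * k (s - t))) \<partial>(lborel \<Otimes>\<^sub>M lborel)) < \<infinity>"
      using le by (simp add: order_le_less_trans)
  qed measurable
  have "(\<integral>\<^sup>+(s, t). ennreal \<bar>f s * g t * k (s - t)\<bar> \<partial>(lborel \<Otimes>\<^sub>M lborel))
      = ennreal (\<integral>(s, t). \<bar>f s * g t * k (s - t)\<bar> \<partial>(lborel \<Otimes>\<^sub>M lborel))"
    using nn_integral_eq_integral[OF integrable_abs[OF int]] by (simp add: split_beta')
  with le show "(\<integral>(s, t). \<bar>f s * g t * k (s - t)\<bar> \<partial>(lborel \<Otimes>\<^sub>M lborel))
      \<le> ((\<integral>x. (f x)\<^sup>2 \<partial>lborel) + (\<integral>x. (g x)\<^sup>2 \<partial>lborel)) / 2 * ?C"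
    using C0 by (simp add: ennreal_le_iff mult_nonneg_nonneg)
qed

lemma B_form_bound:
  assumes k[measurable]: "k \<in> borel_measurable borel" and ki: "set_integrable lborel {-R..R} k"
    and f: "f \<in> L2 a b" and R: "b - a \<le> R"
  shows "\<bar>B_form k f f\<bar> \<le> (\<integral>t. indicator {-R..R} t * \<bar>k t\<bar> \<partial>lborel) * (\<integral>x. (f x)\<^sup>2 \<partial>lborel)"
proof -
  have "\<bar>B_form k f f\<bar> \<le> (\<integral>x. \<bar>case x of (s, t) \<Rightarrow> f s * f t * k (s - t)\<bar> \<partial>(lborel \<Otimes>\<^sub>M lborel))"
    unfolding B_form_def using integral_norm_bound[of "lborel \<Otimes>\<^sub>M lborel"] by simp
  also have "\<dots> = (\<integral>(s, t). \<bar>f s * f t * k (s - t)\<bar> \<partial>(lborel \<Otimes>\<^sub>M lborel))"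
    by (intro Bochner_Integration.integral_cong) auto
  finally show ?thesis using kernel_form_bound(2)[OF k ki f f R] by (simp add: mult_ac)
qed

section \<open>Triangle kernels and window integrals\<close>

definition Lam :: "(real \<Rightarrow> real) \<Rightarrow> real \<Rightarrow> real \<Rightarrow> real" where
  "Lam f x r = (\<integral>s. indicator {x..x + r} s * f s \<partial>lborel)"

abbreviation tri :: "real \<Rightarrow> real \<Rightarrow> real" where
  "tri r \<equiv> (\<lambda>t. max 0 (r - \<bar>t\<bar>))"

lemma integral_pair_product:
  fixes f :: "'a::euclidean_space \<Rightarrow> real" and g :: "'b::euclidean_space \<Rightarrow> real"
  assumes f: "integrable lborel f" and g: "integrable lborel g"
  shows "integrable (lborel \<Otimes>\<^sub>M lborel) (\<lambda>(s, t). f s * g t)"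
    and "(\<integral>(s, t). f s * g t \<partial>(lborel \<Otimes>\<^sub>M lborel)) = (\<integral>s. f s \<partial>lborel) * (\<integral>t. g t \<partial>lborel)"
proof -
  have [measurable]: "f \<in> borel_measurable borel" "g \<in> borel_measurable borel" using f g by auto
  show i: "integrable (lborel \<Otimes>\<^sub>M lborel) (\<lambda>(s, t). f s * g t)"
    by (rule lborel_pair.Fubini_integrable) (use f g in \<open>auto simp: abs_mult\<close>)
  from lborel_pair.integral_fst[OF i]
  show "(\<integral>(s, t). f s * g t \<partial>(lborel \<Otimes>\<^sub>M lborel)) = (\<integral>s. f s \<partial>lborel) * (\<integral>t. g t \<partial>lborel)"
    by (simp add: split_beta')
qed

text \<open>The triangle is the autocorrelation of a window: the positions \<open>x\<close> whose
  window contains both points form an interval of length \<open>r - |s - t|\<close>, empty if this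
  is negative.\<close>

lemma integral_indicator_windows:
  fixes s t r :: real
  shows "(\<integral>x. indicator {x..x+r} s * indicator {x..x+r} t \<partial>lborel) = tri r (s - t)"
    and "integrable lborel (\<lambda>x. indicator {x..x+r} s * indicator {x..x+r} t :: real)"
proof -
  have *: "(\<lambda>x. indicator {x..x+r} s * indicator {x..x+r} t) = (indicator {max s t - r..min s t} :: real \<Rightarrow> real)"
    by (auto simp: fun_eq_iff indicator_def)
  show "(\<integral>x. indicator {x..x+r} s * indicator {x..x+r} t \<partial>lborel) = tri r (s - t)"
    unfolding * by (cases "max s t - r \<le> min s t") (auto simp: max_def min_def abs_if split: if_splits)
  show "integrable lborel (\<lambda>x. indicator {x..x+r} s * indicator {x..x+r} t :: real)"
    unfolding * by (cases "max s t - r \<le> min s t") (auto simp: integrable_indicator_iff)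
qed

lemma tri_set_integrable: "set_integrable lborel {-R..R} (tri r)"
  by (intro borel_integrable_atLeastAtMost') (auto intro!: continuous_intros)

lemma indicator_window_measurable [measurable]:
  "(\<lambda>p. indicator {u p..v p} (w p) :: real) \<in> borel_measurable M"
  if [measurable]: "u \<in> borel_measurable M" "v \<in> borel_measurable M" "w \<in> borel_measurable M"
  for u v w :: "'a \<Rightarrow> real"
proof -
  have "(\<lambda>p. indicator {u p..v p} (w p) :: real) = (\<lambda>p. if u p \<le> w p \<and> w p \<le> v p then 1 else 0)"
    by (auto simp: indicator_def)
  then show ?thesis by simp
qed

lemma Lam_measurable [measurable]:
  assumes [measurable]: "f \<in> borel_measurable borel" "u \<in> borel_measurable M" "v \<in> borel_measurable M"
  shows "(\<lambda>p. Lam f (u p) (v p)) \<in> borel_measurable M"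
proof -
  have "(\<lambda>(x, r). Lam f x r) \<in> borel_measurable (borel \<Otimes>\<^sub>M borel)"
    unfolding Lam_def split_beta' by measurable
  then show ?thesis by (rule measurable_compose[of "\<lambda>p. (u p, v p)", unfolded o_def, rotated, where g = "\<lambda>(x, r). Lam f x r", simplified]) measurable
qed

text \<open>Two evaluations of one integral over \<open>s\<close>, \<open>t\<close>,
  \<open>x\<close>. Absolute convergence is inherited from the form, since integrating the absolute
  value over \<open>x\<close> again yields the triangle.\<close>

lemma tri_form:
  assumes f: "f \<in> L2 a b"
  shows "B_form (tri r) f f = (\<integral>x. (Lam f x r)\<^sup>2 \<partial>lborel)"
    and "integrable lborel (\<lambda>x. (Lam f x r)\<^sup>2)"
proof -
  have [measurable]: "f \<in> borel_measurable borel" using f by (auto simp: L2_def)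
  define h where "h = (\<lambda>((s, t), x). f s * f t * (indicator {x..x+r} s * indicator {x..x+r} t))"
  have hm[measurable]: "h \<in> borel_measurable ((lborel \<Otimes>\<^sub>M lborel) \<Otimes>\<^sub>M lborel)"
    unfolding h_def split_beta' by measurable
  have tm: "tri r \<in> borel_measurable borel" by measurable
  note bd = kernel_form_bound[OF tm tri_set_integrable f f order_refl]
  interpret P: pair_sigma_finite "lborel \<Otimes>\<^sub>M lborel :: (real \<times> real) measure" "lborel :: real measure"
    unfolding lborel_prod by (rule lborel_pair.pair_sigma_finite_axioms)
  have inner1: "(\<integral>x. h (p, x) \<partial>lborel) = (case p of (s, t) \<Rightarrow> f s * f t * tri r (s - t))" for p
    by (cases p) (simp add: h_def integral_indicator_windows)
  have inner1': "(\<integral>x. norm (h (p, x)) \<partial>lborel) = norm (case p of (s, t) \<Rightarrow> f s * f t * tri r (s - t))" for p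
    by (cases p) (simp add: h_def integral_indicator_windows abs_mult)
  have hint: "integrable ((lborel \<Otimes>\<^sub>M lborel) \<Otimes>\<^sub>M lborel) h"
  proof (rule P.Fubini_integrable[OF hm])
    show "integrable (lborel \<Otimes>\<^sub>M lborel) (\<lambda>p. \<integral>x. norm (h (p, x)) \<partial>lborel)"
      unfolding inner1' using bd(1) by (rule integrable_norm)
    show "AE p in lborel \<Otimes>\<^sub>M lborel. integrable lborel (\<lambda>x. h (p, x))"
      by (auto simp: h_def split_beta' integral_indicator_windows)
  qed
  have fi: "integrable lborel (\<lambda>s. indicator {x..x+r} s * f s)" for x
    by (rule Bochner_Integration.integrable_bound[OF L2_integrable[OF f]]) (auto simp: indicator_def)
  have inner2: "(\<integral>p. h (p, x) \<partial>(lborel \<Otimes>\<^sub>M lborel)) = (Lam f x r)\<^sup>2" for x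
  proof -
    have "(\<integral>p. h (p, x) \<partial>(lborel \<Otimes>\<^sub>M lborel))
      = (\<integral>(s, t). (indicator {x..x+r} s * f s) * (indicator {x..x+r} t * f t) \<partial>(lborel \<Otimes>\<^sub>M lborel))"
      by (intro Bochner_Integration.integral_cong) (auto simp: h_def mult_ac)
    then show ?thesis using integral_pair_product(2)[OF fi fi, of x x] by (simp add: Lam_def power2_eq_square)
  qed
  have "(\<integral>x. (\<integral>p. h (p, x) \<partial>(lborel \<Otimes>\<^sub>M lborel)) \<partial>lborel) = (\<integral>p. (\<integral>x. h (p, x) \<partial>lborel) \<partial>(lborel \<Otimes>\<^sub>M lborel))"
    using P.Fubini_integral[of "\<lambda>p x. h (p, x)"] hint by simp
  then show "B_form (tri r) f f = (\<integral>x. (Lam f x r)\<^sup>2 \<partial>lborel)"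
    unfolding inner1 inner2 B_form_def by simp
  show "integrable lborel (\<lambda>x. (Lam f x r)\<^sup>2)"
    using P.integrable_snd[of "\<lambda>p x. h (p, x)"] hint unfolding inner2 by simp
qed

lemma B_form_add:
  assumes [measurable]: "k1 \<in> borel_measurable borel" "k2 \<in> borel_measurable borel"
    and "set_integrable lborel {-(b-a)..b-a} k1" "set_integrable lborel {-(b-a)..b-a} k2"
    and f: "f \<in> L2 a b" and g: "g \<in> L2 a b"
  shows "B_form (\<lambda>t. k1 t + k2 t) f g = B_form k1 f g + B_form k2 f g"
proof -
  have "B_form k1 f g + B_form k2 f g = (\<integral>p. (case p of (s, t) \<Rightarrow> f s * g t * k1 (s - t)) +
    (case p of (s, t) \<Rightarrow> f s * g t * k2 (s - t)) \<partial>(lborel \<Otimes>\<^sub>M lborel))"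
    unfolding B_form_def
    by (rule Bochner_Integration.integral_add[symmetric])
      (use kernel_form_bound(1)[OF _ _ f g order_refl] assms in auto)
  also have "\<dots> = B_form (\<lambda>t. k1 t + k2 t) f g"
    unfolding B_form_def by (intro Bochner_Integration.integral_cong) (auto simp: algebra_simps)
  finally show ?thesis ..
qed

lemma B_form_scale: "B_form (\<lambda>t. c * k t) f g = c * B_form k f g"
proof -
  have "B_form (\<lambda>t. c * k t) f g = (\<integral>p. c * (case p of (s, t) \<Rightarrow> f s * g t * k (s - t)) \<partial>(lborel \<Otimes>\<^sub>M lborel))"
    unfolding B_form_def by (intro Bochner_Integration.integral_cong) (auto simp: algebra_simps)
  then show ?thesis by (simp add: B_form_def)
qed

text \<open>Summation by parts: it evaluates at a grid point the combination of triangles weighted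
  by second differences. The truncated subtraction \<open>i - 1\<close> is harmless since
  \<open>i > j\<close>.\<close>

lemma second_difference_sum:
  fixes a :: "nat \<Rightarrow> real"
  assumes "j \<le> N"
  shows "(\<Sum>i\<in>{j<..N}. (real i - real j) * (a (i - 1) - 2 * a i + a (i + 1)))
    = a j - (real N - real j + 1) * a N + (real N - real j) * a (N + 1)"
  using assms
proof (induction N rule: dec_induct)
  case base then show ?case by simp
next
  case (step n)
  have "{j<..Suc n} = insert (Suc n) {j<..n}" using step.hyps by auto
  then show ?case using step.IH by (simp add: algebra_simps)
qed

lemma antimono_lipschitz_abs_continuous:
  fixes k :: "real \<Rightarrow> real"
  assumes dec: "\<And>s t. 0 \<le> s \<Longrightarrow> s \<le> t \<Longrightarrow> k t \<le> k s"
    and lip: "\<And>s t. 0 \<le> s \<Longrightarrow> s \<le> t \<Longrightarrow> k s - k t \<le> l * (t - s)"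
  shows "continuous_on UNIV (\<lambda>t. k \<bar>t\<bar>)"
proof (rule continuous_onI)
  fix x e :: real assume e: "e > 0"
  have l0: "l \<ge> 0" using lip[of 0 1] dec[of 0 1] by simp
  have bd: "\<bar>k s - k t\<bar> \<le> l * \<bar>s - t\<bar>" if "0 \<le> s" "0 \<le> t" for s t
    using lip[of s t] lip[of t s] dec[of s t] dec[of t s] that by (cases "s \<le> t") auto
  show "\<exists>d>0. \<forall>y\<in>UNIV. dist y x < d \<longrightarrow> dist (k \<bar>y\<bar>) (k \<bar>x\<bar>) \<le> e"
  proof (intro exI[of _ "e / (l + 1)"] conjI ballI impI)
    fix y assume "dist y x < e / (l + 1)"
    then have "(l + 1) * \<bar>y - x\<bar> < e" using l0 by (simp add: dist_real_def field_simps)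
    moreover have "\<bar>k \<bar>y\<bar> - k \<bar>x\<bar>\<bar> \<le> l * \<bar>\<bar>y\<bar> - \<bar>x\<bar>\<bar>" by (rule bd) auto
    moreover have "l * \<bar>\<bar>y\<bar> - \<bar>x\<bar>\<bar> \<le> (l + 1) * \<bar>y - x\<bar>" using l0 by (intro mult_mono) auto
    ultimately show "dist (k \<bar>y\<bar>) (k \<bar>x\<bar>) \<le> e" by (simp add: dist_real_def)
  qed (use e l0 in auto)
qed

text \<open>Polya's criterion. The piecewise linear interpolations are positive combinations of triangles.\<close>

lemma polya_form_nonneg:
  fixes k :: "real \<Rightarrow> real"
  assumes dec: "\<And>s t. 0 \<le> s \<Longrightarrow> s \<le> t \<Longrightarrow> k t \<le> k s" and pos: "\<And>t. 0 \<le> t \<Longrightarrow> 0 \<le> k t"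
    and mid: "\<And>x h. 0 \<le> h \<Longrightarrow> h \<le> x \<Longrightarrow> 2 * k x \<le> k (x - h) + k (x + h)"
    and lip: "\<And>s t. 0 \<le> s \<Longrightarrow> s \<le> t \<Longrightarrow> k s - k t \<le> l * (t - s)"
    and f: "f \<in> L2 a b" and ab: "a < b"
  shows "0 \<le> B_form (\<lambda>t. k \<bar>t\<bar>) f f"
proof -
  define R where "R = b - a"
  have R: "R > 0" using ab by (simp add: R_def)
  have [measurable]: "f \<in> borel_measurable borel" using f by (auto simp: L2_def)
  have l0: "l \<ge> 0" using lip[of 0 1] dec[of 0 1] by simp
  note kUNIV = antimono_lipschitz_abs_continuous[OF dec lip]
  have kcont: "continuous_on {-R..R} (\<lambda>t. k \<bar>t\<bar>)" using kUNIV continuous_on_subset by blast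
  define F where "F = (\<integral>(s, t). \<bar>f s * f t\<bar> \<partial>(lborel \<Otimes>\<^sub>M lborel))"
  note fi = L2_integrable[OF f]
  have ff: "integrable (lborel \<Otimes>\<^sub>M lborel) (\<lambda>(s, t). f s * f t)" using integral_pair_product(1)[OF fi fi] .
  have F0: "F \<ge> 0" unfolding F_def by (intro integral_nonneg_AE) (auto split: prod.split)
  have "- (l * R * F) / real N \<le> B_form (\<lambda>t. k \<bar>t\<bar>) f f" if N: "N > 0" for N :: nat
  proof -
    define h where "h = R / N"
    have h: "h > 0" "real N * h = R" using N R by (auto simp: h_def)
    \<comment> \<open>The values are frozen beyond \<open>R\<close>. This makes the last second
      difference equal to \<open>A (N - 1) - A N\<close>, which is nonnegative by monotonicity
      alone, and leaves the constant \<open>A N\<close> as the tail of the interpolation.\<close>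
    define A where "A i = k (min (real i * h) R)" for i :: nat
    define c where "c i = (A (i - 1) - 2 * A i + A (i + 1)) / h" for i
    have AN: "A (N + 1) = A N" using h by (simp add: A_def distrib_right)
    have Aeq: "A i = k (real i * h)" if "i \<le> N" for i
    proof -
      have "real i * h \<le> real N * h" using that h by (intro mult_right_mono) auto
      then show ?thesis using h by (simp add: A_def)
    qed
    have c0: "c i \<ge> 0" if i: "i \<in> {0<..N}" for i
    proof (cases "i = N")
      case True
      have "A N \<le> A (N - 1)" unfolding A_def using h R by (intro dec) (auto simp: min_def mult_right_mono)
      then show ?thesis using AN h True by (simp add: c_def)
    next
      case False
      have "2 * k (real i * h) \<le> k (real i * h - h) + k (real i * h + h)"
        using i h by (intro mid) (auto simp: Suc_le_eq)
      moreover have "real (i - 1) * h = real i * h - h" using i by (simp add: of_nat_diff algebra_simps)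
      moreover have "real (i + 1) * h = real i * h + h" by (simp add: algebra_simps)
      ultimately have "2 * A i \<le> A (i - 1) + A (i + 1)"
        using i False Aeq[of "i - 1"] Aeq[of i] Aeq[of "i + 1"] by (simp add: le_diff_conv)
      then show ?thesis using h by (simp add: c_def)
    qed
    define I where "I t = A N + (\<Sum>i\<in>{0<..N}. c i * tri (real i * h) t)" for t
    have Ij: "I (real j * h) = A j" if "j \<le> N" for j
    proof -
      have "(\<Sum>i\<in>{0<..N}. c i * tri (real i * h) (real j * h)) = (\<Sum>i\<in>{j<..N}. c i * tri (real i * h) (real j * h))"
        by (rule sum.mono_neutral_right) (use h in \<open>auto simp: max_def mult_right_mono abs_mult\<close>)
      also have "\<dots> = (\<Sum>i\<in>{j<..N}. (real i - real j) * (A (i - 1) - 2 * A i + A (i + 1)))"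
      proof (intro sum.cong refl)
        fix i assume "i \<in> {j<..N}"
        then have "tri (real i * h) (real j * h) = (real i - real j) * h"
          using h by (auto simp: max_def algebra_simps abs_mult)
        then show "c i * tri (real i * h) (real j * h) = (real i - real j) * (A (i - 1) - 2 * A i + A (i + 1))"
          using h by (simp add: c_def)
      qed
      also have "\<dots> = A j - A N" unfolding second_difference_sum[OF that] AN by (simp add: algebra_simps)
      finally show ?thesis by (simp add: I_def)
    qed
    have Idec: "I t \<le> I s" if "0 \<le> s" "s \<le> t" for s t
      unfolding I_def using c0 that by (intro add_left_mono sum_mono mult_left_mono) auto
    have Ieven: "I \<bar>t\<bar> = I t" for t by (simp add: I_def)
    \<comment> \<open>Both functions decrease and agree at the grid points, so inside a cell they
      differ by at most the drop of \<open>k\<close> across it.\<close>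
    have close: "\<bar>I \<bar>t\<bar> - k \<bar>t\<bar>\<bar> \<le> l * h" if t: "\<bar>t\<bar> \<le> R" for t
    proof -
      \<comment> \<open>The minimum assigns the endpoint \<open>|t| = R\<close> to the last
        cell.\<close>
      define j where "j = min (N - 1) (nat \<lfloor>\<bar>t\<bar> / h\<rfloor>)"
      have jN: "j < N" using N by (simp add: j_def)
      have j1: "real j * h \<le> \<bar>t\<bar>"
      proof -
        have "real j \<le> real (nat \<lfloor>\<bar>t\<bar> / h\<rfloor>)" by (simp add: j_def)
        also have "\<dots> \<le> \<bar>t\<bar> / h" using h by (simp add: of_nat_nat)
        finally show ?thesis using h by (simp add: field_simps)
      qed
      have j2: "\<bar>t\<bar> \<le> real (j + 1) * h"
      proof (cases "nat \<lfloor>\<bar>t\<bar> / h\<rfloor> \<le> N - 1")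
        case True
        then have "j = nat \<lfloor>\<bar>t\<bar> / h\<rfloor>" by (simp add: j_def)
        then have "\<bar>t\<bar> / h \<le> real j + 1" using h by (simp add: of_nat_nat)
        then show ?thesis using h by (simp add: field_simps)
      next
        case False
        then have "real (j + 1) * h = R" using N h by (simp add: j_def)
        then show ?thesis using t by simp
      qed
      have "I (real (j + 1) * h) \<le> I \<bar>t\<bar>" "I \<bar>t\<bar> \<le> I (real j * h)"
        using j1 j2 h by (auto intro!: Idec)
      moreover have "k (real (j + 1) * h) \<le> k \<bar>t\<bar>" "k \<bar>t\<bar> \<le> k (real j * h)"
        using j1 j2 h by (auto intro!: dec)
      moreover have "k (real j * h) - k (real (j + 1) * h) \<le> l * h"
        using lip[of "real j * h" "real (j + 1) * h"] h by (simp add: algebra_simps)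
      ultimately show ?thesis using Ij[of j] Ij[of "j + 1"] jN Aeq[of j] Aeq[of "j + 1"] by auto
    qed
    have Im[measurable]: "I \<in> borel_measurable borel" unfolding I_def by measurable
    have Icont: "continuous_on UNIV I" unfolding I_def by (intro continuous_intros)
    have Iint: "set_integrable lborel {-R..R} I"
      by (intro borel_integrable_atLeastAtMost' continuous_on_subset[OF Icont]) auto
    have kint: "set_integrable lborel {-R..R} (\<lambda>t. k \<bar>t\<bar>)" by (intro borel_integrable_atLeastAtMost' kcont)
    have km: "(\<lambda>t. k \<bar>t\<bar>) \<in> borel_measurable borel"
      by (rule borel_measurable_continuous_onI[OF kUNIV])
    have trii: "B_form (tri r) f f \<ge> 0" for r
      unfolding tri_form(1)[OF f] by (intro integral_nonneg_AE) auto
    have Ipos: "B_form I f f \<ge> 0"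
    proof -
      have "B_form (\<lambda>t. A N + (\<Sum>i\<in>S. c i * tri (real i * h) t)) f f \<ge> 0" if "finite S" "S \<subseteq> {0<..N}" for S
        using that
      proof (induction S rule: finite_induct)
        case empty
        have "B_form (\<lambda>t. A N) f f = (\<integral>p. A N * (case p of (s, t) \<Rightarrow> f s * f t) \<partial>(lborel \<Otimes>\<^sub>M lborel))"
          unfolding B_form_def by (intro Bochner_Integration.integral_cong) auto
        also have "\<dots> = A N * (\<integral>s. f s \<partial>lborel)\<^sup>2"
          using integral_pair_product(2)[OF fi fi] by (simp add: power2_eq_square)
        also have "\<dots> \<ge> 0" using pos[of R] R h by (simp add: A_def)
        finally show ?case by simp
      next
        case (insert i S)
        let ?k1 = "\<lambda>t. c i * tri (real i * h) t" and ?k2 = "\<lambda>t. A N + (\<Sum>i\<in>S. c i * tri (real i * h) t)"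
        have "B_form (\<lambda>t. ?k1 t + ?k2 t) f f = B_form ?k1 f f + B_form ?k2 f f"
          by (rule B_form_add[OF _ _ _ _ f f]; (intro borel_integrable_atLeastAtMost' continuous_intros)?) auto
        moreover have "B_form ?k1 f f \<ge> 0"
          unfolding B_form_scale using c0 trii insert.prems by (intro mult_nonneg_nonneg) auto
        moreover have "(\<lambda>t. ?k1 t + ?k2 t) = (\<lambda>t. A N + (\<Sum>i\<in>insert i S. c i * tri (real i * h) t))"
          using insert.hyps by (simp add: fun_eq_iff)
        ultimately show ?case using insert by simp
      qed
      from this[of "{0<..N}"] show ?thesis unfolding I_def by simp
    qed
    have "B_form I f f - B_form (\<lambda>t. k \<bar>t\<bar>) f f \<le> (\<integral>p. (l * h) * (case p of (s, t) \<Rightarrow> \<bar>f s * f t\<bar>) \<partial>(lborel \<Otimes>\<^sub>M lborel))"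
    proof -
      have i1: "integrable (lborel \<Otimes>\<^sub>M lborel) (\<lambda>(s, t). f s * f t * I (s - t))"
        using kernel_form_bound(1)[OF Im Iint f f] by (simp add: R_def)
      have i2: "integrable (lborel \<Otimes>\<^sub>M lborel) (\<lambda>(s, t). f s * f t * k \<bar>s - t\<bar>)"
        using kernel_form_bound(1)[OF km kint f f] by (simp add: R_def)
      have i3: "integrable (lborel \<Otimes>\<^sub>M lborel) (\<lambda>(s, t). \<bar>f s * f t\<bar>)"
        using integrable_abs[OF ff] by (simp add: split_beta')
      show ?thesis
        unfolding B_form_def Bochner_Integration.integral_diff[OF i1 i2, symmetric]
      proof (rule integral_mono)
        show "integrable (lborel \<Otimes>\<^sub>M lborel) (\<lambda>p. (l * h) * (case p of (s, t) \<Rightarrow> \<bar>f s * f t\<bar>))" using i3 by simp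
        show "integrable (lborel \<Otimes>\<^sub>M lborel) (\<lambda>x. (case x of (s, t) \<Rightarrow> f s * f t * I (s - t)) -
            (case x of (s, t) \<Rightarrow> f s * f t * k \<bar>s - t\<bar>))"
          using i1 i2 by (rule Bochner_Integration.integrable_diff)
        fix p :: "real \<times> real"
        obtain s t where p: "p = (s, t)" by force
        have "f s * f t * I (s - t) - f s * f t * k \<bar>s - t\<bar> \<le> l * h * \<bar>f s * f t\<bar>"
        proof (cases "f s = 0 \<or> f t = 0")
          case False
          then have "s \<in> {a<..<b}" "t \<in> {a<..<b}" using L2_outside[OF f] by blast+
          then have "\<bar>s - t\<bar> \<le> R" by (auto simp: R_def)
          then have "\<bar>I (s - t) - k \<bar>s - t\<bar>\<bar> \<le> l * h" using close Ieven by metis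
          then have "\<bar>f s * f t\<bar> * \<bar>I (s - t) - k \<bar>s - t\<bar>\<bar> \<le> \<bar>f s * f t\<bar> * (l * h)" by (rule mult_left_mono) simp
          moreover have "f s * f t * (I (s - t) - k \<bar>s - t\<bar>) \<le> \<bar>f s * f t\<bar> * \<bar>I (s - t) - k \<bar>s - t\<bar>\<bar>"
            by (metis abs_ge_self abs_mult)
          ultimately show ?thesis by (simp add: algebra_simps)
        qed auto
        then show "(case p of (s, t) \<Rightarrow> f s * f t * I (s - t)) - (case p of (s, t) \<Rightarrow> f s * f t * k \<bar>s - t\<bar>)
            \<le> l * h * (case p of (s, t) \<Rightarrow> \<bar>f s * f t\<bar>)" by (simp add: p)
      qed
    qed
    also have "\<dots> = l * h * F" by (simp add: F_def)
    finally show ?thesis using Ipos by (simp add: h_def)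
  qed
  then have lim: "- (l * R * F) / real N \<le> B_form (\<lambda>t. k \<bar>t\<bar>) f f" if "N \<ge> 1" for N using that by simp
  have "(\<lambda>N. - (l * R * F) / real N) \<longlonglongrightarrow> 0" by real_asymp
  then show ?thesis by (rule LIMSEQ_le_const2) (use lim in auto)
qed

section \<open>The logarithmic kernel and its convex splitting\<close>

text \<open>The bound \<open>3 * \<alpha> <= ln (1 / e0)\<close> lets the leading term of the second
  derivative absorb the negative one on \<open>(0, e0]\<close>. The explicit formula reaches up to
  \<open>2 * e0\<close> so that \<open>e0\<close> is an interior point and the tangent there is
  available.\<close>

locale logarithmic_kernel =
  fixes \<alpha> e0 :: real and B :: "real \<Rightarrow> real"
  assumes alpha: "1 < \<alpha>"
    and even: "\<And>t. t \<noteq> 0 \<Longrightarrow> B (- t) = B t"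
    and nonneg: "\<And>t. 0 < t \<Longrightarrow> 0 \<le> B t"
    and dec: "\<And>s t. 0 < s \<Longrightarrow> s \<le> t \<Longrightarrow> B t \<le> B s"
    and conv: "convex_on {0<..} B"
    and e0: "0 < e0" "3 * \<alpha> \<le> ln (1 / e0)"
    and explicit: "\<And>t. 0 < t \<Longrightarrow> t < 2 * e0 \<Longrightarrow> B t = 1 / (t * ln (1 / t) powr \<alpha>)"
begin

lemma B_abs: "t \<noteq> 0 \<Longrightarrow> B \<bar>t\<bar> = B t"
  using even[of t] by (auto simp: abs_if)

lemma B_measurable [measurable]: "B \<in> borel_measurable borel"
proof -
  have "continuous_on {0<..} B" by (rule convex_on_continuous[OF _ conv]) auto
  then have [measurable]: "(\<lambda>x. indicator {0<..} x *\<^sub>R B x) \<in> borel_measurable borel"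
    by (intro borel_measurable_continuous_on_indicator) auto
  have "B = (\<lambda>t. if t = 0 then B 0 else indicator {0<..} \<bar>t\<bar> *\<^sub>R B \<bar>t\<bar>)"
    using B_abs by (auto simp: fun_eq_iff)
  moreover have "(\<lambda>t. if t = 0 then B 0 else indicator {0<..} \<bar>t\<bar> *\<^sub>R B \<bar>t\<bar>) \<in> borel_measurable borel"
    by measurable
  ultimately show ?thesis by metis
qed

section \<open>Derivatives of the kernel near zero\<close>

definition L :: "real \<Rightarrow> real" where "L t = ln (1 / t)"

definition dB :: "real \<Rightarrow> real" where
  "dB t = - (L t powr (-\<alpha>)) / t\<^sup>2 + \<alpha> * L t powr (-\<alpha>-1) / t\<^sup>2"

definition ddB :: "real \<Rightarrow> real" where
  "ddB t = 2 * L t powr (-\<alpha>) / t^3 - 3 * \<alpha> * L t powr (-\<alpha>-1) / t^3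
     + \<alpha> * (\<alpha> + 1) * L t powr (-\<alpha>-2) / t^3"

lemma e0_less_1: "2 * e0 < 1"
proof -
  have "2 < ln (1 / e0)" using e0(2) alpha by linarith
  then have "exp 2 < exp (ln (1 / e0))" by simp
  then have "exp 2 < 1 / e0" using e0(1) by simp
  moreover have "(2::real) < exp 2" using exp_ge_add_one_self[of 2] by linarith
  ultimately have "2 < 1 / e0" by linarith
  then show ?thesis using e0(1) by (simp add: field_simps)
qed

lemma L_pos: "0 < t \<Longrightarrow> t < 2 * e0 \<Longrightarrow> L t > 0"
  using e0_less_1 by (simp add: L_def)

lemma L_ge: "0 < t \<Longrightarrow> t \<le> e0 \<Longrightarrow> L t \<ge> 3 * \<alpha>"
  using e0 unfolding L_def by (smt (verit) divide_pos_pos frac_le ln_mono)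

lemma B_eq: "0 < t \<Longrightarrow> t < 2 * e0 \<Longrightarrow> B t = L t powr (-\<alpha>) / t"
  using explicit[of t] L_pos[of t] by (simp add: L_def powr_minus field_simps)

lemma L_deriv: "0 < t \<Longrightarrow> (L has_real_derivative (- 1 / t)) (at t)"
  unfolding L_def by (auto intro!: derivative_eq_intros simp: field_simps)

lemma L_powr_deriv:
  assumes "0 < t" "t < 2 * e0"
  shows "((\<lambda>t. L t powr c) has_real_derivative (- c * L t powr (c - 1) / t)) (at t)"
  using DERIV_fun_powr[OF L_deriv[OF assms(1)] L_pos[OF assms], of c] by simp

lemma L_powr_quotient_deriv:
  assumes t: "0 < t" "t < 2 * e0"
  shows "((\<lambda>t. L t powr c / t ^ Suc n) has_real_derivative
    - (c * L t powr (c - 1) / t ^ (n + 2)) - real (Suc n) * L t powr c / t ^ (n + 2)) (at t)"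
proof -
  have "((\<lambda>t. L t powr c / t ^ Suc n) has_real_derivative
      ((- c * L t powr (c - 1) / t) * t ^ Suc n - L t powr c * (real (Suc n) * t ^ n)) / (t ^ Suc n * t ^ Suc n)) (at t)"
    using DERIV_divide[OF L_powr_deriv[OF t, of c] DERIV_pow[of "Suc n" t]] t by simp
  moreover have "((- c * L t powr (c - 1) / t) * t ^ Suc n - L t powr c * (real (Suc n) * t ^ n)) / (t ^ Suc n * t ^ Suc n)
      = - (c * L t powr (c - 1) / t ^ (n + 2)) - real (Suc n) * L t powr c / t ^ (n + 2)"
    using t by (simp add: divide_simps) (simp add: algebra_simps)
  ultimately show ?thesis by metis
qed

lemma B_deriv:
  assumes t: "0 < t" "t < 2 * e0"
  shows "(B has_real_derivative dB t) (at t)"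
proof -
  have "((\<lambda>t. L t powr (-\<alpha>) / t) has_real_derivative dB t) (at t)"
    using L_powr_quotient_deriv[OF t, of "-\<alpha>" 0] by (simp add: dB_def algebra_simps power2_eq_square)
  moreover have "\<forall>\<^sub>F x in nhds t. B x = L x powr (-\<alpha>) / x"
    using eventually_nhds_in_open[of "{0<..<2*e0}" t] t by (auto elim!: eventually_mono simp: B_eq)
  ultimately show ?thesis using DERIV_cong_ev[OF refl _ refl, of B "\<lambda>t. L t powr (-\<alpha>) / t" t] by metis
qed

lemma dB_deriv:
  assumes t: "0 < t" "t < 2 * e0"
  shows "(dB has_real_derivative ddB t) (at t)"
proof -
  have "((\<lambda>t. \<alpha> * (L t powr (-\<alpha>-1) / t ^ Suc 1) - L t powr (-\<alpha>) / t ^ Suc 1) has_real_derivative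
      \<alpha> * (- ((-\<alpha>-1) * L t powr (-\<alpha>-1 - 1) / t ^ (1 + 2)) - real (Suc 1) * L t powr (-\<alpha>-1) / t ^ (1 + 2))
      - (- ((-\<alpha>) * L t powr (-\<alpha> - 1) / t ^ (1 + 2)) - real (Suc 1) * L t powr (-\<alpha>) / t ^ (1 + 2))) (at t)"
    by (intro DERIV_diff DERIV_cmult L_powr_quotient_deriv[OF t])
  moreover have "(\<lambda>t. \<alpha> * (L t powr (-\<alpha>-1) / t ^ Suc 1) - L t powr (-\<alpha>) / t ^ Suc 1) = dB"
    by (simp add: fun_eq_iff dB_def power2_eq_square)
  moreover have "\<alpha> * (- ((-\<alpha>-1) * L t powr (-\<alpha>-1 - 1) / t ^ (1 + 2)) - real (Suc 1) * L t powr (-\<alpha>-1) / t ^ (1 + 2))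
      - (- ((-\<alpha>) * L t powr (-\<alpha> - 1) / t ^ (1 + 2)) - real (Suc 1) * L t powr (-\<alpha>) / t ^ (1 + 2)) = ddB t"
  proof -
    have e: "- \<alpha> - 1 - 1 = - \<alpha> - 2" by simp
    have "\<alpha> * (- ((-\<alpha>-1) * Z / p) - real (Suc 1) * Y / p)
      - (- ((-\<alpha>) * Y / p) - real (Suc 1) * X / p)
      = 2 * X / p - 3 * \<alpha> * Y / p + \<alpha> * (\<alpha> + 1) * Z / p" for X Y Z p :: real
      by (simp add: add_divide_distrib diff_divide_distrib algebra_simps)
    moreover have "(1::nat) + 2 = 3" by simp
    ultimately show ?thesis unfolding ddB_def e by metis
  qed
  ultimately show ?thesis by metis
qed

text \<open>Since \<open>3 * \<alpha> <= L t\<close>, the negative middle term costs at most one of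
  the two copies of the leading term; the last term is positive.\<close>

lemma ddB_ge:
  assumes t: "0 < t" "t \<le> e0"
  shows "L t powr (-\<alpha>) / t^3 \<le> ddB t"
proof -
  have Lp: "L t > 0" using L_pos t e0 by simp
  have "3 * \<alpha> * L t powr (-\<alpha>-1) \<le> L t * L t powr (-\<alpha>-1)"
    using L_ge[OF t] by (intro mult_right_mono) auto
  also have "\<dots> = L t powr (-\<alpha>)" using Lp by (simp add: powr_diff powr_mult_base powr_minus_divide)
  finally have "L t powr (-\<alpha>) \<le> 2 * L t powr (-\<alpha>) - 3 * \<alpha> * L t powr (-\<alpha>-1) + \<alpha> * (\<alpha> + 1) * L t powr (-\<alpha>-2)"
    using alpha by (simp add: add_increasing2)
  then have "L t powr (-\<alpha>) / t^3 \<le> (2 * L t powr (-\<alpha>) - 3 * \<alpha> * L t powr (-\<alpha>-1) + \<alpha> * (\<alpha> + 1) * L t powr (-\<alpha>-2)) / t^3"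
    using t by (intro divide_right_mono) auto
  then show ?thesis by (simp add: ddB_def add_divide_distrib diff_divide_distrib)
qed

lemma ddB_nonneg: "0 < t \<Longrightarrow> t \<le> e0 \<Longrightarrow> 0 \<le> ddB t"
  using ddB_ge[of t] by (meson divide_nonneg_nonneg less_imp_le order_trans powr_ge_zero zero_le_power)

lemma ddB_measurable [measurable]: "ddB \<in> borel_measurable borel"
  unfolding ddB_def L_def by measurable

section \<open>The nonsingular part of the kernel\<close>

lemma tangent: "0 < x \<Longrightarrow> B e0 + dB e0 * (x - e0) \<le> B x"
  using convex_on_imp_above_tangent[OF conv, of e0 x "dB e0"] B_deriv[of e0] e0
  by (auto simp: interior_open has_field_derivative_at_within)

lemma dB_e0_nonpos: "dB e0 \<le> 0"
  using tangent[of "2 * e0"] dec[of e0 "2 * e0"] e0 by (simp add: mult_le_0_iff) (smt (verit) mult_pos_pos)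

text \<open>Below \<open>e0\<close> the graph is replaced by its tangent at \<open>e0\<close>. The
  result stays decreasing and convex and becomes Lipschitz, so Polya's criterion applies; and
  \<open>B - k1\<close> vanishes beyond \<open>e0\<close> and to first order at \<open>e0\<close>,
  so its expansion into triangles has no boundary terms.\<close>

definition k1 :: "real \<Rightarrow> real" where
  "k1 u = (if u < e0 then B e0 + dB e0 * (u - e0) else B u)"

lemma k1_linear: "u \<le> e0 \<Longrightarrow> k1 u = B e0 + dB e0 * (u - e0)"
  by (cases "u = e0") (auto simp: k1_def)

lemma k1_le: "0 < u \<Longrightarrow> k1 u \<le> B u"
  using tangent by (auto simp: k1_def)

lemma k1_ge: "0 \<le> u \<Longrightarrow> B e0 + dB e0 * (u - e0) \<le> k1 u"
  using tangent[of u] e0 by (auto simp: k1_def)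

lemma k1_dec: assumes "0 \<le> s" "s \<le> t" shows "k1 t \<le> k1 s"
proof -
  have 1: "k1 t \<le> k1 s" if "s \<le> t" "t \<le> e0" for s t
  proof -
    have "k1 s = B e0 + dB e0 * (s - e0)" "k1 t = B e0 + dB e0 * (t - e0)"
      using that by (auto intro: k1_linear)
    then show ?thesis using dB_e0_nonpos mult_left_mono_neg[of "s - e0" "t - e0" "dB e0"] that by simp
  qed
  have 2: "k1 t \<le> k1 s" if "e0 \<le> s" "s \<le> t" for s t
    using that dec[of s t] e0 by (simp add: k1_def)
  show ?thesis using 1[of s t] 2[of s t] 1[of s e0] 2[of e0 t] assms by linarith
qed

lemma k1_nonneg: "0 \<le> t \<Longrightarrow> 0 \<le> k1 t"
  using k1_dec[of t "max t e0"] nonneg[of "max t e0"] e0 by (auto simp: k1_def max_def split: if_splits)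

text \<open>The slopes of a convex decreasing function are steepest on the left, where they equal
  \<open>dB e0\<close>.\<close>

lemma k1_lip: assumes "0 \<le> s" "s \<le> t" shows "k1 s - k1 t \<le> - dB e0 * (t - s)"
proof -
  have lin: "k1 s - k1 t = - dB e0 * (t - s)" if "s \<le> t" "t \<le> e0" for s t
  proof -
    have "k1 s = B e0 + dB e0 * (s - e0)" "k1 t = B e0 + dB e0 * (t - e0)"
      using that by (auto intro: k1_linear)
    then show ?thesis by (simp add: algebra_simps)
  qed
  have big: "k1 s - k1 t \<le> - dB e0 * (t - s)" if st: "e0 \<le> s" "s \<le> t" for s t
  proof (cases "s = t \<or> s = e0")
    case True
    then show ?thesis using tangent[of t] st e0 by (auto simp: k1_def algebra_simps)
  next
    case False
    then have lt: "e0 < s" "s < t" using st by auto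
    have "dB e0 \<le> (B e0 - B s) / (e0 - s)"
      using tangent[of s] lt e0 by (simp add: field_simps)
    also have "\<dots> \<le> (B e0 - B t) / (e0 - t)"
      using convex_on_slope_le(1)[OF conv _ _ lt] e0 lt by simp
    also have "\<dots> \<le> (B s - B t) / (s - t)"
      using convex_on_slope_le(2)[OF conv _ _ lt] e0 lt by simp
    finally have "dB e0 \<le> (B s - B t) / (s - t)" .
    then show ?thesis using lt e0 by (simp add: k1_def field_simps)
  qed
  show ?thesis
  proof (cases "s < e0 \<and> e0 < t")
    case True
    then have "k1 s - k1 t \<le> - dB e0 * (e0 - s) + - dB e0 * (t - e0)"
      using lin[of s e0] big[of e0 t] by simp
    then show ?thesis by (simp add: algebra_simps)
  qed (use lin[of s t] big[of s t] assms in auto)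
qed

lemma k1_mid: assumes h: "0 \<le> h" "h \<le> x" shows "2 * k1 x \<le> k1 (x - h) + k1 (x + h)"
proof (cases "x \<le> e0")
  case True
  then have "k1 x = B e0 + dB e0 * (x - e0)" by (auto simp: k1_def)
  then show ?thesis using k1_ge[of "x - h"] k1_ge[of "x + h"] h by (simp add: algebra_simps)
next
  case x: False
  show ?thesis
  proof (cases "h = 0")
    case False
    then have hp: "h > 0" using h by simp
    have up: "k1 (x + h) = B (x + h)" "k1 x = B x" using x h by (auto simp: k1_def)
    show ?thesis
    proof (cases "x - h < e0")
      case False
      then have lo: "k1 (x - h) = B (x - h)" "0 < x - h" using e0 by (auto simp: k1_def)
      have "B ((1 - 1/2) *\<^sub>R (x - h) + (1/2) *\<^sub>R (x + h)) \<le> (1 - 1/2) * B (x - h) + (1/2) * B (x + h)"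
        by (rule convex_onD[OF conv]) (use lo hp in auto)
      then show ?thesis using lo up by (simp add: field_simps)
    next
      case True
      \<comment> \<open>The points straddle \<open>e0\<close>. The line through the graph at
        \<open>e0\<close> and at \<open>x\<close>, of slope \<open>q\<close>, lies below
        \<open>k1\<close> both at \<open>x - h\<close> and at \<open>x + h\<close>.\<close>
      define q where "q = (B e0 - B x) / (e0 - x)"
      have "dB e0 \<le> q" using tangent[of x] x e0 by (simp add: q_def field_simps)
      have lo: "k1 (x - h) = B e0 + dB e0 * (x - h - e0)" using True by (simp add: k1_def)
      have "q * (x - h - e0) \<le> dB e0 * (x - h - e0)"
        using \<open>dB e0 \<le> q\<close> True by (intro mult_right_mono_neg) auto
      moreover have "B e0 + q * (x - e0) = B x" using x by (simp add: q_def field_simps)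
      ultimately have 1: "B x - q * h \<le> k1 (x - h)" unfolding lo by (simp add: algebra_simps)
      have "q \<le> (B e0 - B (x + h)) / (e0 - (x + h))"
        unfolding q_def using convex_on_slope_le(1)[OF conv, of e0 "x + h" x] x e0 hp by simp
      also have "\<dots> \<le> (B x - B (x + h)) / (x - (x + h))"
        using convex_on_slope_le(2)[OF conv, of e0 "x + h" x] x e0 hp by simp
      finally have "B x + q * h \<le> B (x + h)" using hp by (simp add: field_simps)
      then show ?thesis using 1 up by simp
    qed
  qed simp
qed

lemma k1_continuous: "continuous_on UNIV (\<lambda>t. k1 \<bar>t\<bar>)"
  by (rule antimono_lipschitz_abs_continuous[OF k1_dec k1_lip])

lemma k1_measurable [measurable]: "(\<lambda>t. k1 \<bar>t\<bar>) \<in> borel_measurable borel"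
  by (rule borel_measurable_continuous_onI[OF k1_continuous])

lemma k1_set_integrable: "set_integrable lborel {-R..R} (\<lambda>t. k1 \<bar>t\<bar>)"
  by (intro borel_integrable_atLeastAtMost' continuous_on_subset[OF k1_continuous]) auto

text \<open>The antiderivative \<open>L t powr (1 - \<alpha>) / (\<alpha> - 1)\<close> tends to 0 at
  0 because \<open>\<alpha> > 1\<close>.\<close>

lemma B_near_zero_integrable: "set_integrable lborel {0<..<e0} B"
proof -
  define F where "F t = L t powr (1 - \<alpha>) / (\<alpha> - 1)" for t
  have "set_integrable lborel (einterval 0 e0) B"
  proof (rule interval_integral_FTC_nonneg(1)[where F = F and A = 0 and B = "F e0"])
    show "(0::ereal) < ereal e0" using e0 by simp
    show "DERIV F x :> B x" if "0 < ereal x" "ereal x < ereal e0" for x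
    proof -
      have x: "0 < x" "x < 2 * e0" using that e0 by auto
      have "(F has_real_derivative (- (1 - \<alpha>) * L x powr (1 - \<alpha> - 1) / x / (\<alpha> - 1))) (at x)"
        unfolding F_def using L_powr_deriv[OF x, of "1 - \<alpha>"] by (rule DERIV_cdivide)
      moreover have "- (1 - \<alpha>) * L x powr (1 - \<alpha> - 1) / x / (\<alpha> - 1) = B x"
        using alpha x by (simp add: B_eq field_simps)
      ultimately show ?thesis by simp
    qed
    show "isCont B x" if "0 < ereal x" "ereal x < ereal e0" for x
      using B_deriv[of x] that e0 DERIV_isCont by auto
    show "AE x in lborel. 0 < ereal x \<longrightarrow> ereal x < ereal e0 \<longrightarrow> 0 \<le> B x" using nonneg by auto
    have "(F \<longlongrightarrow> 0) (at_right 0)" unfolding F_def L_def using alpha by real_asymp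
    moreover have "at_right (0::ereal) = filtermap ereal (at_right 0)"
      using at_right_ereal[of 0] by (simp add: zero_ereal_def)
    ultimately show "((F \<circ> real_of_ereal) \<longlongrightarrow> 0) (at_right 0)"
      by (simp add: filterlim_filtermap)
    have "isCont F e0" unfolding F_def
      using DERIV_cdivide[OF L_powr_deriv[of e0 "1 - \<alpha>"]] e0 by (intro DERIV_isCont) auto
    then have "(F \<longlongrightarrow> F e0) (at_left e0)" by (metis at_le continuous_at tendsto_mono top_greatest)
    then show "((F \<circ> real_of_ereal) \<longlongrightarrow> F e0) (at_left (ereal e0))"
      by (simp add: at_left_ereal filterlim_filtermap)
  qed
  then show ?thesis by (simp add: zero_ereal_def)
qed

lemma B_set_integrable: "set_integrable lborel {-R..R} B"
proof -
  have 1: "integrable lborel (\<lambda>t. indicator {0<..<e0} t *\<^sub>R B t)"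
    using B_near_zero_integrable by (simp add: set_integrable_def)
  have 2: "integrable lborel (\<lambda>t. indicator {0<..<e0} (-t) *\<^sub>R B (-t))"
    using lborel_integrable_real_affine[OF 1, of "-1" 0] by simp
  have 3: "integrable lborel (\<lambda>t. indicator {-R..R} t *\<^sub>R k1 \<bar>t\<bar>)"
    using k1_set_integrable[of R] by (simp add: set_integrable_def)
  have m: "(\<lambda>t. indicator {-R..R} t *\<^sub>R B t) \<in> borel_measurable lborel" by measurable
  have le: "norm (indicator {-R..R} t *\<^sub>R B t) \<le> norm (indicator {0<..<e0} t *\<^sub>R B t
     + indicator {0<..<e0} (-t) *\<^sub>R B (-t) + indicator {-R..R} t *\<^sub>R k1 \<bar>t\<bar>)" if "t \<noteq> 0" for t
  proof -
    have a: "B t = B \<bar>t\<bar>" "B (- t) = B \<bar>t\<bar>" "B \<bar>t\<bar> \<ge> 0" "k1 \<bar>t\<bar> \<ge> 0"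
      using that B_abs[of t] even[of t] nonneg[of "\<bar>t\<bar>"] k1_nonneg[of "\<bar>t\<bar>"] by auto
    define X where "X = indicator {0<..<e0} t * B \<bar>t\<bar>"
    define Y where "Y = indicator {0<..<e0} (-t) * B \<bar>t\<bar>"
    define Z where "Z = indicator {-R..R} t * k1 \<bar>t\<bar>"
    have XYZ: "X \<ge> 0" "Y \<ge> 0" "Z \<ge> 0" using a(3,4) by (auto simp: X_def Y_def Z_def)
    have "indicator {-R..R} t * B \<bar>t\<bar> \<le> X + Y + Z"
    proof (cases "\<bar>t\<bar> < e0")
      case True
      have "X + Y = B \<bar>t\<bar>" using True that by (cases "t > 0") (simp_all add: X_def Y_def)
      moreover have "indicator {-R..R} t * B \<bar>t\<bar> \<le> B \<bar>t\<bar>" using a(3) by (simp add: indicator_def)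
      ultimately show ?thesis using XYZ(3) by linarith
    next
      case False
      then have "indicator {-R..R} t * B \<bar>t\<bar> = Z" by (simp add: k1_def Z_def)
      then show ?thesis using XYZ(1,2) by linarith
    qed
    moreover have "0 \<le> indicator {-R..R} t * B \<bar>t\<bar>" using a(3) by simp
    ultimately show ?thesis unfolding a(1,2) X_def Y_def Z_def real_norm_def real_scaleR_def by linarith
  qed
  show ?thesis unfolding set_integrable_def
  proof (rule Bochner_Integration.integrable_bound[OF Bochner_Integration.integrable_add[OF
        Bochner_Integration.integrable_add[OF 1 2] 3] m])
    show "AE t in lborel. norm (indicator {-R..R} t *\<^sub>R B t) \<le> norm (indicator {0<..<e0} t *\<^sub>R B t
     + indicator {0<..<e0} (-t) *\<^sub>R B (-t) + indicator {-R..R} t *\<^sub>R k1 \<bar>t\<bar>)"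
      using AE_lborel_singleton[of 0] by eventually_elim (rule le)
  qed
qed

section \<open>The singular part as a mixture of triangles\<close>

definition w :: "real \<Rightarrow> real" where "w r = indicator {0<..<e0} r * ddB r"

lemma w_nonneg: "0 \<le> w r" using ddB_nonneg by (auto simp: w_def indicator_def)

lemma w_measurable [measurable]: "w \<in> borel_measurable borel"
  unfolding w_def by measurable

definition K0 :: "real \<Rightarrow> real" where "K0 t = B t - k1 \<bar>t\<bar>"

lemma K0_measurable [measurable]: "K0 \<in> borel_measurable borel"
  unfolding K0_def by measurable

lemma K0_set_integrable: "set_integrable lborel {-R..R} K0"
  unfolding K0_def by (intro set_integral_diff B_set_integrable k1_set_integrable)

text \<open>Taylor's formula at \<open>e0\<close> with integral remainder, through the
  antiderivative \<open>dB r * (r - |t|) - B r\<close>. At \<open>t = 0\<close> the mixture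
  diverges, so the diagonal is excluded.\<close>

lemma K0_mixture:
  assumes t: "t \<noteq> 0"
  shows "integrable lborel (\<lambda>r. w r * tri r t)" "(\<integral>r. w r * tri r t \<partial>lborel) = K0 t"
proof -
  have K0t: "K0 t = B \<bar>t\<bar> - k1 \<bar>t\<bar>" using B_abs t by (simp add: K0_def)
  have nn: "(\<integral>\<^sup>+r. ennreal (w r * tri r t) \<partial>lborel) = ennreal (K0 t)"
  proof (cases "\<bar>t\<bar> < e0")
    case False
    then have z: "ennreal (w r * tri r t) = 0" for r by (auto simp: w_def indicator_def)
    show ?thesis unfolding z using False by (simp add: K0t k1_def)
  next
    case True
    have tp: "\<bar>t\<bar> > 0" using t by simp
    have "(\<integral>\<^sup>+r. ennreal (w r * tri r t) \<partial>lborel)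
        = (\<integral>\<^sup>+r. ennreal (ddB r * (r - \<bar>t\<bar>)) * indicator {\<bar>t\<bar>..e0} r \<partial>lborel)"
    proof (rule nn_integral_cong_AE)
      show "AE r in lborel. ennreal (w r * tri r t) = ennreal (ddB r * (r - \<bar>t\<bar>)) * indicator {\<bar>t\<bar>..e0} r"
        using AE_lborel_singleton[of e0] by eventually_elim (use tp in \<open>auto simp: w_def indicator_def\<close>)
    qed
    also have "\<dots> = ennreal ((dB e0 * (e0 - \<bar>t\<bar>) - B e0) - (dB \<bar>t\<bar> * (\<bar>t\<bar> - \<bar>t\<bar>) - B \<bar>t\<bar>))"
    proof (rule nn_integral_FTC_Icc[where F = "\<lambda>r. dB r * (r - \<bar>t\<bar>) - B r"])
      fix r assume r: "r \<in> {\<bar>t\<bar>..e0}"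
      have r': "0 < r" "r < 2 * e0" using r tp by auto
      have "((\<lambda>r. dB r * (r - \<bar>t\<bar>) - B r) has_real_derivative
          (ddB r * (r - \<bar>t\<bar>) + (1 - 0) * dB r) - dB r) (at r)"
        by (intro DERIV_diff DERIV_mult dB_deriv B_deriv r' DERIV_ident DERIV_const)
      then show "((\<lambda>r. dB r * (r - \<bar>t\<bar>) - B r) has_real_derivative ddB r * (r - \<bar>t\<bar>)) (at r)" by simp
      show "0 \<le> ddB r * (r - \<bar>t\<bar>)" using ddB_nonneg[of r] r r' by simp
    qed (use True in auto)
    finally show ?thesis using True by (simp add: K0t k1_def algebra_simps)
  qed
  show i: "integrable lborel (\<lambda>r. w r * tri r t)"
    by (rule integrableI_nonneg) (use nn w_nonneg in \<open>auto intro!: mult_nonneg_nonneg\<close>)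
  have "ennreal (\<integral>r. w r * tri r t \<partial>lborel) = ennreal (K0 t)"
    using nn_integral_eq_integral[OF i] nn w_nonneg by (simp add: mult_nonneg_nonneg)
  moreover have "0 \<le> (\<integral>r. w r * tri r t \<partial>lborel)"
    by (intro integral_nonneg_AE) (auto intro!: mult_nonneg_nonneg w_nonneg)
  moreover have "0 \<le> K0 t" using k1_le[of "\<bar>t\<bar>"] t by (simp add: K0t)
  ultimately show "(\<integral>r. w r * tri r t \<partial>lborel) = K0 t" by (simp add: ennreal_inj)
qed

text \<open>Fubini off the diagonal, which is a null set. It applies because integrating the
  absolute value over \<open>r\<close> reproduces \<open>|f s * f t|\<close> times
  \<open>K0\<close>, whose integral converges. The left side is an extended integral, so later uses
  need no integrability of the windows.\<close>

lemma K0_form: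
  assumes f: "f \<in> L2 a b"
  shows "(\<integral>\<^sup>+r. \<integral>\<^sup>+x. ennreal (w r * (Lam f x r)\<^sup>2) \<partial>lborel \<partial>lborel) = ennreal (B_form K0 f f)"
proof -
  have [measurable]: "f \<in> borel_measurable borel" using f by (auto simp: L2_def)
  interpret P: pair_sigma_finite "lborel \<Otimes>\<^sub>M lborel :: (real \<times> real) measure" "lborel :: real measure"
    unfolding lborel_prod by (rule lborel_pair.pair_sigma_finite_axioms)
  define h where "h = (\<lambda>((s, t), r). f s * f t * (w r * tri r (s - t)))"
  have hm[measurable]: "h \<in> borel_measurable ((lborel \<Otimes>\<^sub>M lborel) \<Otimes>\<^sub>M lborel)"
    unfolding h_def split_beta' by measurable
  have offdiag: "AE p in lborel \<Otimes>\<^sub>M lborel. fst p \<noteq> (snd p :: real)"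
  proof -
    have "AE t in lborel. s \<noteq> t" for s :: real
      using AE_lborel_singleton[of s] by eventually_elim auto
    then show ?thesis by (intro lborel_pair.AE_pair_measure) measurable
  qed
  note bd = kernel_form_bound[OF K0_measurable K0_set_integrable f f order_refl]
  have inner1: "(\<integral>r. h (p, r) \<partial>lborel) = (case p of (s, t) \<Rightarrow> f s * f t * K0 (s - t))" if "fst p \<noteq> snd p" for p
    using that by (cases p) (simp add: h_def K0_mixture)
  have K0p: "K0 u \<ge> 0" if "u \<noteq> 0" for u
    unfolding K0_mixture(2)[OF that, symmetric] by (intro integral_nonneg_AE) (auto intro!: mult_nonneg_nonneg w_nonneg)
  have inner1': "(\<integral>r. norm (h (p, r)) \<partial>lborel) = norm (case p of (s, t) \<Rightarrow> f s * f t * K0 (s - t))"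
    if "fst p \<noteq> snd p" for p
  proof (cases p)
    case (Pair s t)
    then have st: "s - t \<noteq> 0" using that by simp
    have "(\<lambda>r. norm (h (p, r))) = (\<lambda>r. \<bar>f s * f t\<bar> * (w r * tri r (s - t)))"
      using w_nonneg by (auto simp: h_def Pair abs_mult fun_eq_iff)
    then show ?thesis using K0_mixture[OF st] K0p[OF st] by (simp add: Pair abs_mult)
  qed
  have hint: "integrable ((lborel \<Otimes>\<^sub>M lborel) \<Otimes>\<^sub>M lborel) h"
  proof (rule P.Fubini_integrable[OF hm])
    have "integrable (lborel \<Otimes>\<^sub>M lborel) (\<lambda>p. norm (case p of (s, t) \<Rightarrow> f s * f t * K0 (s - t)))"
      using bd(1) by (rule integrable_norm)
    then show "integrable (lborel \<Otimes>\<^sub>M lborel) (\<lambda>p. \<integral>r. norm (h (p, r)) \<partial>lborel)"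
    proof (rule integrable_cong_AE_imp)
      show "AE p in lborel \<Otimes>\<^sub>M lborel. norm (case p of (s, t) \<Rightarrow> f s * f t * K0 (s - t)) = (\<integral>r. norm (h (p, r)) \<partial>lborel)"
        using offdiag by eventually_elim (rule inner1'[symmetric])
    qed measurable
    show "AE p in lborel \<Otimes>\<^sub>M lborel. integrable lborel (\<lambda>r. h (p, r))"
      using offdiag by eventually_elim (auto simp: h_def split_beta' K0_mixture)
  qed
  have inner2: "(\<integral>p. h (p, r) \<partial>(lborel \<Otimes>\<^sub>M lborel)) = w r * B_form (tri r) f f" for r
  proof -
    have "(\<integral>p. h (p, r) \<partial>(lborel \<Otimes>\<^sub>M lborel))
      = (\<integral>p. w r * (case p of (s, t) \<Rightarrow> f s * f t * tri r (s - t)) \<partial>(lborel \<Otimes>\<^sub>M lborel))"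
      by (intro Bochner_Integration.integral_cong) (auto simp: h_def mult_ac)
    then show ?thesis by (simp add: B_form_def)
  qed
  have "(\<integral>r. (\<integral>p. h (p, r) \<partial>(lborel \<Otimes>\<^sub>M lborel)) \<partial>lborel) = (\<integral>p. (\<integral>r. h (p, r) \<partial>lborel) \<partial>(lborel \<Otimes>\<^sub>M lborel))"
    using P.Fubini_integral[of "\<lambda>p r. h (p, r)"] hint by simp
  also have "\<dots> = B_form K0 f f" unfolding B_form_def
    by (rule Bochner_Integration.integral_cong_AE) (use offdiag in \<open>auto elim!: eventually_mono simp: inner1\<close>)
  finally have I: "(\<integral>r. w r * B_form (tri r) f f \<partial>lborel) = B_form K0 f f" unfolding inner2 .
  have rint: "integrable lborel (\<lambda>r. w r * B_form (tri r) f f)"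
    using P.integrable_snd[of "\<lambda>p r. h (p, r)"] hint unfolding inner2 by simp
  have tri0: "B_form (tri r) f f \<ge> 0" for r
    unfolding tri_form(1)[OF f] by (intro integral_nonneg_AE) auto
  have "(\<integral>\<^sup>+x. ennreal (w r * (Lam f x r)\<^sup>2) \<partial>lborel) = ennreal (w r * B_form (tri r) f f)" for r
  proof -
    have "integrable lborel (\<lambda>x. w r * (Lam f x r)\<^sup>2)" using tri_form(2)[OF f, of r] by simp
    from nn_integral_eq_integral[OF this] show ?thesis
      using w_nonneg by (simp add: tri_form(1)[OF f])
  qed
  then show ?thesis
    using nn_integral_eq_integral[OF rint] I w_nonneg tri0 by simp
qed

theorem form_lower_bound:
  assumes f: "f \<in> L2 a b" and ab: "a < b"
  shows "(\<integral>\<^sup>+r. \<integral>\<^sup>+x. ennreal (w r * (Lam f x r)\<^sup>2) \<partial>lborel \<partial>lborel) \<le> ennreal (B_form B f f)"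
proof -
  have "B_form B f f = B_form (\<lambda>t. K0 t + k1 \<bar>t\<bar>) f f" by (simp add: K0_def)
  also have "\<dots> = B_form K0 f f + B_form (\<lambda>t. k1 \<bar>t\<bar>) f f"
    by (rule B_form_add[OF K0_measurable k1_measurable K0_set_integrable k1_set_integrable f f])
  finally have "B_form K0 f f \<le> B_form B f f"
    using polya_form_nonneg[OF k1_dec k1_nonneg k1_mid k1_lip f ab] by simp
  then show ?thesis unfolding K0_form[OF f] by (rule ennreal_leI)
qed

end

section \<open>Smoothing at logarithmically averaged scales\<close>

lemma Lam_sum:
  assumes "finite I" "\<And>i. i \<in> I \<Longrightarrow> f i \<in> L2 a b"
  shows "Lam (\<lambda>x. \<Sum>i\<in>I. c i * f i x) x r = (\<Sum>i\<in>I. c i * Lam (f i) x r)"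
proof -
  have "integrable lborel (\<lambda>s. indicator {x..x+r} s * f i s)" if "i \<in> I" for i
  proof -
    have [measurable]: "f i \<in> borel_measurable borel" using assms(2)[OF that] by (simp add: L2_def)
    show ?thesis
      by (rule Bochner_Integration.integrable_bound[OF L2_integrable[OF assms(2)[OF that]]]) (auto simp: indicator_def)
  qed
  then show ?thesis
    by (simp add: Lam_def sum_distrib_left mult.left_commute[of "indicator _ _"])
qed

lemma Lam_shift: "Lam f x r = (\<integral>\<sigma>. indicator {0..r} \<sigma> * f (x + \<sigma>) \<partial>lborel)"
  using lborel_integral_real_affine[of 1 "\<lambda>s. indicator {x..x + r} s * f s" x]
  by (simp add: Lam_def indicator_def)

lemma lborel_integral_translate:
  fixes f :: "'a::euclidean_space \<Rightarrow> real"
  assumes [measurable]: "f \<in> borel_measurable borel"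
  shows "(\<integral>x. f (c + x) \<partial>lborel) = (\<integral>x. f x \<partial>lborel)"
proof -
  have "(\<integral>x. f x \<partial>lborel) = (\<integral>x. f x \<partial>(distr lborel borel ((+) c)))" by (simp add: lborel_distr_plus)
  also have "\<dots> = (\<integral>x. f (c + x) \<partial>lborel)" by (rule integral_distr) auto
  finally show ?thesis ..
qed

lemma lborel_integrable_translate:
  fixes f :: "'a::euclidean_space \<Rightarrow> real"
  assumes "integrable lborel f"
  shows "integrable lborel (\<lambda>x. f (c + x))"
proof -
  have [measurable]: "f \<in> borel_measurable borel" using assms by auto
  have "integrable (distr lborel borel ((+) c)) f" using assms by (simp add: lborel_distr_plus)
  then show ?thesis by (simp add: integrable_distr_eq)
qed

text \<open>The window lengths \<open>r\<close> are averaged over \<open>[\<rho>\<^sup>2, \<rho>]\<close> with respect to \<open>dr / r\<close>: the bounded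
  distance of \<open>r\<close> from \<open>0\<close> keeps the smoothing kernel bounded, and \<open>ln (1 / r)\<close> varies only by a
  factor \<open>2\<close>.\<close>

context logarithmic_kernel
begin

definition log_density :: "real \<Rightarrow> real \<Rightarrow> real" where
  "log_density \<rho> r = indicator {\<rho>\<^sup>2..\<rho>} r / (r * L \<rho>)"

text \<open>Division by \<open>r\<close> turns the window integral \<open>Lam\<close> into a window
  mean.\<close>

definition log_weight :: "real \<Rightarrow> real \<Rightarrow> real" where "log_weight \<rho> r = log_density \<rho> r / r"

text \<open>The mixture of uniform densities on \<open>[0, r]\<close>: a probability density on
  \<open>[0, \<rho>]\<close>, so that convolution with it approximates the identity while using
  window means only.\<close>

definition phi :: "real \<Rightarrow> real \<Rightarrow> real" where
  "phi \<rho> \<sigma> = (\<integral>r. log_weight \<rho> r * indicator {0..r} \<sigma> \<partial>lborel)"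

lemma L_measurable [measurable]: "L \<in> borel_measurable borel" unfolding L_def by measurable

lemma log_density_measurable [measurable]: "log_density \<rho> \<in> borel_measurable borel" unfolding log_density_def by measurable

lemma log_weight_measurable [measurable]: "log_weight \<rho> \<in> borel_measurable borel" unfolding log_weight_def by measurable

context
  fixes \<rho> :: real assumes rho: "0 < \<rho>" "\<rho> < e0"
begin

lemma rho1: "\<rho> < 1" "L \<rho> > 0" "\<rho>\<^sup>2 < \<rho>" "\<rho>\<^sup>2 > 0"
  using rho e0_less_1 L_pos[of \<rho>] e0 by (auto simp: power2_eq_square)

lemma window_pos: "r \<in> {\<rho>\<^sup>2..\<rho>} \<Longrightarrow> 0 < r"
  using rho1(4) unfolding atLeastAtMost_iff by linarith

lemma log_density_nonneg: "0 \<le> log_density \<rho> r"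
proof (cases "r \<in> {\<rho>\<^sup>2..\<rho>}")
  case True
  then have "r > 0" by (rule window_pos)
  then show ?thesis using rho1(2) by (auto simp: log_density_def)
qed (auto simp: log_density_def log_weight_def)

lemma om_nn_integral: "(\<integral>\<^sup>+r. ennreal (log_density \<rho> r) \<partial>lborel) = 1"
proof -
  have "(\<integral>\<^sup>+r. ennreal (log_density \<rho> r) \<partial>lborel) = (\<integral>\<^sup>+r. ennreal (1 / (r * L \<rho>)) * indicator {\<rho>\<^sup>2..\<rho>} r \<partial>lborel)"
    by (intro nn_integral_cong) (auto simp: log_density_def indicator_def)
  also have "\<dots> = ennreal (ln \<rho> / L \<rho> - ln (\<rho>\<^sup>2) / L \<rho>)"
  proof (rule nn_integral_FTC_Icc[where F = "\<lambda>r. ln r / L \<rho>"])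
    fix r assume r: "r \<in> {\<rho>\<^sup>2..\<rho>}"
    then have r0: "r > 0" by (rule window_pos)
    show "((\<lambda>r. ln r / L \<rho>) has_real_derivative 1 / (r * L \<rho>)) (at r)"
      using DERIV_cdivide[OF DERIV_ln_divide[OF r0], of "L \<rho>"] by simp
    show "0 \<le> 1 / (r * L \<rho>)" using r0 rho1 by simp
  qed (use rho1 in auto)
  also have "ln \<rho> / L \<rho> - ln (\<rho>\<^sup>2) / L \<rho> = 1"
  proof -
    have "ln \<rho> - ln (\<rho>\<^sup>2) = L \<rho>" using rho by (simp add: L_def ln_div ln_realpow)
    then show ?thesis using rho1(2) by (simp add: diff_divide_distrib[symmetric])
  qed
  finally show ?thesis by simp
qed

text \<open>A crude bound, finite thanks to the cutoff at the square of \<rho>; it only serves to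
  justify Fubini.\<close>

lemma om_le: "log_weight \<rho> r \<le> 1 / (\<rho>^4 * L \<rho>) * indicator {\<rho>\<^sup>2..\<rho>} r"
proof (cases "r \<in> {\<rho>\<^sup>2..\<rho>}")
  case True
  then have r: "\<rho>\<^sup>2 \<le> r" "0 < r" using window_pos by auto
  have "\<rho>\<^sup>2 * \<rho>\<^sup>2 \<le> r * r" using r(1) less_imp_le[OF r(2)] by (intro mult_mono) auto
  then have "\<rho>^4 * L \<rho> \<le> r * r * L \<rho>" using rho1 by (intro mult_right_mono) (auto simp: power4_eq_xxxx power2_eq_square mult_ac)
  then have "1 / (r * r * L \<rho>) \<le> 1 / (\<rho>^4 * L \<rho>)" using rho rho1 r by (intro divide_left_mono) auto
  then show ?thesis using True by (simp add: log_density_def log_weight_def mult_ac)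
qed (auto simp: log_density_def log_weight_def)

lemma om_div_nonneg: "0 \<le> log_weight \<rho> r"
proof (cases "r \<in> {\<rho>\<^sup>2..\<rho>}")
  case True
  then have "r > 0" by (rule window_pos)
  then show ?thesis using log_density_nonneg[of r] by (simp add: log_weight_def)
qed (auto simp: log_density_def log_weight_def)

lemma om_window_integrable:
  assumes F: "integrable lborel F"
  shows "integrable (lborel \<Otimes>\<^sub>M lborel) (\<lambda>(\<sigma>, r). log_weight \<rho> r * (indicator {0..r} \<sigma> * F \<sigma>))"
proof (rule Bochner_Integration.integrable_bound)
  have [measurable]: "F \<in> borel_measurable borel" using F by auto
  have 1: "integrable lborel (\<lambda>r. 1 / (\<rho>^4 * L \<rho>) * indicator {\<rho>\<^sup>2..\<rho>} r)"
    using rho1 by (intro integrable_mult_right) (auto simp: integrable_indicator_iff)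
  show "integrable (lborel \<Otimes>\<^sub>M lborel) (\<lambda>(\<sigma>, r). F \<sigma> * (1 / (\<rho>^4 * L \<rho>) * indicator {\<rho>\<^sup>2..\<rho>} r))"
    by (rule integral_pair_product(1)[OF F 1])
  show "(\<lambda>(\<sigma>, r). log_weight \<rho> r * (indicator {0..r} \<sigma> * F \<sigma>)) \<in> borel_measurable (lborel \<Otimes>\<^sub>M lborel)"
    unfolding split_beta' by measurable
  have "norm (log_weight \<rho> r * (indicator {0..r} \<sigma> * F \<sigma>)) \<le> norm (F \<sigma> * (1 / (\<rho>^4 * L \<rho>) * indicator {\<rho>\<^sup>2..\<rho>} r))" for \<sigma> r
  proof -
    have "norm (log_weight \<rho> r * (indicator {0..r} \<sigma> * F \<sigma>)) = log_weight \<rho> r * (indicator {0..r} \<sigma> * \<bar>F \<sigma>\<bar>)"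
      using om_div_nonneg[of r] by (simp add: abs_mult)
    also have "\<dots> \<le> log_weight \<rho> r * \<bar>F \<sigma>\<bar>"
      using om_div_nonneg by (intro mult_left_mono) (auto simp: indicator_def)
    also have "\<dots> \<le> (1 / (\<rho>^4 * L \<rho>) * indicator {\<rho>\<^sup>2..\<rho>} r) * \<bar>F \<sigma>\<bar>"
      using om_le by (intro mult_right_mono) auto
    also have "\<dots> \<le> norm (F \<sigma> * (1 / (\<rho>^4 * L \<rho>) * indicator {\<rho>\<^sup>2..\<rho>} r))"
      by (metis abs_ge_self abs_mult abs_mult_pos' abs_ge_zero mult.commute real_norm_def mult_right_mono)
    finally show ?thesis .
  qed
  then show "AE p in lborel \<Otimes>\<^sub>M lborel. norm (case p of (\<sigma>, r) \<Rightarrow> log_weight \<rho> r * (indicator {0..r} \<sigma> * F \<sigma>))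
      \<le> norm (case p of (\<sigma>, r) \<Rightarrow> F \<sigma> * (1 / (\<rho>^4 * L \<rho>) * indicator {\<rho>\<^sup>2..\<rho>} r))"
    by (auto split: prod.split)
qed

lemma phi_measurable [measurable]: "phi \<rho> \<in> borel_measurable borel"
proof -
  have "(\<lambda>(\<sigma>, r). log_weight \<rho> r * indicator {0..r} \<sigma>) \<in> borel_measurable (borel \<Otimes>\<^sub>M lborel)"
    unfolding split_beta' by measurable
  then show ?thesis unfolding phi_def by measurable
qed

lemma phi_nonneg: "0 \<le> phi \<rho> \<sigma>"
  unfolding phi_def using om_div_nonneg by (intro integral_nonneg_AE) auto

lemma phi_eq_0: "\<sigma> \<notin> {0..\<rho>} \<Longrightarrow> phi \<rho> \<sigma> = 0"
proof -
  assume "\<sigma> \<notin> {0..\<rho>}"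
  then have "(\<lambda>r. log_weight \<rho> r * indicator {0..r} \<sigma>) = (\<lambda>r. 0)"
    by (auto simp: log_density_def log_weight_def indicator_def fun_eq_iff)
  then show ?thesis by (simp add: phi_def)
qed

lemma phi_Lam:
  assumes f: "integrable lborel f"
  shows "integrable lborel (\<lambda>\<sigma>. phi \<rho> \<sigma> * f (x + \<sigma>))"
    and "(\<integral>\<sigma>. phi \<rho> \<sigma> * f (x + \<sigma>) \<partial>lborel) = (\<integral>r. log_weight \<rho> r * Lam f x r \<partial>lborel)"
    and "integrable lborel (\<lambda>r. log_weight \<rho> r * Lam f x r)"
proof -
  note F = lborel_integrable_translate[OF f, of x]
  note I = om_window_integrable[OF F]
  have 1: "(\<integral>r. log_weight \<rho> r * (indicator {0..r} \<sigma> * f (x + \<sigma>)) \<partial>lborel) = phi \<rho> \<sigma> * f (x + \<sigma>)" for \<sigma>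
    unfolding phi_def by (simp add: mult.assoc[symmetric])
  have 2: "(\<integral>\<sigma>. log_weight \<rho> r * (indicator {0..r} \<sigma> * f (x + \<sigma>)) \<partial>lborel) = log_weight \<rho> r * Lam f x r" for r
    unfolding Lam_shift by simp
  show "integrable lborel (\<lambda>\<sigma>. phi \<rho> \<sigma> * f (x + \<sigma>))"
    using lborel_pair.integrable_fst[OF I] unfolding 1 .
  show "integrable lborel (\<lambda>r. log_weight \<rho> r * Lam f x r)"
    using lborel_pair.integrable_snd[OF I] unfolding 2 .
  show "(\<integral>\<sigma>. phi \<rho> \<sigma> * f (x + \<sigma>) \<partial>lborel) = (\<integral>r. log_weight \<rho> r * Lam f x r \<partial>lborel)"
    using lborel_pair.Fubini_integral[OF I] unfolding 1 2 by simp
qed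

lemma phi_integral: "integrable lborel (phi \<rho>)" "(\<integral>\<sigma>. phi \<rho> \<sigma> \<partial>lborel) = 1"
proof -
  \<comment> \<open>A test function equal to 1 on the support of \<open>phi\<close>: its window
    integral from 0 is \<open>r\<close>, which cancels the division in
    \<open>log_weight\<close>.\<close>
  define f :: "real \<Rightarrow> real" where "f = indicator {0..1}"
  have f: "integrable lborel f" by (simp add: f_def integrable_indicator_iff)
  have e: "phi \<rho> \<sigma> * f (0 + \<sigma>) = phi \<rho> \<sigma>" for \<sigma>
    using phi_eq_0[of \<sigma>] rho1 by (cases "\<sigma> \<in> {0..1}") (auto simp: f_def indicator_def)
  show "integrable lborel (phi \<rho>)" using phi_Lam(1)[OF f, of 0] unfolding e .
  have "log_weight \<rho> r * Lam f 0 r = log_density \<rho> r" for r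
  proof (cases "r \<in> {\<rho>\<^sup>2..\<rho>}")
    case True
    then have r: "0 < r" "r \<le> 1" using rho1 window_pos[OF True] by auto
    have "(\<lambda>s. indicator {0..0 + r} s * f s) = indicator {0..r}" using r by (auto simp: f_def indicator_def fun_eq_iff)
    then have "Lam f 0 r = r" using r by (simp add: Lam_def)
    then show ?thesis using r by (simp add: log_weight_def)
  qed (auto simp: log_density_def log_weight_def)
  then have "(\<integral>\<sigma>. phi \<rho> \<sigma> \<partial>lborel) = (\<integral>r. log_density \<rho> r \<partial>lborel)"
    using phi_Lam(2)[OF f, of 0] unfolding e by simp
  also have "\<dots> = 1"
  proof -
    have "integrable lborel (log_density \<rho>)" by (rule integrableI_nonneg) (use log_density_nonneg om_nn_integral in auto)
    from nn_integral_eq_integral[OF this] have "ennreal (\<integral>r. log_density \<rho> r \<partial>lborel) = ennreal 1"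
      using log_density_nonneg om_nn_integral by simp
    then show ?thesis using log_density_nonneg by (subst (asm) ennreal_inj) (auto intro!: integral_nonneg_AE)
  qed
  finally show "(\<integral>\<sigma>. phi \<rho> \<sigma> \<partial>lborel) = 1" .
qed

section \<open>Smoothing in the plane and its cost\<close>

definition psi :: "real \<times> real \<Rightarrow> real" where "psi h = phi \<rho> (fst h) * phi \<rho> (snd h)"

lemma psi_nonneg: "0 \<le> psi h" using phi_nonneg by (simp add: psi_def)

lemma psi_integral: "integrable lborel psi" "(\<integral>h. psi h \<partial>lborel) = 1"
  using integral_pair_product[OF phi_integral(1) phi_integral(1)] phi_integral(2)
  by (simp_all add: psi_def[abs_def] lborel_prod split_beta')

lemma psi_support: "psi h \<noteq> 0 \<Longrightarrow> fst h \<in> {0..\<rho>} \<and> snd h \<in> {0..\<rho>}"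
  using phi_eq_0[of "fst h"] phi_eq_0[of "snd h"] by (auto simp: psi_def)

lemma psi_measurable [measurable]: "psi \<in> borel_measurable borel"
  using psi_integral(1) by auto

text \<open>The sign in \<open>z - h\<close> makes the adjoint average over \<open>p + h\<close>,
  that is, over the forward windows that \<open>Lam\<close> sees.\<close>

definition Phi :: "(real \<times> real \<Rightarrow> real) \<Rightarrow> real \<times> real \<Rightarrow> real" where
  "Phi e z = (\<integral>h. e (z - h) * psi h \<partial>lborel)"

text \<open>An upper bound for the integral of \<open>log_weight^2 / w\<close> in one variable. Two
  variables contribute its square, of which a square root is taken, so a single factor
  remains.\<close>

definition smoothing_cost :: real where "smoothing_cost = 2 powr \<alpha> * L \<rho> powr (\<alpha> - 1)"

text \<open>On the window range \<open>L r <= 2 * L \<rho>\<close>, so \<open>w r\<close> is at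
  least \<open>(2 * L \<rho>) powr (-\<alpha>) / r^3\<close>, while \<open>log_weight\<close> is
  \<open>1 / (r^2 * L \<rho>)\<close>. The powers of \<open>r\<close> combine to
  \<open>1 / r\<close>, the shape of \<open>log_density\<close>; this is why \<open>dr / r\<close>
  is the right average.\<close>

lemma om_w_pointwise:
  assumes r: "r \<in> {\<rho>\<^sup>2..\<rho>}"
  shows "w r > 0" "(log_weight \<rho> r)\<^sup>2 / w r \<le> 2 powr \<alpha> * L \<rho> powr (\<alpha> - 1) * log_density \<rho> r"
proof -
  have r0: "0 < r" "r \<le> e0" "r < e0" using r rho window_pos[OF r] by auto
  have Lr: "L r > 0" using L_pos r0 e0 by simp
  have "ln (\<rho>\<^sup>2) \<le> ln r" by (rule iffD2[OF ln_le_cancel_iff[OF rho1(4) r0(1)]]) (use r in simp)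
  moreover have "ln (1 / r) = - ln r" "ln (1 / \<rho>\<^sup>2) = - ln (\<rho>\<^sup>2)"
    using r0(1) rho1(4) by (simp_all only: ln_one ln_div zero_less_one) simp_all
  ultimately have "ln (1 / r) \<le> ln (1 / \<rho>\<^sup>2)" by linarith
  also have "\<dots> = 2 * L \<rho>" using rho by (simp add: L_def ln_div ln_realpow)
  finally have LL: "L r \<le> 2 * L \<rho>" by (simp add: L_def)
  have "(2 * L \<rho>) powr (-\<alpha>) / r^3 \<le> L r powr (-\<alpha>) / r^3"
    using LL Lr alpha r0 by (intro divide_right_mono powr_mono2') auto
  also have "\<dots> \<le> ddB r" using r0 by (intro ddB_ge) auto
  also have "ddB r = w r" using r0 by (simp add: w_def)
  finally have wge: "(2 * L \<rho>) powr (-\<alpha>) / r^3 \<le> w r" .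
  moreover have p: "(2 * L \<rho>) powr (-\<alpha>) / r^3 > 0" using r0 rho1 by simp
  ultimately show "w r > 0" by linarith
  have "(log_weight \<rho> r)\<^sup>2 / w r \<le> (log_weight \<rho> r)\<^sup>2 / ((2 * L \<rho>) powr (-\<alpha>) / r^3)"
    by (rule divide_left_mono[OF wge _ mult_pos_pos[OF \<open>w r > 0\<close> p]]) simp
  also have "\<dots> = 2 powr \<alpha> * L \<rho> powr (\<alpha> - 1) * log_density \<rho> r"
    using r r0 rho1 by (simp add: log_density_def log_weight_def powr_minus powr_mult powr_diff field_simps power2_eq_square power3_eq_cube)
  finally show "(log_weight \<rho> r)\<^sup>2 / w r \<le> 2 powr \<alpha> * L \<rho> powr (\<alpha> - 1) * log_density \<rho> r" .
qed

text \<open>Cauchy-Schwarz in the window lengths with weight \<open>w r * w r'\<close>. Division by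
  a vanishing \<open>w\<close> does no harm: \<open>w\<close> is positive on the window range, and
  \<open>log_weight\<close> is zero outside it.\<close>

lemma average_le:
  fixes U :: "real \<Rightarrow> real \<Rightarrow> real"
  assumes [measurable]: "(\<lambda>(r, r'). U r r') \<in> borel_measurable (borel \<Otimes>\<^sub>M borel)"
  shows "(\<integral>\<^sup>+r. \<integral>\<^sup>+r'. ennreal (log_weight \<rho> r * (log_weight \<rho> r') * \<bar>U r r'\<bar>) \<partial>lborel \<partial>lborel)\<^sup>2
    \<le> ennreal (smoothing_cost\<^sup>2) * (\<integral>\<^sup>+r. \<integral>\<^sup>+r'. ennreal (w r * w r' * (U r r')\<^sup>2) \<partial>lborel \<partial>lborel)"
proof -
  have [measurable]: "(\<lambda>p. U (fst p) (snd p)) \<in> borel_measurable (borel \<Otimes>\<^sub>M borel)"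
    using assms by (simp add: split_beta')
  define F where "F p = ennreal (sqrt ((log_weight \<rho> (fst p))\<^sup>2 / w (fst p)) * sqrt ((log_weight \<rho> (snd p))\<^sup>2 / w (snd p)))" for p :: "real \<times> real"
  define G where "G p = ennreal (sqrt (w (fst p)) * sqrt (w (snd p)) * \<bar>U (fst p) (snd p)\<bar>)" for p :: "real \<times> real"
  have Fm[measurable]: "F \<in> borel_measurable (borel \<Otimes>\<^sub>M borel)" unfolding F_def by measurable
  have Gm[measurable]: "G \<in> borel_measurable (borel \<Otimes>\<^sub>M borel)" unfolding G_def by measurable
  have sq: "sqrt ((log_weight \<rho> r)\<^sup>2 / w r) * sqrt (w r) = log_weight \<rho> r" for r
  proof (cases "r \<in> {\<rho>\<^sup>2..\<rho>}")
    case True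
    then show ?thesis using om_w_pointwise(1)[OF True] om_div_nonneg[of r] by (simp add: real_sqrt_divide)
  qed (auto simp: log_density_def log_weight_def)
  have FG: "F (r, r') * G (r, r') = ennreal (log_weight \<rho> r * (log_weight \<rho> r') * \<bar>U r r'\<bar>)" for r r'
  proof -
    have "F (r, r') * G (r, r') = ennreal ((sqrt ((log_weight \<rho> r)\<^sup>2 / w r) * sqrt (w r)) * (sqrt ((log_weight \<rho> r')\<^sup>2 / w r') * sqrt (w r')) * \<bar>U r r'\<bar>)"
      unfolding F_def G_def fst_conv snd_conv using w_nonneg
      by (subst ennreal_mult[symmetric]) (auto intro!: arg_cong[where f = ennreal] simp: mult_ac)
    then show ?thesis unfolding sq .
  qed
  have G2: "G (r, r') ^ 2 = ennreal (w r * w r' * (U r r')\<^sup>2)" for r r'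
    using w_nonneg by (simp add: G_def ennreal_power power_mult_distrib)
  have om2: "(\<integral>\<^sup>+r. ennreal ((log_weight \<rho> r)\<^sup>2 / w r) \<partial>lborel) \<le> ennreal smoothing_cost"
  proof -
    have "(\<integral>\<^sup>+r. ennreal ((log_weight \<rho> r)\<^sup>2 / w r) \<partial>lborel) \<le> (\<integral>\<^sup>+r. ennreal smoothing_cost * ennreal (log_density \<rho> r) \<partial>lborel)"
    proof (intro nn_integral_mono)
      fix r
      show "ennreal ((log_weight \<rho> r)\<^sup>2 / w r) \<le> ennreal smoothing_cost * ennreal (log_density \<rho> r)"
      proof (cases "r \<in> {\<rho>\<^sup>2..\<rho>}")
        case True
        then show ?thesis using om_w_pointwise(2)[OF True] log_density_nonneg[of r]
          by (simp add: smoothing_cost_def ennreal_leI flip: ennreal_mult)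
      qed (auto simp: log_density_def log_weight_def)
    qed
    also have "\<dots> = ennreal smoothing_cost" by (simp add: nn_integral_cmult om_nn_integral)
    finally show ?thesis .
  qed
  have F2: "F (r, r') ^ 2 = ennreal ((log_weight \<rho> r)\<^sup>2 / w r) * ennreal ((log_weight \<rho> r')\<^sup>2 / w r')" for r r'
    using w_nonneg by (simp add: F_def ennreal_power power_mult_distrib flip: ennreal_mult)
  have it: "(\<integral>\<^sup>+p. H p \<partial>(lborel \<Otimes>\<^sub>M lborel)) = (\<integral>\<^sup>+r. \<integral>\<^sup>+r'. H (r, r') \<partial>lborel \<partial>lborel)"
    if [measurable]: "H \<in> borel_measurable (borel \<Otimes>\<^sub>M borel)" for H :: "real \<times> real \<Rightarrow> ennreal"
    by (rule lborel.nn_integral_fst[symmetric]) simp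
  have "(\<integral>\<^sup>+p. F p * G p \<partial>(lborel \<Otimes>\<^sub>M lborel))\<^sup>2 \<le> (\<integral>\<^sup>+p. F p ^ 2 \<partial>(lborel \<Otimes>\<^sub>M lborel)) * (\<integral>\<^sup>+p. G p ^ 2 \<partial>(lborel \<Otimes>\<^sub>M lborel))"
    by (rule Cauchy_Schwarz_nn_integral) auto
  moreover have "(\<integral>\<^sup>+p. F p ^ 2 \<partial>(lborel \<Otimes>\<^sub>M lborel)) \<le> ennreal (smoothing_cost\<^sup>2)"
  proof -
    have "(\<integral>\<^sup>+p. F p ^ 2 \<partial>(lborel \<Otimes>\<^sub>M lborel))
      = (\<integral>\<^sup>+r. ennreal ((log_weight \<rho> r)\<^sup>2 / w r) \<partial>lborel) * (\<integral>\<^sup>+r. ennreal ((log_weight \<rho> r)\<^sup>2 / w r) \<partial>lborel)"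
      by (subst it) (auto simp: F2 nn_integral_cmult nn_integral_multc)
    also have "\<dots> \<le> ennreal smoothing_cost * ennreal smoothing_cost" using om2 by (intro mult_mono) auto
    also have "\<dots> = ennreal (smoothing_cost\<^sup>2)" by (simp add: smoothing_cost_def power2_eq_square flip: ennreal_mult)
    finally show ?thesis .
  qed
  ultimately have "(\<integral>\<^sup>+p. F p * G p \<partial>(lborel \<Otimes>\<^sub>M lborel))\<^sup>2 \<le> ennreal (smoothing_cost\<^sup>2) * (\<integral>\<^sup>+p. G p ^ 2 \<partial>(lborel \<Otimes>\<^sub>M lborel))"
    by (meson dual_order.trans mult_right_mono zero_le)
  then show ?thesis by (simp add: it FG G2)
qed

end

end

section \<open>Dual norm of Lipschitz kernels\<close>

locale log_kernel_completion = logarithmic_kernel +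
  fixes a b :: real and J :: "(real \<Rightarrow> real) \<Rightarrow> 'h::{real_inner, complete_space}"
  assumes ab: "a < b" and G: "is_G B a b J"
begin

lemma J_add: "f \<in> L2 a b \<Longrightarrow> g \<in> L2 a b \<Longrightarrow> J (\<lambda>x. f x + g x) = J f + J g"
  using G by (simp add: is_G_def)

lemma J_scale: "f \<in> L2 a b \<Longrightarrow> J (\<lambda>x. c * f x) = c *\<^sub>R J f"
  using G by (simp add: is_G_def)

lemma J_inner: "f \<in> L2 a b \<Longrightarrow> g \<in> L2 a b \<Longrightarrow> J f \<bullet> J g = B_form B f g"
  using G by (simp add: is_G_def)

lemma J_zero: "J (\<lambda>x. 0) = 0"
  using J_scale[OF L2_zero, of 0] by simp

lemma J_sum:
  "finite I \<Longrightarrow> (\<And>i. i \<in> I \<Longrightarrow> f i \<in> L2 a b) \<Longrightarrow> J (\<lambda>x. \<Sum>i\<in>I. c i * f i x) = (\<Sum>i\<in>I. c i *\<^sub>R J (f i))"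
proof (induction I rule: finite_induct)
  case empty then show ?case by (simp add: J_zero)
next
  case (insert i I)
  have "J (\<lambda>x. c i * f i x + (\<Sum>i\<in>I. c i * f i x)) = J (\<lambda>x. c i * f i x) + J (\<lambda>x. \<Sum>i\<in>I. c i * f i x)"
    using insert by (intro J_add L2_scale L2_sum) auto
  then show ?case using insert J_scale[of "f i" "c i"] by simp
qed

lemma Lam_bound:
  "f \<in> L2 a b \<Longrightarrow> (\<integral>\<^sup>+r. \<integral>\<^sup>+x. ennreal (w r * (Lam f x r)\<^sup>2) \<partial>lborel \<partial>lborel) \<le> ennreal ((norm (J f))\<^sup>2)"
  using form_lower_bound[of f a b] ab by (simp add: J_inner power2_norm_eq_inner)

section \<open>Gram expression and energy of a tensor\<close>

context
  fixes n :: nat and f g :: "nat \<Rightarrow> real \<Rightarrow> real"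
  assumes f: "\<And>i. i < n \<Longrightarrow> f i \<in> L2 a b" and g: "\<And>i. i < n \<Longrightarrow> g i \<in> L2 a b"
begin

text \<open>The squared norm, in the Hilbert tensor square of the completion, of the sum of the
  tensors of \<open>J (f i)\<close> and \<open>J (g i)\<close>.\<close>

definition gram :: real where
  "gram = (\<Sum>i<n. \<Sum>j<n. (J (f i) \<bullet> J (f j)) * (J (g i) \<bullet> J (g j)))"

lemma gram_nonneg: "0 \<le> gram"
  unfolding gram_def by (rule gram_product_nonneg) simp

definition tens :: "real \<times> real \<Rightarrow> real" where
  "tens z = (\<Sum>i<n. f i (fst z) * g i (snd z))"

text \<open>The integral of the tensor over the rectangle with corner \<open>(x, y)\<close> and
  sides \<open>r\<close>, \<open>r'\<close>.\<close>

definition U :: "real \<Rightarrow> real \<Rightarrow> real \<Rightarrow> real \<Rightarrow> real" where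
  "U x y r r' = (\<Sum>i<n. Lam (f i) x r * Lam (g i) y r')"

text \<open>A density in the corner of the rectangle. Keeping it local is what later allows the
  energy to be shared among the annuli.\<close>

definition energy :: "real \<times> real \<Rightarrow> ennreal" where
  "energy z = (\<integral>\<^sup>+r. \<integral>\<^sup>+r'. ennreal (w r * w r' * (U (fst z) (snd z) r r')\<^sup>2) \<partial>lborel \<partial>lborel)"

lemma fm: "i < n \<Longrightarrow> f i \<in> borel_measurable borel" and gm: "i < n \<Longrightarrow> g i \<in> borel_measurable borel"
  using f g L2_measurable by blast+

lemma U_measurable [measurable]:
  assumes [measurable]: "p \<in> borel_measurable M" "q \<in> borel_measurable M" "r \<in> borel_measurable M" "r' \<in> borel_measurable M"
  shows "(\<lambda>z. U (p z) (q z) (r z) (r' z)) \<in> borel_measurable M"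
  unfolding U_def by (intro borel_measurable_sum borel_measurable_times Lam_measurable fm gm assms) auto

lemma energy_measurable [measurable]: "energy \<in> borel_measurable borel"
proof -
  have "energy \<in> borel_measurable (borel \<Otimes>\<^sub>M borel)" unfolding energy_def by measurable
  then show ?thesis by (simp add: borel_prod)
qed

text \<open>The one-dimensional bound is applied twice. With \<open>x\<close> and \<open>r\<close>
  frozen it is applied in the second variable; factoring the Gram matrix of the
  \<open>J (g i)\<close> turns the result into a sum of squares of window integrals of the
  combinations \<open>F k\<close>, to which it applies in the first variable. The weights recombine
  to the Gram expression.\<close>

lemma energy_total: "(\<integral>\<^sup>+z. energy z \<partial>lborel) \<le> ennreal gram"
proof -
  obtain c :: "nat \<Rightarrow> nat \<Rightarrow> real" where c: "\<forall>i\<in>{..<n}. \<forall>j\<in>{..<n}. J (g i) \<bullet> J (g j) = (\<Sum>k<n. c k i * c k j)"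
    using gram_factorization[of "{..<n}" "\<lambda>i. J (g i)"] by auto
  define F where "F k = (\<lambda>x. \<Sum>i<n. c k i * f i x)" for k
  have F: "F k \<in> L2 a b" for k unfolding F_def using f by (intro L2_sum) auto
  have [measurable]: "F k \<in> borel_measurable borel" for k using F by (rule L2_measurable)
  have JF: "J (F k) = (\<Sum>i<n. c k i *\<^sub>R J (f i))" for k unfolding F_def using f by (intro J_sum) auto
  have LF: "Lam (F k) x r = (\<Sum>i<n. c k i * Lam (f i) x r)" for k x r
    unfolding F_def by (rule Lam_sum) (use f in auto)
  have inner: "(\<integral>\<^sup>+r'. \<integral>\<^sup>+y. ennreal (w r' * (U x y r r')\<^sup>2) \<partial>lborel \<partial>lborel)
      \<le> ennreal (\<Sum>k<n. (Lam (F k) x r)\<^sup>2)" for x r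
  proof -
    define h where "h = (\<lambda>y. \<Sum>i<n. Lam (f i) x r * g i y)"
    have h: "h \<in> L2 a b" unfolding h_def using g by (intro L2_sum) auto
    have Lh: "Lam h y r' = U x y r r'" for y r' unfolding h_def U_def by (rule Lam_sum) (use g in auto)
    have Jh: "J h = (\<Sum>i<n. Lam (f i) x r *\<^sub>R J (g i))" unfolding h_def using g by (intro J_sum) auto
    have "(norm (J h))\<^sup>2 = (\<Sum>i<n. \<Sum>j<n. Lam (f i) x r * Lam (f j) x r * (J (g i) \<bullet> J (g j)))"
      unfolding power2_norm_eq_inner Jh by (simp add: inner_sum_left inner_sum_right mult_ac sum_distrib_left inner_commute)
    also have "\<dots> = (\<Sum>i<n. \<Sum>j<n. \<Sum>k<n. (c k i * Lam (f i) x r) * (c k j * Lam (f j) x r))"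
      using c by (intro sum.cong refl) (simp add: sum_distrib_left mult_ac)
    also have "\<dots> = (\<Sum>i<n. \<Sum>k<n. \<Sum>j<n. (c k i * Lam (f i) x r) * (c k j * Lam (f j) x r))"
      by (intro sum.cong refl sum.swap)
    also have "\<dots> = (\<Sum>k<n. \<Sum>i<n. \<Sum>j<n. (c k i * Lam (f i) x r) * (c k j * Lam (f j) x r))"
      by (rule sum.swap)
    also have "\<dots> = (\<Sum>k<n. (Lam (F k) x r)\<^sup>2)"
      unfolding LF power2_eq_square sum_product ..
    finally have "(norm (J h))\<^sup>2 = (\<Sum>k<n. (Lam (F k) x r)\<^sup>2)" .
    then show ?thesis using Lam_bound[OF h] unfolding Lh by simp
  qed
  have "(\<integral>\<^sup>+z. energy z \<partial>lborel) = (\<integral>\<^sup>+x. \<integral>\<^sup>+y. energy (x, y) \<partial>lborel \<partial>lborel)"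
    unfolding lborel_prod[symmetric] by (rule lborel.nn_integral_fst[symmetric]) (simp add: lborel_prod)
  also have "\<dots> = (\<integral>\<^sup>+x. \<integral>\<^sup>+r. \<integral>\<^sup>+y. \<integral>\<^sup>+r'. ennreal (w r * w r' * (U x y r r')\<^sup>2) \<partial>lborel \<partial>lborel \<partial>lborel \<partial>lborel)"
    unfolding energy_def fst_conv snd_conv by (intro nn_integral_cong lborel_pair.Fubini') measurable
  also have "\<dots> = (\<integral>\<^sup>+r. \<integral>\<^sup>+x. \<integral>\<^sup>+y. \<integral>\<^sup>+r'. ennreal (w r * w r' * (U x y r r')\<^sup>2) \<partial>lborel \<partial>lborel \<partial>lborel \<partial>lborel)"
    by (rule lborel_pair.Fubini') measurable
  also have "\<dots> = (\<integral>\<^sup>+r. \<integral>\<^sup>+x. \<integral>\<^sup>+r'. \<integral>\<^sup>+y. ennreal (w r * w r' * (U x y r r')\<^sup>2) \<partial>lborel \<partial>lborel \<partial>lborel \<partial>lborel)"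
    by (intro nn_integral_cong lborel_pair.Fubini') measurable
  also have "\<dots> = (\<integral>\<^sup>+r. \<integral>\<^sup>+x. ennreal (w r) * (\<integral>\<^sup>+r'. \<integral>\<^sup>+y. ennreal (w r' * (U x y r r')\<^sup>2) \<partial>lborel \<partial>lborel) \<partial>lborel \<partial>lborel)"
    using w_nonneg by (intro nn_integral_cong)
      (simp add: nn_integral_cmult[symmetric] ennreal_mult[symmetric] mult.assoc mult_nonneg_nonneg)
  also have "\<dots> \<le> (\<integral>\<^sup>+r. \<integral>\<^sup>+x. ennreal (w r) * ennreal (\<Sum>k<n. (Lam (F k) x r)\<^sup>2) \<partial>lborel \<partial>lborel)"
    by (intro nn_integral_mono mult_left_mono inner) simp
  also have "\<dots> = (\<integral>\<^sup>+r. \<integral>\<^sup>+x. (\<Sum>k<n. ennreal (w r * (Lam (F k) x r)\<^sup>2)) \<partial>lborel \<partial>lborel)"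
    using w_nonneg by (intro nn_integral_cong) (simp add: sum_distrib_left sum_nonneg flip: ennreal_mult)
  also have "\<dots> = (\<Sum>k<n. \<integral>\<^sup>+r. \<integral>\<^sup>+x. ennreal (w r * (Lam (F k) x r)\<^sup>2) \<partial>lborel \<partial>lborel)"
    by (simp add: nn_integral_sum)
  also have "\<dots> \<le> (\<Sum>k<n. ennreal ((norm (J (F k)))\<^sup>2))"
    by (intro sum_mono Lam_bound F)
  also have "\<dots> = ennreal (\<Sum>k<n. (norm (J (F k)))\<^sup>2)" by simp
  also have "(\<Sum>k<n. (norm (J (F k)))\<^sup>2) = gram"
  proof -
    have "(\<Sum>k<n. (norm (J (F k)))\<^sup>2) = (\<Sum>k<n. \<Sum>i<n. \<Sum>j<n. (c k i * c k j) * (J (f i) \<bullet> J (f j)))"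
      unfolding power2_norm_eq_inner JF by (simp add: inner_sum_left inner_sum_right mult_ac sum_distrib_left inner_commute)
    also have "\<dots> = (\<Sum>i<n. \<Sum>k<n. \<Sum>j<n. (c k i * c k j) * (J (f i) \<bullet> J (f j)))" by (rule sum.swap)
    also have "\<dots> = (\<Sum>i<n. \<Sum>j<n. \<Sum>k<n. (c k i * c k j) * (J (f i) \<bullet> J (f j)))"
      by (intro sum.cong refl sum.swap)
    also have "\<dots> = gram" unfolding gram_def
      using c by (intro sum.cong refl) (simp add: sum_distrib_left mult_ac)
    finally show ?thesis .
  qed
  finally show ?thesis .
qed

lemma tens_integrable: "integrable lborel tens"
proof -
  have "integrable lborel (\<lambda>z. f i (fst z) * g i (snd z))" if "i < n" for i
    using integral_pair_product(1)[OF L2_integrable[OF f[OF that]] L2_integrable[OF g[OF that]]]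
    by (simp add: lborel_prod split_beta')
  then show ?thesis unfolding tens_def by (intro Bochner_Integration.integrable_sum) auto
qed

context
  fixes \<rho> :: real assumes rho: "0 < \<rho>" "\<rho> < e0"
begin

text \<open>By \<open>phi_Lam\<close> in each variable, the smoothed tensor is a weighted mean of
  the rectangle integrals \<open>U\<close>, and \<open>average_le\<close> applies.\<close>

lemma averaged_tens:
  "(ennreal \<bar>\<integral>h. psi \<rho> h * tens (p + h) \<partial>lborel\<bar>)\<^sup>2 \<le> ennreal ((smoothing_cost \<rho>)\<^sup>2) * energy p"
proof -
  obtain x y where p: "p = (x, y)" by force
  have fi: "integrable lborel (f i)" "integrable lborel (g i)" if "i < n" for i
    using L2_integrable f g that by blast+
  have 1: "(\<integral>h. psi \<rho> h * tens (p + h) \<partial>lborel) = (\<Sum>i<n. (\<integral>r. log_weight \<rho> r * Lam (f i) x r \<partial>lborel) * (\<integral>r. log_weight \<rho> r * Lam (g i) y r \<partial>lborel))"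
  proof -
    have "(\<integral>h. psi \<rho> h * tens (p + h) \<partial>lborel)
        = (\<integral>h. (\<Sum>i<n. (phi \<rho> (fst h) * f i (x + fst h)) * (phi \<rho> (snd h) * g i (y + snd h))) \<partial>lborel)"
      by (intro Bochner_Integration.integral_cong refl) (simp add: psi_def[OF rho] tens_def p sum_distrib_left mult_ac)
    also have "\<dots> = (\<Sum>i<n. \<integral>h. (phi \<rho> (fst h) * f i (x + fst h)) * (phi \<rho> (snd h) * g i (y + snd h)) \<partial>lborel)"
    proof (rule Bochner_Integration.integral_sum)
      fix i assume "i \<in> {..<n}"
      then have i: "i < n" by simp
      show "integrable lborel (\<lambda>h. (phi \<rho> (fst h) * f i (x + fst h)) * (phi \<rho> (snd h) * g i (y + snd h)))"
        using integral_pair_product(1)[OF phi_Lam(1)[OF rho fi(1)[OF i]] phi_Lam(1)[OF rho fi(2)[OF i]]]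
        by (simp add: lborel_prod split_beta')
    qed
    also have "\<dots> = (\<Sum>i<n. (\<integral>r. log_weight \<rho> r * Lam (f i) x r \<partial>lborel) * (\<integral>r. log_weight \<rho> r * Lam (g i) y r \<partial>lborel))"
    proof (intro sum.cong refl)
      fix i assume "i \<in> {..<n}"
      then have i: "i < n" by simp
      show "(\<integral>h. (phi \<rho> (fst h) * f i (x + fst h)) * (phi \<rho> (snd h) * g i (y + snd h)) \<partial>lborel)
        = (\<integral>r. log_weight \<rho> r * Lam (f i) x r \<partial>lborel) * (\<integral>r. log_weight \<rho> r * Lam (g i) y r \<partial>lborel)"
        using integral_pair_product(2)[OF phi_Lam(1)[OF rho fi(1)[OF i]] phi_Lam(1)[OF rho fi(2)[OF i]]]
        by (simp add: lborel_prod split_beta' phi_Lam(2)[OF rho fi(1)[OF i]] phi_Lam(2)[OF rho fi(2)[OF i]])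
    qed
    finally show ?thesis .
  qed
  have ii: "integrable (lborel \<Otimes>\<^sub>M lborel) (\<lambda>(r, r'). (log_weight \<rho> r * Lam (f i) x r) * (log_weight \<rho> r' * Lam (g i) y r'))"
    if i: "i < n" for i
    using integral_pair_product(1)[OF phi_Lam(3)[OF rho fi(1)[OF i]] phi_Lam(3)[OF rho fi(2)[OF i]]] .
  have eqU: "(\<lambda>(r, r'). log_weight \<rho> r * log_weight \<rho> r' * U x y r r')
      = (\<lambda>q. \<Sum>i<n. case q of (r, r') \<Rightarrow> (log_weight \<rho> r * Lam (f i) x r) * (log_weight \<rho> r' * Lam (g i) y r'))"
    by (auto simp: fun_eq_iff U_def sum_distrib_left mult_ac)
  have 2: "(\<integral>h. psi \<rho> h * tens (p + h) \<partial>lborel) = (\<integral>(r, r'). log_weight \<rho> r * log_weight \<rho> r' * U x y r r' \<partial>(lborel \<Otimes>\<^sub>M lborel))"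
    unfolding 1 eqU
    by (subst Bochner_Integration.integral_sum)
      (use ii integral_pair_product(2)[OF phi_Lam(3)[OF rho fi(1)] phi_Lam(3)[OF rho fi(2)]] in auto)
  have 3: "integrable (lborel \<Otimes>\<^sub>M lborel) (\<lambda>(r, r'). log_weight \<rho> r * log_weight \<rho> r' * U x y r r')"
    unfolding eqU using ii by (intro Bochner_Integration.integrable_sum) auto
  have Um: "(\<lambda>(r, r'). U x y r r') \<in> borel_measurable (borel \<Otimes>\<^sub>M borel)" unfolding split_beta' by measurable
  have "ennreal \<bar>\<integral>h. psi \<rho> h * tens (p + h) \<partial>lborel\<bar>
      \<le> (\<integral>\<^sup>+q. ennreal (norm (case q of (r, r') \<Rightarrow> log_weight \<rho> r * log_weight \<rho> r' * U x y r r')) \<partial>(lborel \<Otimes>\<^sub>M lborel))"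
    unfolding 2 using integral_norm_bound_ennreal[OF 3] by simp
  also have "\<dots> = (\<integral>\<^sup>+r. \<integral>\<^sup>+r'. ennreal (norm (log_weight \<rho> r * log_weight \<rho> r' * U x y r r')) \<partial>lborel \<partial>lborel)"
    using Um by (subst lborel.nn_integral_fst[symmetric]) (auto simp: split_beta')
  also have "\<dots> = (\<integral>\<^sup>+r. \<integral>\<^sup>+r'. ennreal (log_weight \<rho> r * log_weight \<rho> r' * \<bar>U x y r r'\<bar>) \<partial>lborel \<partial>lborel)"
    using om_div_nonneg[OF rho] by (simp add: abs_mult)
  finally have "ennreal \<bar>\<integral>h. psi \<rho> h * tens (p + h) \<partial>lborel\<bar>
      \<le> (\<integral>\<^sup>+r. \<integral>\<^sup>+r'. ennreal (log_weight \<rho> r * log_weight \<rho> r' * \<bar>U x y r r'\<bar>) \<partial>lborel \<partial>lborel)" .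
  then have "(ennreal \<bar>\<integral>h. psi \<rho> h * tens (p + h) \<partial>lborel\<bar>)\<^sup>2
      \<le> (\<integral>\<^sup>+r. \<integral>\<^sup>+r'. ennreal (log_weight \<rho> r * log_weight \<rho> r' * \<bar>U x y r r'\<bar>) \<partial>lborel \<partial>lborel)\<^sup>2"
    by (rule power_mono) simp
  also have "\<dots> \<le> ennreal ((smoothing_cost \<rho>)\<^sup>2) * energy p"
    using average_le[OF rho Um] by (simp add: energy_def p)
  finally show ?thesis .
qed

text \<open>The convolution is moved from \<open>e\<close> to the tensor. Cauchy-Schwarz over
  \<open>S\<close> then pairs the smoothed tensor, controlled by the energy inside \<open>S\<close>,
  with \<open>e\<close>, whose square norm is at most \<open>M * sqrt A\<close>.\<close>

lemma smoothing_term_le: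
  fixes e :: "real \<times> real \<Rightarrow> real"
  assumes em[measurable]: "e \<in> borel_measurable borel" and eM: "\<And>z. \<bar>e z\<bar> \<le> M"
    and S[measurable]: "S \<in> sets borel" and eS: "\<And>z. z \<notin> S \<Longrightarrow> e z = 0"
    and area: "emeasure lborel S \<le> ennreal A" and A: "A \<ge> 0"
    and R: "(\<integral>\<^sup>+z. indicator S z * energy z \<partial>lborel) \<le> ennreal (R\<^sup>2)" and R0: "R \<ge> 0"
  shows "\<bar>\<integral>z. tens z * Phi \<rho> e z \<partial>lborel\<bar> \<le> M * sqrt A * smoothing_cost \<rho> * R"
proof -
  have [measurable]: "psi \<rho> \<in> borel_measurable borel" by (rule psi_measurable[OF rho])
  have M0: "M \<ge> 0" using eM[of 0] by (rule order_trans[OF abs_ge_zero])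
  have ufm[measurable]: "tens \<in> borel_measurable borel" using tens_integrable by auto
  define V where "V p = (\<integral>h. psi \<rho> h * tens (p + h) \<partial>lborel)" for p
  have bound: "\<bar>c * d * e z\<bar> \<le> M * \<bar>c * d\<bar>" for c d z
    using mult_left_mono[OF eM[of z], of "\<bar>c * d\<bar>"] by (simp add: abs_mult mult_ac)
  have int1: "integrable (lborel \<Otimes>\<^sub>M lborel) (\<lambda>(z, h). tens z * psi \<rho> h * e (z - h))"
  proof (rule Bochner_Integration.integrable_bound)
    show "integrable (lborel \<Otimes>\<^sub>M lborel) (\<lambda>q. M * (case q of (z, h) \<Rightarrow> tens z * psi \<rho> h))"
      using integral_pair_product(1)[OF tens_integrable psi_integral(1)[OF rho]] by (rule integrable_mult_right)
    show "AE q in lborel \<Otimes>\<^sub>M lborel. norm (case q of (z, h) \<Rightarrow> tens z * psi \<rho> h * e (z - h))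
        \<le> norm (M * (case q of (z, h) \<Rightarrow> tens z * psi \<rho> h))"
      using bound M0 by (auto simp: abs_mult split: prod.split)
  qed measurable
  \<comment> \<open>The translated integrand is a new function of the pair, so its absolute
    convergence is verified separately before the integrals are exchanged again.\<close>
  have int2: "integrable (lborel \<Otimes>\<^sub>M lborel) (\<lambda>(h, p). tens (p + h) * psi \<rho> h * e p)"
  proof (rule lborel_pair.Fubini_integrable)
    have t: "integrable lborel (\<lambda>p. tens (p + h))" for h
      using lborel_integrable_translate[OF tens_integrable, of h] by (simp add: add.commute)
    have i: "integrable lborel (\<lambda>p. tens (p + h) * psi \<rho> h * e p)" for h
    proof (rule Bochner_Integration.integrable_bound)
      show "integrable lborel (\<lambda>p. M * (tens (p + h) * psi \<rho> h))" using t by simp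
      show "AE p in lborel. norm (tens (p + h) * psi \<rho> h * e p) \<le> norm (M * (tens (p + h) * psi \<rho> h))"
        using bound M0 by (auto simp: abs_mult)
    qed measurable
    then show "AE h in lborel. integrable lborel (\<lambda>p. case (h, p) of (h, p) \<Rightarrow> tens (p + h) * psi \<rho> h * e p)" by simp
    have mm: "(\<lambda>(h, p). tens (p + h) * psi \<rho> h * e p) \<in> borel_measurable (lborel \<Otimes>\<^sub>M lborel)" by measurable
    then show "(\<lambda>(h, p). tens (p + h) * psi \<rho> h * e p) \<in> borel_measurable (lborel \<Otimes>\<^sub>M lborel)" .
    show "integrable lborel (\<lambda>h. \<integral>p. norm (case (h, p) of (h, p) \<Rightarrow> tens (p + h) * psi \<rho> h * e p) \<partial>lborel)"
    proof (rule Bochner_Integration.integrable_bound)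
      show "integrable lborel (\<lambda>h. M * (\<integral>z. \<bar>tens z\<bar> \<partial>lborel) * psi \<rho> h)" using psi_integral(1)[OF rho] by simp
      show "(\<lambda>h. \<integral>p. norm (case (h, p) of (h, p) \<Rightarrow> tens (p + h) * psi \<rho> h * e p) \<partial>lborel) \<in> borel_measurable lborel"
        by measurable
      have "(\<integral>p. norm (tens (p + h) * psi \<rho> h * e p) \<partial>lborel) \<le> M * (\<integral>z. \<bar>tens z\<bar> \<partial>lborel) * psi \<rho> h" for h
      proof -
        have "(\<integral>p. norm (tens (p + h) * psi \<rho> h * e p) \<partial>lborel) \<le> (\<integral>p. M * psi \<rho> h * \<bar>tens (h + p)\<bar> \<partial>lborel)"
        proof (rule integral_mono)
          show "integrable lborel (\<lambda>p. M * psi \<rho> h * \<bar>tens (h + p)\<bar>)" using t[of h] by (simp add: add.commute)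
          show "norm (tens (p + h) * psi \<rho> h * e p) \<le> M * psi \<rho> h * \<bar>tens (h + p)\<bar>" for p
            using bound[of "tens (p + h)" "psi \<rho> h" p] psi_nonneg[OF rho, of h] by (simp add: abs_mult add.commute mult_ac)
        qed (use i[of h] in auto)
        also have "\<dots> = M * psi \<rho> h * (\<integral>z. \<bar>tens z\<bar> \<partial>lborel)"
          using lborel_integral_translate[of "\<lambda>z. \<bar>tens z\<bar>" h] by simp
        finally show ?thesis by (simp add: mult_ac)
      qed
      then show "AE h in lborel. norm (\<integral>p. norm (case (h, p) of (h, p) \<Rightarrow> tens (p + h) * psi \<rho> h * e p) \<partial>lborel)
          \<le> norm (M * (\<integral>z. \<bar>tens z\<bar> \<partial>lborel) * psi \<rho> h)"
        by (intro AE_I2) (auto intro: order_trans[OF _ abs_ge_self])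
    qed
  qed
  have "(\<integral>z. tens z * Phi \<rho> e z \<partial>lborel) = (\<integral>z. \<integral>h. tens z * psi \<rho> h * e (z - h) \<partial>lborel \<partial>lborel)"
    unfolding Phi_def[OF rho] by (simp add: mult_ac flip: integral_mult_right_zero)
  also have "\<dots> = (\<integral>h. \<integral>z. tens z * psi \<rho> h * e (z - h) \<partial>lborel \<partial>lborel)"
    using lborel_pair.Fubini_integral[OF int1] by simp
  also have "\<dots> = (\<integral>h. \<integral>p. tens (p + h) * psi \<rho> h * e p \<partial>lborel \<partial>lborel)"
  proof (rule Bochner_Integration.integral_cong[OF refl])
    fix h
    show "(\<integral>z. tens z * psi \<rho> h * e (z - h) \<partial>lborel) = (\<integral>p. tens (p + h) * psi \<rho> h * e p \<partial>lborel)"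
      using lborel_integral_translate[of "\<lambda>z. tens z * psi \<rho> h * e (z - h)" h] by (simp add: add.commute)
  qed
  also have "\<dots> = (\<integral>p. \<integral>h. tens (p + h) * psi \<rho> h * e p \<partial>lborel \<partial>lborel)"
    using lborel_pair.Fubini_integral[OF int2] by simp
  also have "\<dots> = (\<integral>p. V p * e p \<partial>lborel)"
    unfolding V_def by (simp add: mult_ac flip: integral_mult_left_zero)
  finally have eq: "(\<integral>z. tens z * Phi \<rho> e z \<partial>lborel) = (\<integral>p. V p * e p \<partial>lborel)" .
  have Vm[measurable]: "V \<in> borel_measurable borel"
  proof -
    have "(\<lambda>p. \<integral>h. psi \<rho> h * tens (p + h) \<partial>lborel) \<in> borel_measurable borel" by measurable
    then show ?thesis unfolding V_def .
  qed
  have Ve: "integrable lborel (\<lambda>p. V p * e p)"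
    using lborel_pair.integrable_snd[OF int2] unfolding V_def by (simp add: mult_ac flip: integral_mult_left_zero)
  have "ennreal \<bar>\<integral>p. V p * e p \<partial>lborel\<bar> \<le> (\<integral>\<^sup>+p. ennreal (norm (V p * e p)) \<partial>lborel)"
    using integral_norm_bound_ennreal[OF Ve] by simp
  \<comment> \<open>The indicator is written twice so that Cauchy-Schwarz yields the area of
    \<open>S\<close> from one factor and the energy inside \<open>S\<close> from the other.\<close>
  also have "\<dots> \<le> (\<integral>\<^sup>+p. ennreal M * (indicator S p * (indicator S p * ennreal \<bar>V p\<bar>)) \<partial>lborel)"
  proof (intro nn_integral_mono)
    fix p
    show "ennreal (norm (V p * e p)) \<le> ennreal M * (indicator S p * (indicator S p * ennreal \<bar>V p\<bar>))"
    proof (cases "p \<in> S")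
      case True
      have "norm (V p * e p) \<le> M * \<bar>V p\<bar>" using mult_left_mono[OF eM[of p], of "\<bar>V p\<bar>"] by (simp add: abs_mult mult_ac)
      then show ?thesis using True M0 by (simp add: ennreal_leI flip: ennreal_mult)
    qed (simp add: eS)
  qed
  also have "\<dots> = ennreal M * (\<integral>\<^sup>+p. indicator S p * (indicator S p * ennreal \<bar>V p\<bar>) \<partial>lborel)"
    by (rule nn_integral_cmult) measurable
  finally have "(ennreal \<bar>\<integral>p. V p * e p \<partial>lborel\<bar>)\<^sup>2
      \<le> (ennreal M * (\<integral>\<^sup>+p. indicator S p * (indicator S p * ennreal \<bar>V p\<bar>) \<partial>lborel))\<^sup>2" by (rule power_mono) simp
  also have "\<dots> = (ennreal M)\<^sup>2 * (\<integral>\<^sup>+p. indicator S p * (indicator S p * ennreal \<bar>V p\<bar>) \<partial>lborel)\<^sup>2"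
    by (rule power_mult_distrib)
  also have "\<dots> \<le> (ennreal M)\<^sup>2 * ((\<integral>\<^sup>+p. (indicator S p)\<^sup>2 \<partial>lborel) * (\<integral>\<^sup>+p. (indicator S p * ennreal \<bar>V p\<bar>)\<^sup>2 \<partial>lborel))"
    by (intro mult_left_mono Cauchy_Schwarz_nn_integral) auto
  also have "\<dots> \<le> (ennreal M)\<^sup>2 * (ennreal A * (ennreal ((smoothing_cost \<rho>)\<^sup>2) * ennreal (R\<^sup>2)))"
  proof (intro mult_left_mono mult_mono)
    have "(indicator S p :: ennreal)\<^sup>2 = indicator S p" for p by (auto simp: indicator_def)
    then show "(\<integral>\<^sup>+p. (indicator S p)\<^sup>2 \<partial>lborel) \<le> ennreal A" using area by simp
    have "(\<integral>\<^sup>+p. (indicator S p * ennreal \<bar>V p\<bar>)\<^sup>2 \<partial>lborel) \<le> (\<integral>\<^sup>+p. ennreal ((smoothing_cost \<rho>)\<^sup>2) * (indicator S p * energy p) \<partial>lborel)"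
      using averaged_tens unfolding V_def by (intro nn_integral_mono) (auto simp: indicator_def)
    also have "\<dots> = ennreal ((smoothing_cost \<rho>)\<^sup>2) * (\<integral>\<^sup>+p. indicator S p * energy p \<partial>lborel)"
      by (rule nn_integral_cmult) measurable
    also have "\<dots> \<le> ennreal ((smoothing_cost \<rho>)\<^sup>2) * ennreal (R\<^sup>2)" using R by (rule mult_left_mono) simp
    finally show "(\<integral>\<^sup>+p. (indicator S p * ennreal \<bar>V p\<bar>)\<^sup>2 \<partial>lborel) \<le> ennreal ((smoothing_cost \<rho>)\<^sup>2) * ennreal (R\<^sup>2)" .
  qed auto
  also have "\<dots> = ennreal ((M * sqrt A * smoothing_cost \<rho> * R)\<^sup>2)"
    using M0 A by (simp add: power_mult_distrib ennreal_power mult_ac flip: ennreal_mult)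
  finally have "\<bar>\<integral>p. V p * e p \<partial>lborel\<bar>\<^sup>2 \<le> (M * sqrt A * smoothing_cost \<rho> * R)\<^sup>2"
    by (simp add: ennreal_power)
  moreover have "0 \<le> M * sqrt A * smoothing_cost \<rho> * R" using M0 A R0 by (simp add: smoothing_cost_def[OF rho])
  ultimately show ?thesis unfolding eq by (rule power2_le_imp_le)
qed

end

end

end

text \<open>In the sum metric, Lipschitz functions of one coordinate and Lipschitz functions of
  \<open>l1\<close> keep their constants.\<close>

definition plane_lipschitz :: "real \<Rightarrow> (real \<times> real \<Rightarrow> real) \<Rightarrow> bool" where
  "plane_lipschitz l e \<longleftrightarrow> (\<forall>z z'. \<bar>e z - e z'\<bar> \<le> l * (\<bar>fst z - fst z'\<bar> + \<bar>snd z - snd z'\<bar>))"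

lemma plane_lipschitzD: "plane_lipschitz l e \<Longrightarrow> \<bar>e z - e z'\<bar> \<le> l * (\<bar>fst z - fst z'\<bar> + \<bar>snd z - snd z'\<bar>)"
  unfolding plane_lipschitz_def by blast

lemma plane_lipschitz_nonneg: "plane_lipschitz l e \<Longrightarrow> 0 \<le> l"
  using plane_lipschitzD[of l e "(0, 0)" "(1, 0)"] by simp

lemma plane_lipschitz_measurable [measurable_dest]:
  assumes "plane_lipschitz l e" shows "e \<in> borel_measurable borel"
proof (rule borel_measurable_continuous_onI, rule continuous_onI)
  fix x :: "real \<times> real" and \<epsilon> :: real assume \<epsilon>: "\<epsilon> > 0"
  note l0 = plane_lipschitz_nonneg[OF assms]
  show "\<exists>d>0. \<forall>y\<in>UNIV. dist y x < d \<longrightarrow> dist (e y) (e x) \<le> \<epsilon>"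
  proof (intro exI[of _ "\<epsilon> / (2 * l + 1)"] conjI ballI impI)
    fix y assume d: "dist y x < \<epsilon> / (2 * l + 1)"
    have "\<bar>fst y - fst x\<bar> \<le> dist y x" "\<bar>snd y - snd x\<bar> \<le> dist y x"
      using dist_fst_le[of y x] dist_snd_le[of y x] by (simp_all add: dist_real_def)
    then have "\<bar>e y - e x\<bar> \<le> l * (dist y x + dist y x)"
      by (intro order_trans[OF plane_lipschitzD[OF assms]] mult_left_mono l0) auto
    also have "\<dots> \<le> (2 * l + 1) * dist y x" by (simp add: algebra_simps)
    also have "\<dots> \<le> \<epsilon>" using d l0 by (simp add: field_simps)
    finally show "dist (e y) (e x) \<le> \<epsilon>" by (simp add: dist_real_def)
  qed (use \<epsilon> l0 in auto)
qed

section \<open>Iterated smoothing of Lipschitz kernels\<close>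

context log_kernel_completion
begin

context
  fixes \<rho> :: real assumes rho: "0 < \<rho>" "\<rho> < e0"
begin

lemma Phi_integrable:
  assumes [measurable]: "e \<in> borel_measurable borel" and "\<And>z. \<bar>e z\<bar> \<le> M"
  shows "integrable lborel (\<lambda>h. e (z - h) * psi \<rho> h)"
proof (rule Bochner_Integration.integrable_bound)
  have [measurable]: "psi \<rho> \<in> borel_measurable borel" by (rule psi_measurable[OF rho])
  show "integrable lborel (\<lambda>h. M * psi \<rho> h)" using psi_integral(1)[OF rho] by simp
  show "(\<lambda>h. e (z - h) * psi \<rho> h) \<in> borel_measurable lborel" by measurable
  show "AE h in lborel. norm (e (z - h) * psi \<rho> h) \<le> norm (M * psi \<rho> h)"
    using assms(2) by (auto simp: abs_mult intro!: mult_right_mono order_trans[OF assms(2) abs_ge_self])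
qed

lemma Phi_lipschitz:
  assumes lip: "plane_lipschitz l e" and M: "\<And>z. \<bar>e z\<bar> \<le> M"
  shows "plane_lipschitz l (Phi \<rho> e)"
  unfolding plane_lipschitz_def
proof (intro allI)
  fix z z' :: "real \<times> real"
  note I = Phi_integrable[OF plane_lipschitz_measurable[OF lip] M]
  let ?d = "l * (\<bar>fst z - fst z'\<bar> + \<bar>snd z - snd z'\<bar>)"
  have "Phi \<rho> e z - Phi \<rho> e z' = (\<integral>h. e (z - h) * psi \<rho> h - e (z' - h) * psi \<rho> h \<partial>lborel)"
    unfolding Phi_def[OF rho] by (rule Bochner_Integration.integral_diff[symmetric, OF I I])
  also have "\<bar>\<dots>\<bar> \<le> (\<integral>h. \<bar>e (z - h) * psi \<rho> h - e (z' - h) * psi \<rho> h\<bar> \<partial>lborel)"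
    by (rule integral_abs_bound)
  also have "\<dots> \<le> (\<integral>h. ?d * psi \<rho> h \<partial>lborel)"
  proof (rule integral_mono)
    show "integrable lborel (\<lambda>h. \<bar>e (z - h) * psi \<rho> h - e (z' - h) * psi \<rho> h\<bar>)"
      by (intro integrable_abs Bochner_Integration.integrable_diff I)
    show "integrable lborel (\<lambda>h. ?d * psi \<rho> h)" using psi_integral(1)[OF rho] by simp
    fix h
    have "\<bar>e (z - h) - e (z' - h)\<bar> \<le> ?d" using plane_lipschitzD[OF lip, of "z - h" "z' - h"] by simp
    from mult_right_mono[OF this psi_nonneg[OF rho, of h]]
    show "\<bar>e (z - h) * psi \<rho> h - e (z' - h) * psi \<rho> h\<bar> \<le> ?d * psi \<rho> h"
      using psi_nonneg[OF rho, of h] by (simp add: abs_mult left_diff_distrib[symmetric])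
  qed
  also have "\<dots> = ?d" using psi_integral(2)[OF rho] by simp
  finally show "\<bar>Phi \<rho> e z - Phi \<rho> e z'\<bar> \<le> ?d" .
qed

lemma Phi_close:
  assumes lip: "plane_lipschitz l e" and M: "\<And>z. \<bar>e z\<bar> \<le> M"
  shows "\<bar>e z - Phi \<rho> e z\<bar> \<le> 2 * l * \<rho>"
proof -
  note I = Phi_integrable[OF plane_lipschitz_measurable[OF lip] M]
  have i1: "integrable lborel (\<lambda>h. e z * psi \<rho> h)" using psi_integral(1)[OF rho] by simp
  have "e z - Phi \<rho> e z = (\<integral>h. e z * psi \<rho> h \<partial>lborel) - (\<integral>h. e (z - h) * psi \<rho> h \<partial>lborel)"
    using psi_integral(2)[OF rho] by (simp add: Phi_def[OF rho])
  also have "\<dots> = (\<integral>h. e z * psi \<rho> h - e (z - h) * psi \<rho> h \<partial>lborel)"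
    by (rule Bochner_Integration.integral_diff[symmetric, OF i1 I])
  also have "\<bar>\<dots>\<bar> \<le> (\<integral>h. \<bar>e z * psi \<rho> h - e (z - h) * psi \<rho> h\<bar> \<partial>lborel)"
    by (rule integral_abs_bound)
  also have "\<dots> \<le> (\<integral>h. (2 * l * \<rho>) * psi \<rho> h \<partial>lborel)"
  proof (rule integral_mono)
    show "integrable lborel (\<lambda>h. \<bar>e z * psi \<rho> h - e (z - h) * psi \<rho> h\<bar>)"
      by (intro integrable_abs Bochner_Integration.integrable_diff I i1)
    show "integrable lborel (\<lambda>h. (2 * l * \<rho>) * psi \<rho> h)" using psi_integral(1)[OF rho] by simp
    fix h
    show "\<bar>e z * psi \<rho> h - e (z - h) * psi \<rho> h\<bar> \<le> 2 * l * \<rho> * psi \<rho> h"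
    proof (cases "psi \<rho> h = 0")
      case False
      then have h: "\<bar>fst h\<bar> + \<bar>snd h\<bar> \<le> 2 * \<rho>" using psi_support[OF rho, of h] by auto
      have "\<bar>e z - e (z - h)\<bar> \<le> l * (\<bar>fst h\<bar> + \<bar>snd h\<bar>)" using plane_lipschitzD[OF lip, of z "z - h"] by simp
      also have "\<dots> \<le> l * (2 * \<rho>)" using h plane_lipschitz_nonneg[OF lip] by (rule mult_left_mono)
      finally show ?thesis
        using mult_right_mono[of "\<bar>e z - e (z - h)\<bar>" "l * (2 * \<rho>)" "psi \<rho> h"] psi_nonneg[OF rho, of h]
        by (simp add: abs_mult left_diff_distrib[symmetric])
    qed simp
  qed
  also have "\<dots> = 2 * l * \<rho>" using psi_integral(2)[OF rho] by simp
  finally show ?thesis .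
qed

lemma Phi_support:
  assumes "\<And>h. fst h \<in> {0..\<rho>} \<Longrightarrow> snd h \<in> {0..\<rho>} \<Longrightarrow> e (z - h) = 0"
  shows "Phi \<rho> e z = 0"
proof -
  have "e (z - h) * psi \<rho> h = 0" for h using assms[of h] psi_support[OF rho, of h] by auto
  then have "(\<lambda>h. e (z - h) * psi \<rho> h) = (\<lambda>h. 0)" by blast
  then show ?thesis unfolding Phi_def[OF rho] by simp
qed

end

text \<open>A smoothing step at scale \<rho> leaves an error of size twice the Lipschitz constant
  times \<rho>, and may double that constant. Shrinking the scale by 16 therefore gains a factor 8
  per step, while the logarithm of the scale grows only linearly in \<open>j\<close>.\<close>

primrec residual :: "(real \<times> real \<Rightarrow> real) \<Rightarrow> real \<Rightarrow> nat \<Rightarrow> real \<times> real \<Rightarrow> real" where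
  "residual k v 0 = k"
| "residual k v (Suc j) = (\<lambda>z. residual k v j z - Phi (v / 16 ^ j) (residual k v j) z)"

text \<open>The total cost of all steps: \<open>8 ^ j\<close> is the decay of the residuals, and
  \<open>(1 + real j) powr (\<alpha> - 1)\<close> is the growth of the logarithmic cost.\<close>

definition dual_const :: real where "dual_const = 2 powr \<alpha> * (\<Sum>j. (1 + real j) powr (\<alpha> - 1) / 8 ^ j)"

lemma dual_const_summable: "summable (\<lambda>j. (1 + real j) powr (\<alpha> - 1) / 8 ^ j)"
proof (rule summable_comparison_test_bigo)
  show "summable (\<lambda>j. norm (1 / 2 ^ j :: real))"
    using summable_geometric[of "1/2 :: real"] by (simp add: power_one_over[symmetric])
  show "(\<lambda>j. (1 + real j) powr (\<alpha> - 1) / 8 ^ j) \<in> O(\<lambda>j. 1 / 2 ^ j)" using alpha by real_asymp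
qed

lemma dual_const_nonneg: "0 \<le> dual_const"
  unfolding dual_const_def by (intro mult_nonneg_nonneg suminf_nonneg dual_const_summable) auto

text \<open>Since \<open>ln 16 <= 3 <= L v\<close>, each refinement adds at most one further
  \<open>L v\<close>.\<close>

lemma L_pow16:
  assumes v: "0 < v" "v < e0"
  shows "0 < L (v / 16 ^ j)" "L (v / 16 ^ j) \<le> L v * (1 + real j)"
proof -
  have e: "L (v / 16 ^ j) = L v + real j * ln 16"
    using v by (simp add: L_def ln_div ln_realpow)
  have "(16::real) = 2 ^ 4" by simp
  then have "ln (16::real) = 4 * ln 2" by (simp only: ln_realpow)
  then have l16: "ln (16::real) \<le> 3" "0 \<le> ln (16::real)" using ln2_le_25_over_36 by auto
  have Lv: "3 \<le> L v" using L_ge[of v] v alpha by simp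
  have "real j * ln 16 \<le> real j * L v" using l16 Lv by (intro mult_left_mono) auto
  then show "L (v / 16 ^ j) \<le> L v * (1 + real j)" unfolding e by (simp add: algebra_simps)
  show "0 < L (v / 16 ^ j)" unfolding e using Lv l16 by (intro add_pos_nonneg) auto
qed

context
  fixes k :: "real \<times> real \<Rightarrow> real" and A l v :: real and S :: "(real \<times> real) set"
  assumes kA: "\<And>z. \<bar>k z\<bar> \<le> A" and lip: "plane_lipschitz l k" and v: "0 < v" "v < e0"
    and supp: "\<And>z z'. z \<notin> S \<Longrightarrow> \<bar>fst z - fst z'\<bar> \<le> 2 * v \<Longrightarrow> \<bar>snd z - snd z'\<bar> \<le> 2 * v \<Longrightarrow> k z' = 0"
begin

lemma dyadic_scale: "0 < v / 16 ^ j" "v / 16 ^ j < e0"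
proof -
  have "v / 16 ^ j \<le> v" using v by (simp add: field_simps)
  then show "v / 16 ^ j < e0" using v by linarith
qed (use v in simp)

lemma residual_bounds:
  "plane_lipschitz (2 ^ j * l) (residual k v j) \<and> (\<forall>z. \<bar>residual k v j z\<bar> \<le> max A (16 * l * v) / 8 ^ j)
   \<and> (\<forall>z z'. z \<notin> S \<longrightarrow> \<bar>fst z - fst z'\<bar> \<le> 2 * v / 2 ^ j \<longrightarrow> \<bar>snd z - snd z'\<bar> \<le> 2 * v / 2 ^ j \<longrightarrow> residual k v j z' = 0)"
proof (induction j)
  case 0
  have "\<bar>k z\<bar> \<le> max A (16 * l * v)" for z using kA[of z] by simp
  then show ?case using lip supp by auto
next
  case (Suc j)
  let ?e = "residual k v j" and ?\<rho> = "v / 16 ^ j"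
  have L: "plane_lipschitz (2 ^ j * l) ?e" and M: "\<And>z. \<bar>?e z\<bar> \<le> max A (16 * l * v) / 8 ^ j"
    and Z: "\<And>z z'. z \<notin> S \<Longrightarrow> \<bar>fst z - fst z'\<bar> \<le> 2 * v / 2 ^ j \<Longrightarrow> \<bar>snd z - snd z'\<bar> \<le> 2 * v / 2 ^ j \<Longrightarrow> ?e z' = 0"
    using Suc by blast+
  note sc = dyadic_scale[of j]
  note P = Phi_lipschitz[OF sc L M]
  have "plane_lipschitz (2 ^ Suc j * l) (residual k v (Suc j))"
    unfolding plane_lipschitz_def
  proof (intro allI)
    fix z z' :: "real \<times> real"
    show "\<bar>residual k v (Suc j) z - residual k v (Suc j) z'\<bar> \<le> 2 ^ Suc j * l * (\<bar>fst z - fst z'\<bar> + \<bar>snd z - snd z'\<bar>)"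
      using plane_lipschitzD[OF L, of z z'] plane_lipschitzD[OF P, of z z'] by (simp add: algebra_simps)
  qed
  moreover have "\<bar>residual k v (Suc j) z\<bar> \<le> max A (16 * l * v) / 8 ^ Suc j" for z
  proof -
    have p: "(16::real) ^ j = 2 ^ j * 8 ^ j" by (simp flip: power_mult_distrib)
    have "\<bar>residual k v (Suc j) z\<bar> \<le> 2 * (2 ^ j * l) * (v / 16 ^ j)"
      using Phi_close[OF sc L M, of z] by simp
    also have "\<dots> = 16 * l * v / 8 ^ Suc j" unfolding p by simp
    also have "\<dots> \<le> max A (16 * l * v) / 8 ^ Suc j" by (intro divide_right_mono) auto
    finally show ?thesis .
  qed
  moreover have "residual k v (Suc j) z' = 0"
    if z: "z \<notin> S" "\<bar>fst z - fst z'\<bar> \<le> 2 * v / 2 ^ Suc j" "\<bar>snd z - snd z'\<bar> \<le> 2 * v / 2 ^ Suc j" for z z'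
  proof -
    have half: "2 * v / 2 ^ j = v / 2 ^ j + v / 2 ^ j" "2 * v / 2 ^ Suc j = v / 2 ^ j" by auto
    have vj: "0 \<le> v / 2 ^ j" using v by simp
    have "(2::real) ^ j \<le> 16 ^ j" by (rule power_mono) auto
    then have r: "?\<rho> \<le> v / 2 ^ j" using v by (intro divide_left_mono) auto
    have "?e z' = 0" by (rule Z[OF z(1)]) (use z vj half in linarith)+
    moreover have "Phi ?\<rho> ?e z' = 0"
    proof (rule Phi_support[OF dyadic_scale])
      fix h :: "real \<times> real" assume h: "fst h \<in> {0..?\<rho>}" "snd h \<in> {0..?\<rho>}"
      show "?e (z' - h) = 0"
      proof (rule Z[OF z(1)])
        show "\<bar>fst z - fst (z' - h)\<bar> \<le> 2 * v / 2 ^ j" using z(2) h(1) r half by auto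
        show "\<bar>snd z - snd (z' - h)\<bar> \<le> 2 * v / 2 ^ j" using z(3) h(2) r half by auto
      qed
    qed
    ultimately show ?thesis by simp
  qed
  ultimately show ?case by blast
qed

text \<open>The kernel telescopes into smoothed residuals, each bounded by
  \<open>smoothing_term_le\<close>. The final residual is only paired with the integrable tensor
  through its supremum, which tends to 0; the integral of the tensor does not enter the
  constant.\<close>

theorem lipschitz_dual_bound:
  assumes f: "\<And>i. i < n \<Longrightarrow> f i \<in> L2 a b" and g: "\<And>i. i < n \<Longrightarrow> g i \<in> L2 a b"
    and S: "S \<in> sets borel" and area: "emeasure lborel S \<le> ennreal s" and s: "s \<ge> 0"
    and R: "(\<integral>\<^sup>+z. indicator S z * energy n f g z \<partial>lborel) \<le> ennreal (R\<^sup>2)" and R0: "R \<ge> 0"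
  shows "\<bar>\<integral>z. tens n f g z * k z \<partial>lborel\<bar> \<le> dual_const * max A (16 * l * v) * sqrt s * L v powr (\<alpha> - 1) * R"
proof -
  let ?u = "tens n f g" and ?A = "max A (16 * l * v)"
  note ui = tens_integrable[of n f g, OF f g]
  have A0: "0 \<le> ?A" using kA[of 0] by simp
  note rb = residual_bounds
  have em: "residual k v j \<in> borel_measurable borel" for j using rb[of j] plane_lipschitz_measurable by blast
  have eM: "\<bar>residual k v j z\<bar> \<le> ?A / 8 ^ j" for j z using rb[of j] by blast
  have uint: "integrable lborel (\<lambda>z. ?u z * e z)"
    if [measurable]: "e \<in> borel_measurable borel" and M: "\<And>z. \<bar>e z\<bar> \<le> M" for e M
  proof (rule Bochner_Integration.integrable_bound)
    have [measurable]: "?u \<in> borel_measurable borel" using ui by auto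
    show "integrable lborel (\<lambda>z. M * ?u z)" using ui by simp
    show "(\<lambda>z. ?u z * e z) \<in> borel_measurable lborel" by measurable
    show "AE z in lborel. norm (?u z * e z) \<le> norm (M * ?u z)"
      using M by (auto simp: abs_mult mult.commute[of M] intro!: mult_left_mono order_trans[OF M abs_ge_self])
  qed
  have step: "\<bar>\<integral>z. ?u z * Phi (v / 16 ^ j) (residual k v j) z \<partial>lborel\<bar>
      \<le> ?A * sqrt s * L v powr (\<alpha> - 1) * R * 2 powr \<alpha> * ((1 + real j) powr (\<alpha> - 1) / 8 ^ j)" for j
  proof -
    have "\<bar>\<integral>z. ?u z * Phi (v / 16 ^ j) (residual k v j) z \<partial>lborel\<bar>
        \<le> (?A / 8 ^ j) * sqrt s * smoothing_cost (v / 16 ^ j) * R"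
    proof (rule smoothing_term_le[OF f g dyadic_scale em eM S _ area s R R0])
      fix z assume "z \<notin> S"
      then show "residual k v j z = 0"
        using rb[of j, THEN conjunct2, THEN conjunct2, rule_format, of z z] v by simp
    qed auto
    also have "\<dots> \<le> (?A / 8 ^ j) * sqrt s * (2 powr \<alpha> * (L v * (1 + real j)) powr (\<alpha> - 1)) * R"
      unfolding smoothing_cost_def[OF dyadic_scale] using L_pow16[OF v, of j] alpha s A0 R0
      by (intro mult_right_mono mult_left_mono powr_mono2) auto
    also have "(L v * (1 + real j)) powr (\<alpha> - 1) = L v powr (\<alpha> - 1) * (1 + real j) powr (\<alpha> - 1)"
      by (rule powr_mult)
    finally show ?thesis by (simp add: mult_ac)
  qed
  have tele: "(\<integral>z. ?u z * k z \<partial>lborel)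
      = (\<Sum>j<m. \<integral>z. ?u z * Phi (v / 16 ^ j) (residual k v j) z \<partial>lborel) + (\<integral>z. ?u z * residual k v m z \<partial>lborel)" for m
  proof (induction m)
    case (Suc m)
    let ?P = "Phi (v / 16 ^ m) (residual k v m)"
    have "plane_lipschitz (2 ^ m * l) ?P" by (rule Phi_lipschitz[OF dyadic_scale conjunct1[OF rb] eM])
    then have Pm: "?P \<in> borel_measurable borel" by (rule plane_lipschitz_measurable)
    \<comment> \<open>The smoothed function is the difference of two consecutive residuals, both
      already bounded.\<close>
    have PM: "\<bar>?P z\<bar> \<le> ?A / 8 ^ m + ?A / 8 ^ Suc m" for z
      using eM[of m z] eM[of "Suc m" z] by simp
    have "(\<integral>z. ?u z * residual k v m z \<partial>lborel) = (\<integral>z. ?u z * ?P z + ?u z * residual k v (Suc m) z \<partial>lborel)"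
      by (intro Bochner_Integration.integral_cong refl) (simp add: algebra_simps)
    also have "\<dots> = (\<integral>z. ?u z * ?P z \<partial>lborel) + (\<integral>z. ?u z * residual k v (Suc m) z \<partial>lborel)"
      by (rule Bochner_Integration.integral_add[OF uint[OF Pm PM] uint[OF em eM]])
    finally show ?case using Suc by simp
  qed simp
  define I where "I = (\<integral>z. \<bar>?u z\<bar> \<partial>lborel)"
  define X where "X = ?A * sqrt s * L v powr (\<alpha> - 1) * R * 2 powr \<alpha>"
  have X0: "X \<ge> 0" using A0 s R0 by (simp add: X_def)
  have main: "\<bar>\<integral>z. ?u z * k z \<partial>lborel\<bar> \<le> X * (\<Sum>j. (1 + real j) powr (\<alpha> - 1) / 8 ^ j) + ?A * I / 8 ^ m" for m
  proof -
    have "\<bar>\<Sum>j<m. \<integral>z. ?u z * Phi (v / 16 ^ j) (residual k v j) z \<partial>lborel\<bar>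
        \<le> (\<Sum>j<m. X * ((1 + real j) powr (\<alpha> - 1) / 8 ^ j))"
      by (rule order_trans[OF sum_abs sum_mono]) (use step in \<open>simp add: X_def\<close>)
    also have "\<dots> = X * (\<Sum>j<m. (1 + real j) powr (\<alpha> - 1) / 8 ^ j)" by (simp add: sum_distrib_left)
    also have "\<dots> \<le> X * (\<Sum>j. (1 + real j) powr (\<alpha> - 1) / 8 ^ j)"
      by (intro mult_left_mono X0 sum_le_suminf dual_const_summable) auto
    finally have 1: "\<bar>\<Sum>j<m. \<integral>z. ?u z * Phi (v / 16 ^ j) (residual k v j) z \<partial>lborel\<bar>
        \<le> X * (\<Sum>j. (1 + real j) powr (\<alpha> - 1) / 8 ^ j)" .
    have "\<bar>\<integral>z. ?u z * residual k v m z \<partial>lborel\<bar> \<le> (\<integral>z. \<bar>?u z * residual k v m z\<bar> \<partial>lborel)"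
      by (rule integral_abs_bound)
    also have "\<dots> \<le> (\<integral>z. ?A / 8 ^ m * \<bar>?u z\<bar> \<partial>lborel)"
    proof (rule integral_mono)
      show "integrable lborel (\<lambda>z. \<bar>?u z * residual k v m z\<bar>)" using uint[OF em eM] by (rule integrable_abs)
      show "integrable lborel (\<lambda>z. ?A / 8 ^ m * \<bar>?u z\<bar>)" using ui by simp
      show "\<bar>?u z * residual k v m z\<bar> \<le> ?A / 8 ^ m * \<bar>?u z\<bar>" for z
        using mult_left_mono[OF eM[of m z], of "\<bar>?u z\<bar>"] by (simp add: abs_mult mult_ac)
    qed
    also have "\<dots> = ?A * I / 8 ^ m" by (simp add: I_def)
    finally show ?thesis using 1 unfolding tele[of m] by linarith
  qed
  have "(\<lambda>m. X * (\<Sum>j. (1 + real j) powr (\<alpha> - 1) / 8 ^ j) + ?A * I / 8 ^ m) \<longlonglongrightarrow> X * (\<Sum>j. (1 + real j) powr (\<alpha> - 1) / 8 ^ j) + 0"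
  proof (intro tendsto_add tendsto_const)
    have "(\<lambda>m. ?A * I * (1/8) ^ m) \<longlonglongrightarrow> ?A * I * 0" by (intro tendsto_mult tendsto_const LIMSEQ_realpow_zero) auto
    then show "(\<lambda>m. ?A * I / 8 ^ m) \<longlonglongrightarrow> 0" by (simp add: power_divide)
  qed
  then have "\<bar>\<integral>z. ?u z * k z \<partial>lborel\<bar> \<le> X * (\<Sum>j. (1 + real j) powr (\<alpha> - 1) / 8 ^ j) + 0"
    by (rule LIMSEQ_le_const) (use main in auto)
  then show ?thesis by (simp add: X_def dual_const_def mult_ac)
qed

end

end

section \<open>Dyadic decomposition of the cross kernel\<close>

definition hat :: "real \<Rightarrow> real" where "hat x = max 0 (min 1 (2 - x))"

lemma hat_simps: "x \<le> 1 \<Longrightarrow> hat x = 1" "2 \<le> x \<Longrightarrow> hat x = 0" "0 \<le> hat x" "hat x \<le> 1"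
  by (auto simp: hat_def)

lemma hat_lipschitz: "\<bar>hat x - hat y\<bar> \<le> \<bar>x - y\<bar>"
  by (auto simp: hat_def max_def min_def abs_if)

text \<open>For \<open>s < 0 < t\<close> this is \<open>t - s\<close>, so \<open>B (l1 z)\<close>
  extends the cross kernel evenly to all four quadrants; away from the origin the extension is
  Lipschitz across the axes.\<close>

definition l1 :: "real \<times> real \<Rightarrow> real" where "l1 z = \<bar>fst z\<bar> + \<bar>snd z\<bar>"

lemma l1_nonneg: "0 \<le> l1 z" by (simp add: l1_def)

lemma l1_diff: "\<bar>l1 z - l1 z'\<bar> \<le> \<bar>fst z - fst z'\<bar> + \<bar>snd z - snd z'\<bar>"
  unfolding l1_def by linarith

lemma l1_measurable [measurable]: "l1 \<in> borel_measurable borel"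
proof -
  have "l1 \<in> borel_measurable (borel \<Otimes>\<^sub>M borel)" unfolding l1_def by measurable
  then show ?thesis by (simp add: borel_prod)
qed

lemma plane_lipschitz_mult:
  assumes e: "plane_lipschitz l e" "\<And>z. \<bar>e z\<bar> \<le> A" and f: "plane_lipschitz l' f" "\<And>z. \<bar>f z\<bar> \<le> A'"
  shows "plane_lipschitz (l * A' + A * l') (\<lambda>z. e z * f z)"
  unfolding plane_lipschitz_def
proof (intro allI)
  fix z z' :: "real \<times> real"
  let ?d = "\<bar>fst z - fst z'\<bar> + \<bar>snd z - snd z'\<bar>"
  have "\<bar>e z * f z - e z' * f z'\<bar> = \<bar>(e z - e z') * f z + e z' * (f z - f z')\<bar>" by (simp add: algebra_simps)
  also have "\<dots> \<le> \<bar>e z - e z'\<bar> * \<bar>f z\<bar> + \<bar>e z'\<bar> * \<bar>f z - f z'\<bar>" by (metis abs_mult abs_triangle_ineq)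
  also have "\<dots> \<le> (l * ?d) * A' + A * (l' * ?d)"
    using e f plane_lipschitzD[OF e(1), of z z'] plane_lipschitzD[OF f(1), of z z'] plane_lipschitz_nonneg[OF e(1)]
      order_trans[OF abs_ge_zero e(2)]
    by (intro add_mono mult_mono) auto
  finally show "\<bar>e z * f z - e z' * f z'\<bar> \<le> (l * A' + A * l') * ?d" by (simp add: algebra_simps)
qed

lemma plane_lipschitz_fst:
  assumes "\<And>x y. \<bar>h x - h y\<bar> \<le> l * \<bar>x - y\<bar>" "l \<ge> 0" shows "plane_lipschitz l (\<lambda>z. h (fst z))"
  unfolding plane_lipschitz_def
proof (intro allI)
  fix z z' :: "real \<times> real"
  show "\<bar>h (fst z) - h (fst z')\<bar> \<le> l * (\<bar>fst z - fst z'\<bar> + \<bar>snd z - snd z'\<bar>)"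
    using assms(1)[of "fst z" "fst z'"] assms(2) by (simp add: distrib_left add_increasing2)
qed

lemma plane_lipschitz_l1:
  assumes "\<And>x y. 0 \<le> x \<Longrightarrow> 0 \<le> y \<Longrightarrow> \<bar>h x - h y\<bar> \<le> l * \<bar>x - y\<bar>" "l \<ge> 0"
  shows "plane_lipschitz l (\<lambda>z. h (l1 z))"
  unfolding plane_lipschitz_def
proof (intro allI)
  fix z z' :: "real \<times> real"
  have "\<bar>h (l1 z) - h (l1 z')\<bar> \<le> l * \<bar>l1 z - l1 z'\<bar>" using assms(1) l1_nonneg by blast
  also have "\<dots> \<le> l * (\<bar>fst z - fst z'\<bar> + \<bar>snd z - snd z'\<bar>)" by (intro mult_left_mono l1_diff assms(2))
  finally show "\<bar>h (l1 z) - h (l1 z')\<bar> \<le> l * (\<bar>fst z - fst z'\<bar> + \<bar>snd z - snd z'\<bar>)" .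
qed

lemma emeasure_box:
  assumes "0 \<le> p" "0 \<le> q"
  shows "emeasure lborel ({-p..p} \<times> {-q..q} :: (real \<times> real) set) = ennreal (4 * p * q)"
proof -
  have "emeasure (lborel \<Otimes>\<^sub>M lborel) ({-p..p} \<times> {-q..q}) = emeasure lborel {-p..p} * emeasure lborel {-q..q}"
    by (rule lborel.emeasure_pair_measure_Times) auto
  then show ?thesis using assms by (simp add: lborel_prod flip: ennreal_mult)
qed

context logarithmic_kernel
begin

text \<open>By convexity the slopes beyond \<open>c\<close> are no steeper than the chords from
  \<open>c / 2\<close>, and these have slope at most \<open>B (c / 2) / (c / 2)\<close> in size
  because \<open>B\<close> is nonnegative.\<close>

lemma B_truncated_lipschitz:
  assumes c: "c > 0"
  shows "\<bar>B (max x c) - B (max y c)\<bar> \<le> 2 * B (c / 2) / c * \<bar>x - y\<bar>"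
proof -
  have 1: "B x - B y \<le> 2 * B (c / 2) / c * (y - x)" if xy: "c \<le> x" "x < y" for x y
  proof -
    have "(B (c/2) - B x) / (c/2 - x) \<le> (B (c/2) - B y) / (c/2 - y)"
      by (rule convex_on_slope_le(1)[OF conv]) (use c xy in auto)
    also have "\<dots> \<le> (B x - B y) / (x - y)"
      by (rule convex_on_slope_le(2)[OF conv]) (use c xy in auto)
    finally have s: "(B x - B y) / (y - x) \<le> (B (c/2) - B x) / (x - c/2)"
      by (metis minus_diff_eq minus_divide_right neg_le_iff_le)
    also have "\<dots> \<le> B (c/2) / (c/2)"
      using c xy nonneg[of x] nonneg[of "c/2"] by (intro frac_le) auto
    finally have "(B x - B y) / (y - x) \<le> 2 * B (c/2) / c" by (simp add: mult.commute)
    then show ?thesis using xy by (simp add: pos_divide_le_eq)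
  qed
  have K: "0 \<le> 2 * B (c / 2) / c" using c nonneg[of "c/2"] by simp
  have 2: "\<bar>B (max x c) - B (max y c)\<bar> \<le> 2 * B (c / 2) / c * \<bar>x - y\<bar>" if "x \<le> y" for x y
  proof (cases "max x c = max y c")
    case True then show ?thesis using mult_nonneg_nonneg[OF K abs_ge_zero] by simp
  next
    case False
    then have lt: "max x c < max y c" using that by auto
    have "\<bar>B (max x c) - B (max y c)\<bar> = B (max x c) - B (max y c)" using dec[of "max x c" "max y c"] lt c by auto
    also have "\<dots> \<le> 2 * B (c / 2) / c * (max y c - max x c)" using 1[OF _ lt] by simp
    also have "\<dots> \<le> 2 * B (c / 2) / c * \<bar>x - y\<bar>" using that by (intro mult_left_mono K) auto
    finally show ?thesis .
  qed
  show ?thesis using 2[of x y] 2[of y x] by (cases "x \<le> y") (auto simp: abs_minus_commute)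
qed

lemma B_growth:
  assumes R: "R > 0"
  shows "\<exists>C>0. \<forall>n. B (R / 2 ^ n / 4) * (R / 2 ^ n) \<le> C / (real n + 1) powr \<alpha>"
proof -
  define X where "X n = B (R / 2 ^ n / 4) * (R / 2 ^ n) * (real n + 1) powr \<alpha>" for n :: nat
  have "(\<lambda>n. 4 * (real n + 1) powr \<alpha> / (ln (4 / R) + real n * ln 2) powr \<alpha>) \<longlonglongrightarrow> 4 * inverse (ln 2 powr \<alpha>)"
    using alpha by real_asymp
  moreover have "\<forall>\<^sub>F n in sequentially. 4 * (real n + 1) powr \<alpha> / (ln (4 / R) + real n * ln 2) powr \<alpha> = X n"
  proof -
    have "(\<lambda>n. R / 2 ^ n / 4) \<longlonglongrightarrow> 0" by real_asymp
    then have "\<forall>\<^sub>F n in sequentially. R / 2 ^ n / 4 < 2 * e0" using e0 by (intro order_tendstoD) auto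
    then show ?thesis
    proof eventually_elim
      case (elim n)
      have p: "0 < R / 2 ^ n / 4" using R by simp
      have l: "ln (1 / (R / 2 ^ n / 4)) = ln (4 / R) + real n * ln 2"
        using R by (simp add: ln_div ln_mult ln_realpow)
      have "X n = 1 / (R / 2 ^ n / 4 * (ln (4 / R) + real n * ln 2) powr \<alpha>) * (R / 2 ^ n) * (real n + 1) powr \<alpha>"
        unfolding X_def explicit[OF p elim] l ..
      also have "\<dots> = 4 * (real n + 1) powr \<alpha> / (ln (4 / R) + real n * ln 2) powr \<alpha>"
        using R by (simp add: field_simps)
      finally show ?case ..
    qed
  qed
  ultimately have "X \<longlonglongrightarrow> 4 * inverse (ln 2 powr \<alpha>)" by (rule Lim_transform_eventually)
  then have "Bseq X" by (intro convergent_imp_Bseq convergentI)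
  then obtain C where C: "C > 0" "\<And>n. norm (X n) \<le> C" unfolding Bseq_def by blast
  have "B (R / 2 ^ n / 4) * (R / 2 ^ n) \<le> C / (real n + 1) powr \<alpha>" for n
  proof -
    have "X n \<le> C" using order_trans[OF abs_ge_self C(2)[of n, unfolded real_norm_def]] .
    moreover have "(real n + 1) powr \<alpha> > 0" by simp
    ultimately show ?thesis unfolding X_def by (subst pos_le_divide_eq)
  qed
  with C(1) show ?thesis by blast
qed

end

context log_kernel_completion
begin

lemma energy_restrict_le:
  assumes f: "\<And>i. i < n \<Longrightarrow> f i \<in> L2 a b" and g: "\<And>i. i < n \<Longrightarrow> g i \<in> L2 a b"
  shows "(\<integral>\<^sup>+z. indicator S z * energy n f g z \<partial>lborel) \<le> ennreal ((sqrt (gram n f g))\<^sup>2)"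
proof -
  have "(\<integral>\<^sup>+z. indicator S z * energy n f g z \<partial>lborel) \<le> (\<integral>\<^sup>+z. energy n f g z \<partial>lborel)"
    by (intro nn_integral_mono) (auto simp: indicator_def)
  also have "\<dots> \<le> ennreal (gram n f g)" by (rule energy_total[OF f g])
  finally show ?thesis using gram_nonneg[OF f g] by simp
qed

text \<open>The dual bound for kernels supported in a box: the region is the box enlarged by the
  margin \<open>2 * v\<close>, and the energy is not localized.\<close>

lemma lipschitz_dual_bounded:
  assumes kA: "\<And>z. \<bar>k z\<bar> \<le> A" and lip: "plane_lipschitz l k" and v: "0 < v" "v < e0"
    and p: "0 \<le> p" and q: "0 \<le> q"
    and supp: "\<And>z. k z \<noteq> 0 \<Longrightarrow> \<bar>fst z\<bar> \<le> p \<and> \<bar>snd z\<bar> \<le> q"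
    and f: "\<And>i. i < n \<Longrightarrow> f i \<in> L2 a b" and g: "\<And>i. i < n \<Longrightarrow> g i \<in> L2 a b"
  shows "\<bar>\<integral>z. tens n f g z * k z \<partial>lborel\<bar>
    \<le> dual_const * max A (16 * l * v) * sqrt (4 * (p + 2 * v) * (q + 2 * v)) * L v powr (\<alpha> - 1) * sqrt (gram n f g)"
proof (rule lipschitz_dual_bound[OF kA lip v _ f g _ _ _ energy_restrict_le[OF f g]])
  let ?S = "{-(p + 2 * v)..p + 2 * v} \<times> {-(q + 2 * v)..q + 2 * v}"
  show "k z' = 0" if "z \<notin> ?S" "\<bar>fst z - fst z'\<bar> \<le> 2 * v" "\<bar>snd z - snd z'\<bar> \<le> 2 * v" for z z'
  proof (rule ccontr)
    assume "k z' \<noteq> 0"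
    from supp[OF this] that(2,3) have "z \<in> ?S" by (cases z; cases z') auto
    then show False using that(1) by blast
  qed
  show "emeasure lborel ?S \<le> ennreal (4 * (p + 2 * v) * (q + 2 * v))"
    using p q v by (subst emeasure_box) auto
  show "?S \<in> sets borel" by (intro borel_closed closed_Times) auto
qed (use p q v gram_nonneg[OF f g] in auto)

text \<open>Lines have capacity zero with respect to the dual norm.\<close>

lemma thin_strip:
  assumes kA: "\<And>z. \<bar>k z\<bar> \<le> A" and lip: "plane_lipschitz l k" and q: "0 < q"
    and supp: "\<And>z. k z \<noteq> 0 \<Longrightarrow> \<bar>snd z\<bar> \<le> q" and \<eta>: "\<eta> > 0"
  shows "\<exists>\<delta>>0. \<forall>n f g. (\<forall>i<n. f i \<in> L2 a b \<and> g i \<in> L2 a b) \<longrightarrow>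
    \<bar>\<integral>z. tens n f g z * (k z * max 0 (1 - \<bar>fst z\<bar> / \<delta>)) \<partial>lborel\<bar> \<le> \<eta> * sqrt (gram n f g)"
proof -
  have A0: "A \<ge> 0" using kA[of 0] by (rule order_trans[OF abs_ge_zero])
  have l0: "l \<ge> 0" by (rule plane_lipschitz_nonneg[OF lip])
  define Y where "Y \<delta> = dual_const * (A + l * \<delta>) * sqrt (4 * (2 * \<delta>) * (q + \<delta>)) * L (\<delta> / 16) powr (\<alpha> - 1)" for \<delta>
  \<comment> \<open>The strip has area of order \<delta>, and its square root beats every power of
    the logarithm.\<close>
  have s0: "((\<lambda>\<delta>. sqrt (\<delta> * L (\<delta> / 16) powr (2 * (\<alpha> - 1)))) \<longlongrightarrow> 0) (at_right 0)"
    unfolding L_def using alpha by real_asymp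
  have "((\<lambda>\<delta>. dual_const * (A + l * \<delta>) * sqrt (8 * (q + \<delta>)) * sqrt (\<delta> * L (\<delta> / 16) powr (2 * (\<alpha> - 1)))) \<longlongrightarrow>
      dual_const * (A + l * 0) * sqrt (8 * (q + 0)) * 0) (at_right 0)"
    by (intro tendsto_intros s0)
  then have lim: "((\<lambda>\<delta>. dual_const * (A + l * \<delta>) * sqrt (8 * (q + \<delta>)) * sqrt (\<delta> * L (\<delta> / 16) powr (2 * (\<alpha> - 1)))) \<longlongrightarrow> 0) (at_right 0)"
    by simp
  have "\<forall>\<^sub>F \<delta> in at_right 0. dual_const * (A + l * \<delta>) * sqrt (8 * (q + \<delta>)) * sqrt (\<delta> * L (\<delta> / 16) powr (2 * (\<alpha> - 1))) < \<eta>"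
    using order_tendstoD(2)[OF lim \<eta>] .
  moreover have "\<forall>\<^sub>F \<delta> in at_right 0. 0 < \<delta> \<and> \<delta> < e0"
    using e0(1) by (intro eventually_conj eventually_at_right_less) (auto simp: eventually_at_right_field)
  ultimately have "\<forall>\<^sub>F \<delta> in at_right 0. 0 < \<delta> \<and> \<delta> < e0 \<and>
      dual_const * (A + l * \<delta>) * sqrt (8 * (q + \<delta>)) * sqrt (\<delta> * L (\<delta> / 16) powr (2 * (\<alpha> - 1))) < \<eta>"
    by eventually_elim auto
  then obtain \<delta> where \<delta>: "0 < \<delta>" "\<delta> < e0"
    "dual_const * (A + l * \<delta>) * sqrt (8 * (q + \<delta>)) * sqrt (\<delta> * L (\<delta> / 16) powr (2 * (\<alpha> - 1))) < \<eta>"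
    using eventually_happens[of _ "at_right (0::real)"] by (auto simp: trivial_limit_at_right_real)
  have sqL: "sqrt (\<delta> * L (\<delta> / 16) powr (2 * (\<alpha> - 1))) = sqrt \<delta> * L (\<delta> / 16) powr (\<alpha> - 1)"
  proof -
    have "L (\<delta> / 16) powr (2 * (\<alpha> - 1)) = (L (\<delta> / 16) powr (\<alpha> - 1))\<^sup>2"
      by (simp add: power2_eq_square powr_add[symmetric])
    then show ?thesis by (simp add: real_sqrt_mult)
  qed
  let ?h = "\<lambda>z. max 0 (1 - \<bar>fst z\<bar> / \<delta>)"
  have hlip: "plane_lipschitz (1 / \<delta>) ?h"
  proof (rule plane_lipschitz_fst)
    fix x y :: real
    have "\<bar>max 0 (1 - \<bar>x\<bar> / \<delta>) - max 0 (1 - \<bar>y\<bar> / \<delta>)\<bar> \<le> \<bar>\<bar>x\<bar> / \<delta> - \<bar>y\<bar> / \<delta>\<bar>" by linarith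
    also have "\<dots> = \<bar>\<bar>x\<bar> - \<bar>y\<bar>\<bar> / \<delta>" using \<delta>(1) by (simp add: diff_divide_distrib[symmetric])
    also have "\<dots> \<le> \<bar>x - y\<bar> / \<delta>" using \<delta>(1) by (intro divide_right_mono) auto
    finally show "\<bar>max 0 (1 - \<bar>x\<bar> / \<delta>) - max 0 (1 - \<bar>y\<bar> / \<delta>)\<bar> \<le> 1 / \<delta> * \<bar>x - y\<bar>" by simp
  qed (use \<delta> in auto)
  have hb: "\<bar>?h z\<bar> \<le> 1" for z using \<delta>(1) by auto
  have klip: "plane_lipschitz (l * 1 + A * (1 / \<delta>)) (\<lambda>z. k z * ?h z)"
    by (rule plane_lipschitz_mult[OF lip kA hlip hb])
  have kb: "\<bar>k z * ?h z\<bar> \<le> A" for z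
    using mult_mono[OF kA[of z] hb[of z]] A0 by (simp add: abs_mult)
  have sp: "\<bar>fst z\<bar> \<le> \<delta> \<and> \<bar>snd z\<bar> \<le> q" if "k z * ?h z \<noteq> 0" for z
  proof
    show "\<bar>snd z\<bar> \<le> q" using supp that by auto
    have "?h z \<noteq> 0" using that by auto
    then have "\<bar>fst z\<bar> / \<delta> < 1" by (rule contrapos_np) simp
    then show "\<bar>fst z\<bar> \<le> \<delta>" using \<delta>(1) by simp
  qed
  have "\<bar>\<integral>z. tens n f g z * (k z * ?h z) \<partial>lborel\<bar> \<le> \<eta> * sqrt (gram n f g)"
    if fg: "\<forall>i<n. f i \<in> L2 a b \<and> g i \<in> L2 a b" for n f g
  proof -
    have f: "\<And>i. i < n \<Longrightarrow> f i \<in> L2 a b" and g: "\<And>i. i < n \<Longrightarrow> g i \<in> L2 a b" using fg by auto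
    \<comment> \<open>The cut-off is steep, with slope \<open>1 / \<delta>\<close>. At the scale
      \<open>\<delta> / 16\<close> the Lipschitz term becomes
      \<open>16 * (l + A / \<delta>) * (\<delta> / 16) = A + l * \<delta>\<close> and stays
      bounded.\<close>
    have v: "0 < \<delta> / 16" "\<delta> / 16 < e0" using \<delta> by auto
    have "\<bar>\<integral>z. tens n f g z * (k z * ?h z) \<partial>lborel\<bar>
        \<le> dual_const * max A (16 * (l * 1 + A * (1 / \<delta>)) * (\<delta> / 16)) * sqrt (4 * (\<delta> + 2 * (\<delta> / 16)) * (q + 2 * (\<delta> / 16)))
          * L (\<delta> / 16) powr (\<alpha> - 1) * sqrt (gram n f g)"
      by (rule lipschitz_dual_bounded[OF kb klip v _ _ sp f g]) (use \<delta> q in auto)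
    also have "\<dots> \<le> dual_const * (A + l * \<delta>) * (sqrt (8 * (q + \<delta>)) * sqrt \<delta>) * L (\<delta> / 16) powr (\<alpha> - 1) * sqrt (gram n f g)"
    proof (intro mult_right_mono mult_mono mult_left_mono)
      show "max A (16 * (l * 1 + A * (1 / \<delta>)) * (\<delta> / 16)) \<le> A + l * \<delta>"
        using \<delta>(1) l0 A0 by (simp add: field_simps)
      have "4 * (\<delta> + 2 * (\<delta> / 16)) * (q + 2 * (\<delta> / 16)) \<le> 4 * (2 * \<delta>) * (q + \<delta>)"
        using \<delta>(1) q by (intro mult_mono) auto
      also have "\<dots> = 8 * (q + \<delta>) * \<delta>" by simp
      finally show "sqrt (4 * (\<delta> + 2 * (\<delta> / 16)) * (q + 2 * (\<delta> / 16))) \<le> sqrt (8 * (q + \<delta>)) * sqrt \<delta>"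
        by (simp add: real_sqrt_mult[symmetric])
    qed (use dual_const_nonneg A0 l0 \<delta>(1) q gram_nonneg[OF f g] in auto)
    also have "\<dots> \<le> \<eta> * sqrt (gram n f g)"
      using \<delta>(3) gram_nonneg[OF f g] unfolding sqL by (intro mult_right_mono) (auto simp: mult_ac)
    finally show ?thesis .
  qed
  with \<delta>(1) show ?thesis by blast
qed

section \<open>Dyadic pieces and their annuli\<close>

definition u :: "nat \<Rightarrow> real" where "u n = (b - a) / 2 ^ n"

text \<open>Differences of dilated cut-offs telescope to a partition of unity. As
  \<open>u 0 = b - a\<close>, the outermost cut-off equals 1 at every distance that occurs.\<close>

definition theta :: "nat \<Rightarrow> real \<Rightarrow> real" where "theta n x = hat (x / u n) - hat (x / u (Suc n))"

text \<open>\<open>theta\<close> vanishes up to \<open>u n / 2\<close>, so the truncation does not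
  change the product; it makes the first factor bounded and Lipschitz on the whole plane.\<close>

definition piece :: "nat \<Rightarrow> real \<times> real \<Rightarrow> real" where
  "piece n z = B (max (l1 z) (u n / 2)) * theta n (l1 z)"

text \<open>Half the truncation point: there \<open>B\<close> dominates the truncated kernel and,
  through \<open>B_truncated_lipschitz\<close>, also its slope.\<close>

definition amp :: "nat \<Rightarrow> real" where "amp n = B (u n / 4)"

text \<open>The support of the piece, between \<open>u n / 2\<close> and \<open>2 * u n\<close>,
  with room for the margin of the smoothing.\<close>

definition annulus :: "nat \<Rightarrow> (real \<times> real) set" where "annulus n = {z. u n / 4 \<le> l1 z \<and> l1 z \<le> 4 * u n}"

lemma u_pos: "0 < u n" using ab by (simp add: u_def)

lemma u_Suc: "u (Suc n) = u n / 2" by (simp add: u_def)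

lemma amp_nonneg: "0 \<le> amp n" using nonneg u_pos by (simp add: amp_def)

lemma theta_bounds: "0 \<le> x \<Longrightarrow> \<bar>theta n x\<bar> \<le> 1" "\<bar>theta n x - theta n y\<bar> \<le> 3 / u n * \<bar>x - y\<bar>"
proof -
  show "\<bar>theta n x\<bar> \<le> 1" using hat_simps(3,4)[of "x / u n"] hat_simps(3,4)[of "x / u (Suc n)"]
    unfolding theta_def by linarith
  have "\<bar>theta n x - theta n y\<bar> \<le> \<bar>x / u n - y / u n\<bar> + \<bar>x / u (Suc n) - y / u (Suc n)\<bar>"
    using hat_lipschitz[of "x / u n" "y / u n"] hat_lipschitz[of "x / u (Suc n)" "y / u (Suc n)"]
    unfolding theta_def by linarith
  also have "\<dots> = \<bar>x - y\<bar> / u n + \<bar>x - y\<bar> / u (Suc n)"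
    using u_pos[of n] u_pos[of "Suc n"] by (simp add: diff_divide_distrib[symmetric] abs_divide)
  also have "\<dots> = 3 / u n * \<bar>x - y\<bar>" by (simp add: u_Suc)
  finally show "\<bar>theta n x - theta n y\<bar> \<le> 3 / u n * \<bar>x - y\<bar>" .
qed

lemma theta_support: "theta n x \<noteq> 0 \<Longrightarrow> u n / 2 < x \<and> x < 2 * u n"
proof (rule ccontr)
  assume nz: "theta n x \<noteq> 0" and "\<not> (u n / 2 < x \<and> x < 2 * u n)"
  then consider "x \<le> u n / 2" | "2 * u n \<le> x" by linarith
  then show False
  proof cases
    case 1
    then have "x \<le> u n" using u_pos[of n] by linarith
    then have "x / u n \<le> 1" "x / u (Suc n) \<le> 1" using 1 u_pos[of n] by (simp_all add: u_Suc)
    then show False using nz by (simp add: theta_def hat_simps)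
  next
    case 2
    then have "2 \<le> x / u n" "2 \<le> x / u (Suc n)" using u_pos[of n] by (simp_all add: u_Suc field_simps)
    then show False using nz by (simp add: theta_def hat_simps)
  qed
qed

lemma piece_support: "piece n z \<noteq> 0 \<Longrightarrow> u n / 2 < l1 z \<and> l1 z < 2 * u n"
  using theta_support[of n "l1 z"] by (auto simp: piece_def)

lemma piece_eq: "piece n z = B (l1 z) * theta n (l1 z)"
  using theta_support[of n "l1 z"] by (cases "theta n (l1 z) = 0") (auto simp: piece_def max_def)

lemma piece_bound: "\<bar>piece n z\<bar> \<le> amp n"
proof -
  have "0 \<le> B (max (l1 z) (u n / 2))" "B (max (l1 z) (u n / 2)) \<le> amp n"
    using u_pos[of n] unfolding amp_def by (auto intro!: nonneg dec)
  then show ?thesis using mult_mono[of "B (max (l1 z) (u n / 2))" "amp n" "\<bar>theta n (l1 z)\<bar>" 1]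
      theta_bounds(1)[OF l1_nonneg[of z], of n] amp_nonneg by (simp add: piece_def abs_mult)
qed

text \<open>Product rule: 4 from the truncated kernel, and 3 from the cut-offs at the scales
  \<open>u n\<close> and \<open>u n / 2\<close>.\<close>

lemma piece_lipschitz: "plane_lipschitz (7 * amp n / u n) (piece n)"
proof -
  have c: "u n / 2 > 0" using u_pos by simp
  have 1: "plane_lipschitz (4 * amp n / u n) (\<lambda>z. B (max (l1 z) (u n / 2)))"
  proof (rule plane_lipschitz_l1)
    show "\<bar>B (max x (u n / 2)) - B (max y (u n / 2))\<bar> \<le> 4 * amp n / u n * \<bar>x - y\<bar>" for x y
      using B_truncated_lipschitz[OF c, of x y] by (simp add: amp_def)
  qed (simp add: amp_nonneg u_pos less_imp_le)
  have 2: "plane_lipschitz (3 / u n) (\<lambda>z. theta n (l1 z))"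
    by (rule plane_lipschitz_l1) (use theta_bounds(2) u_pos[of n] in auto)
  have b1: "\<bar>B (max (l1 z) (u n / 2))\<bar> \<le> amp n" for z
    using u_pos[of n] nonneg[of "max (l1 z) (u n / 2)"] unfolding amp_def by (auto intro!: dec)
  have b2: "\<bar>theta n (l1 z)\<bar> \<le> 1" for z by (rule theta_bounds(1)[OF l1_nonneg])
  show ?thesis using plane_lipschitz_mult[OF 1 b1 2 b2] by (simp add: piece_def[abs_def] add_divide_distrib[symmetric])
qed

lemma piece_measurable [measurable]: "piece n \<in> borel_measurable borel"
  by (rule plane_lipschitz_measurable[OF piece_lipschitz])

lemma piece_sum: "(\<Sum>n<N. piece n z) = B (l1 z) * (hat (l1 z / u 0) - hat (l1 z / u N))"
proof -
  have "(\<Sum>n<N. theta n (l1 z)) = hat (l1 z / u 0) - hat (l1 z / u N)"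
    unfolding theta_def by (rule sum_lessThan_telescope')
  then show ?thesis by (simp add: piece_eq sum_distrib_left[symmetric])
qed

lemma annulus_sets [measurable]: "annulus n \<in> sets borel"
  unfolding annulus_def by measurable

lemma annulus_area: "emeasure lborel (annulus n) \<le> ennreal ((8 * u n)\<^sup>2)"
proof -
  have "annulus n \<subseteq> {-(4 * u n)..4 * u n} \<times> {-(4 * u n)..4 * u n}"
  proof
    fix z assume "z \<in> annulus n"
    then have "\<bar>fst z\<bar> \<le> 4 * u n" "\<bar>snd z\<bar> \<le> 4 * u n" by (auto simp: annulus_def l1_def)
    then show "z \<in> {-(4 * u n)..4 * u n} \<times> {-(4 * u n)..4 * u n}" by (cases z) (auto simp: abs_le_iff)
  qed
  then have "emeasure lborel (annulus n) \<le> emeasure lborel ({-(4 * u n)..4 * u n} \<times> {-(4 * u n)..4 * u n})"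
    by (intro emeasure_mono) (auto intro!: borel_closed closed_Times)
  also have "\<dots> = ennreal ((8 * u n)\<^sup>2)" using u_pos[of n] by (subst emeasure_box) (auto simp: power2_eq_square)
  finally show ?thesis .
qed

text \<open>Outer and inner radius differ by the factor 16, so the indices of annuli with a common
  point differ by at most 4.\<close>

lemma annulus_overlap: "(\<Sum>n<N. indicator (annulus n) z :: ennreal) \<le> 5"
proof -
  define I where "I = {n. n < N \<and> z \<in> annulus n}"
  have fin: "finite I" by (simp add: I_def)
  have "card I \<le> 5"
  proof (cases "I = {}")
    case False
    define m where "m = Min I"
    have m: "m \<in> I" "\<And>n. n \<in> I \<Longrightarrow> m \<le> n" using fin False by (auto simp: m_def)
    have "I \<subseteq> {m..m + 4}"
    proof
      fix n assume n: "n \<in> I"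
      have "n \<le> m + 4"
      proof (rule ccontr)
        assume "\<not> n \<le> m + 4"
        then have "u n \<le> u (m + 5)" unfolding u_def using ab by (intro divide_left_mono power_increasing) auto
        also have "\<dots> = u m / 32" by (simp add: u_def power_add)
        finally have "4 * u n \<le> u m / 8" by simp
        then show False using n m(1) u_pos[of m] by (auto simp: I_def annulus_def)
      qed
      then show "n \<in> {m..m + 4}" using m(2)[OF n] by simp
    qed
    then have "card I \<le> card {m..m + 4}" by (intro card_mono) auto
    then show ?thesis by simp
  qed simp
  moreover have "(\<Sum>n<N. indicator (annulus n) z :: ennreal) = of_nat (card I)"
  proof -
    have "(\<Sum>n<N. indicator (annulus n) z :: ennreal) = (\<Sum>n\<in>I. 1)"
      unfolding I_def indicator_def by (rule sum.mono_neutral_cong_right) auto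
    then show ?thesis by simp
  qed
  ultimately show ?thesis by (metis of_nat_le_iff of_nat_numeral)
qed

end

lemma closure_image_sequence:
  fixes J :: "'a \<Rightarrow> 'b::metric_space"
  assumes "x \<in> closure (J ` A)"
  obtains F where "\<And>k. F k \<in> A" "(\<lambda>k. J (F k)) \<longlonglongrightarrow> x"
proof -
  obtain X where X: "\<forall>k. X k \<in> J ` A" "X \<longlonglongrightarrow> x"
    using assms unfolding closure_sequential by (elim exE conjE)
  have "\<exists>F. \<forall>k. F k \<in> A \<and> J (F k) = X k" using X(1) by (intro choice) (metis imageE)
  then obtain F where "\<forall>k. F k \<in> A \<and> J (F k) = X k" by blast
  then show thesis using X(2) by (intro that[of F]) auto
qed

text \<open>Comparison with the telescoping \<open>2 / ((m + 1) * (m + 2))\<close>. The tail of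
  order \<open>1/N\<close> is what makes the error of the partial sums tend to 0.\<close>

lemma sum_inverse_squares_le: "N \<le> N' \<Longrightarrow> (\<Sum>m\<in>{N..<N'}. 1 / (real m + 1)\<^sup>2) \<le> 2 / (real N + 1) - 2 / (real N' + 1)"
proof (induction N' rule: dec_induct)
  case (step m)
  have "1 / (real m + 1)\<^sup>2 \<le> 2 / ((real m + 1) * (real m + 2))"
    by (simp add: divide_simps power2_eq_square)
  also have "\<dots> = 2 / (real m + 1) - 2 / (real (Suc m) + 1)" by (simp add: field_simps)
  finally show ?case using step by simp
qed simp

section \<open>Almost orthogonality of the pieces\<close>

context log_kernel_completion
begin

lemma tens_times_integrable:
  assumes f: "\<And>i. i < n \<Longrightarrow> f i \<in> L2 a b" and g: "\<And>i. i < n \<Longrightarrow> g i \<in> L2 a b"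
    and [measurable]: "e \<in> borel_measurable borel" and M: "\<And>z. \<bar>e z\<bar> \<le> M"
  shows "integrable lborel (\<lambda>z. tens n f g z * e z)"
proof (rule Bochner_Integration.integrable_bound)
  note ui = tens_integrable[of n f g, OF f g]
  have [measurable]: "tens n f g \<in> borel_measurable borel" using ui by auto
  show "integrable lborel (\<lambda>z. M * tens n f g z)" using ui by simp
  show "(\<lambda>z. tens n f g z * e z) \<in> borel_measurable lborel" by measurable
  show "AE z in lborel. norm (tens n f g z * e z) \<le> norm (M * tens n f g z)"
    using M by (auto simp: abs_mult mult.commute[of M] intro!: mult_left_mono order_trans[OF M abs_ge_self])
qed

text \<open>The part of the tensor norm visible in one annulus. The integral is at most the Gram
  expression, hence finite, so \<open>enn2real\<close> loses nothing.\<close>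

definition annulus_norm :: "nat \<Rightarrow> (nat \<Rightarrow> real \<Rightarrow> real) \<Rightarrow> (nat \<Rightarrow> real \<Rightarrow> real) \<Rightarrow> nat \<Rightarrow> real" where
  "annulus_norm n f g m = sqrt (enn2real (\<integral>\<^sup>+z. indicator (annulus m) z * energy n f g z \<partial>lborel))"

lemma annulus_integral_eq:
  assumes f: "\<And>i. i < n \<Longrightarrow> f i \<in> L2 a b" and g: "\<And>i. i < n \<Longrightarrow> g i \<in> L2 a b"
  shows "(\<integral>\<^sup>+z. indicator (annulus m) z * energy n f g z \<partial>lborel) = ennreal ((annulus_norm n f g m)\<^sup>2)"
proof -
  have "(\<integral>\<^sup>+z. indicator (annulus m) z * energy n f g z \<partial>lborel) < \<infinity>"
    using order_le_less_trans[OF energy_restrict_le[OF f g]] by simp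
  then show ?thesis by (simp add: annulus_norm_def)
qed

lemma annulus_norm_nonneg: "0 \<le> annulus_norm n f g m" by (simp add: annulus_norm_def)

text \<open>Bounded overlap in place of orthogonality: every point of the plane is counted at most
  five times.\<close>

lemma annulus_norm_sum_squares:
  assumes f: "\<And>i. i < n \<Longrightarrow> f i \<in> L2 a b" and g: "\<And>i. i < n \<Longrightarrow> g i \<in> L2 a b"
  shows "(\<Sum>m<N. (annulus_norm n f g m)\<^sup>2) \<le> 5 * gram n f g"
proof -
  have [measurable]: "energy n f g \<in> borel_measurable borel" by (rule energy_measurable[OF f g])
  have "ennreal (\<Sum>m<N. (annulus_norm n f g m)\<^sup>2) = (\<Sum>m<N. \<integral>\<^sup>+z. indicator (annulus m) z * energy n f g z \<partial>lborel)"
    by (simp add: annulus_integral_eq[OF f g])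
  also have "\<dots> = (\<integral>\<^sup>+z. (\<Sum>m<N. indicator (annulus m) z * energy n f g z) \<partial>lborel)"
    by (rule nn_integral_sum[symmetric]) measurable
  also have "\<dots> \<le> (\<integral>\<^sup>+z. 5 * energy n f g z \<partial>lborel)"
  proof (intro nn_integral_mono)
    fix z
    show "(\<Sum>m<N. indicator (annulus m) z * energy n f g z) \<le> 5 * energy n f g z"
      unfolding sum_distrib_right[symmetric] by (intro mult_right_mono annulus_overlap) simp
  qed
  also have "\<dots> = 5 * (\<integral>\<^sup>+z. energy n f g z \<partial>lborel)" by (rule nn_integral_cmult) measurable
  also have "\<dots> \<le> 5 * ennreal (gram n f g)" by (intro mult_left_mono energy_total[OF f g]) simp_all
  also have "\<dots> = ennreal (5 * gram n f g)" by (subst ennreal_mult') auto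
  finally show ?thesis using gram_nonneg[OF f g] by (simp add: ennreal_le_iff)
qed

lemma piece_dual:
  "\<exists>C\<ge>0. \<forall>n f g. (\<forall>i<n. f i \<in> L2 a b \<and> g i \<in> L2 a b) \<longrightarrow>
    (\<forall>m. \<bar>\<integral>z. tens n f g z * piece m z \<partial>lborel\<bar> \<le> C / (real m + 1) * annulus_norm n f g m)"
proof -
  obtain C where C: "C > 0" "\<And>m. B ((b - a) / 2 ^ m / 4) * ((b - a) / 2 ^ m) \<le> C / (real m + 1) powr \<alpha>"
    using B_growth[of "b - a"] ab by auto
  have Cm: "amp m * u m \<le> C / (real m + 1) powr \<alpha>" for m
    using C(2)[of m] by (simp add: amp_def u_def)
  \<comment> \<open>Smoothing at scale \<open>\<kappa> * u m\<close> moves \<open>l1\<close> by at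
    most \<open>4 * \<kappa> * u m\<close>, so 1/16 keeps the margin inside the annulus; the second
    bound keeps all scales below \<open>e0\<close>.\<close>
  define \<kappa> where "\<kappa> = min (1 / 16) (e0 / (2 * (b - a)))"
  have k: "0 < \<kappa>" "\<kappa> \<le> 1 / 16"
    unfolding \<kappa>_def using e0 ab by (simp_all only: min.cobounded1) simp_all
  have "\<kappa> * (b - a) \<le> e0 / (2 * (b - a)) * (b - a)" unfolding \<kappa>_def using ab by (intro mult_right_mono) auto
  moreover have "e0 / (2 * d) * d = e0 / 2" if "d > 0" for d using that by simp
  ultimately have "\<kappa> * (b - a) \<le> e0 / 2" using ab by (metis diff_gt_0_iff_gt)
  then have k0: "\<kappa> * (b - a) < e0" using e0 by linarith
  have v: "0 < \<kappa> * u m" "\<kappa> * u m < e0" for m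
  proof -
    show "0 < \<kappa> * u m" using k u_pos by simp
    have "u m \<le> b - a" using ab unfolding u_def by (simp add: divide_le_eq mult_le_cancel_left1)
    then have "\<kappa> * u m \<le> \<kappa> * (b - a)" using k by (intro mult_left_mono) auto
    then show "\<kappa> * u m < e0" using k0 by linarith
  qed
  define l0 where "l0 = L (\<kappa> * u 0)"
  have l0: "l0 \<ge> 3" using L_ge[of "\<kappa> * u 0"] v[of 0] alpha by (simp add: l0_def)
  have Lm: "L (\<kappa> * u m) \<le> l0 * (real m + 1)" "0 < L (\<kappa> * u m)" for m
  proof -
    have e: "L (\<kappa> * u m) = l0 + real m * ln 2"
      using k ab by (simp add: L_def l0_def u_def ln_div ln_mult ln_realpow)
    have "ln 2 \<le> l0" using l0 ln2_le_25_over_36 by linarith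
    then have "real m * ln 2 \<le> real m * l0" by (intro mult_left_mono) auto
    then show "L (\<kappa> * u m) \<le> l0 * (real m + 1)" unfolding e by (simp add: algebra_simps)
    show "0 < L (\<kappa> * u m)" unfolding e using l0 by (simp add: add_pos_nonneg)
  qed
  \<comment> \<open>56 is 7 from the amplitude and Lipschitz term times 8 from the root of the area.
    The factor \<open>C\<close> bounds \<open>amp m * u m\<close> up to the power
    \<open>-\<alpha>\<close> of \<open>m + 1\<close>, and the logarithm contributes the power
    \<open>\<alpha> - 1\<close>.\<close>
  define C3 where "C3 = 56 * dual_const * l0 powr (\<alpha> - 1) * C"
  have "\<bar>\<integral>z. tens n f g z * piece m z \<partial>lborel\<bar> \<le> C3 / (real m + 1) * annulus_norm n f g m"
    if fg: "\<forall>i<n. f i \<in> L2 a b \<and> g i \<in> L2 a b" for n f g m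
  proof -
    have f: "\<And>i. i < n \<Longrightarrow> f i \<in> L2 a b" and g: "\<And>i. i < n \<Longrightarrow> g i \<in> L2 a b" using fg by auto
    have um: "u m > 0" by (rule u_pos)
    have "\<bar>\<integral>z. tens n f g z * piece m z \<partial>lborel\<bar>
        \<le> dual_const * max (amp m) (16 * (7 * amp m / u m) * (\<kappa> * u m)) * sqrt ((8 * u m)\<^sup>2) * L (\<kappa> * u m) powr (\<alpha> - 1) * annulus_norm n f g m"
    proof (rule lipschitz_dual_bound[OF piece_bound piece_lipschitz v _ f g annulus_sets annulus_area _ _ annulus_norm_nonneg])
      fix z z' :: "real \<times> real"
      assume z: "z \<notin> annulus m" "\<bar>fst z - fst z'\<bar> \<le> 2 * (\<kappa> * u m)" "\<bar>snd z - snd z'\<bar> \<le> 2 * (\<kappa> * u m)"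
      have "\<kappa> * u m \<le> 1 / 16 * u m" using k um by (intro mult_right_mono) auto
      then have d: "\<bar>l1 z - l1 z'\<bar> \<le> u m / 4" using l1_diff[of z z'] z(2,3) by linarith
      show "piece m z' = 0"
      proof (rule ccontr)
        assume "piece m z' \<noteq> 0"
        from piece_support[OF this] d have "u m / 4 \<le> l1 z" "l1 z \<le> 4 * u m" using um by linarith+
        then have "z \<in> annulus m" by (simp add: annulus_def)
        then show False using z(1) by blast
      qed
    qed (use annulus_integral_eq[OF f g] in auto)
    also have "\<dots> \<le> dual_const * (7 * amp m) * (8 * u m) * (l0 powr (\<alpha> - 1) * (real m + 1) powr (\<alpha> - 1)) * annulus_norm n f g m"
    proof (intro mult_right_mono mult_mono mult_left_mono annulus_norm_nonneg dual_const_nonneg)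
      have "16 * (7 * amp m / u m) * (\<kappa> * u m) = 112 * amp m * \<kappa>" using um by simp
      also have "\<dots> \<le> 112 * amp m * (1 / 16)" using k amp_nonneg by (intro mult_left_mono) auto
      finally show "max (amp m) (16 * (7 * amp m / u m) * (\<kappa> * u m)) \<le> 7 * amp m" using amp_nonneg[of m] by simp
      show "sqrt ((8 * u m)\<^sup>2) \<le> 8 * u m" unfolding real_sqrt_abs using um by simp
      have "L (\<kappa> * u m) powr (\<alpha> - 1) \<le> (l0 * (real m + 1)) powr (\<alpha> - 1)"
        using Lm[of m] alpha by (intro powr_mono2) auto
      then show "L (\<kappa> * u m) powr (\<alpha> - 1) \<le> l0 powr (\<alpha> - 1) * (real m + 1) powr (\<alpha> - 1)"
        by (simp add: powr_mult)
    qed (use dual_const_nonneg amp_nonneg um in \<open>auto simp: le_max_iff_disj\<close>)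
    also have "\<dots> = 56 * dual_const * l0 powr (\<alpha> - 1) * (real m + 1) powr (\<alpha> - 1) * (amp m * u m) * annulus_norm n f g m" by simp
    also have "\<dots> \<le> 56 * dual_const * l0 powr (\<alpha> - 1) * (real m + 1) powr (\<alpha> - 1) * (C / (real m + 1) powr \<alpha>) * annulus_norm n f g m"
      using Cm dual_const_nonneg by (intro mult_right_mono mult_left_mono annulus_norm_nonneg) auto
    also have "\<dots> = C3 / (real m + 1) * annulus_norm n f g m"
      by (simp add: C3_def powr_diff)
    finally show ?thesis .
  qed
  moreover have "C3 \<ge> 0" using dual_const_nonneg C by (simp add: C3_def)
  ultimately show ?thesis by blast
qed

text \<open>Cauchy-Schwarz in the index of the piece: the factors \<open>1 / (m + 1)\<close> are
  square summable, and so are the annulus norms.\<close>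

lemma pieces_dual:
  "\<exists>C\<ge>0. \<forall>n f g. (\<forall>i<n. f i \<in> L2 a b \<and> g i \<in> L2 a b) \<longrightarrow>
    (\<forall>N N'. N \<le> N' \<longrightarrow> \<bar>\<Sum>m\<in>{N..<N'}. \<integral>z. tens n f g z * piece m z \<partial>lborel\<bar> \<le> C / sqrt (real N + 1) * sqrt (gram n f g))"
proof -
  obtain C where C: "C \<ge> 0" "\<And>n f g m. (\<forall>i<n. f i \<in> L2 a b \<and> g i \<in> L2 a b) \<Longrightarrow>
    \<bar>\<integral>z. tens n f g z * piece m z \<partial>lborel\<bar> \<le> C / (real m + 1) * annulus_norm n f g m" using piece_dual by blast
  have "\<bar>\<Sum>m\<in>{N..<N'}. \<integral>z. tens n f g z * piece m z \<partial>lborel\<bar> \<le> (C * sqrt 10) / sqrt (real N + 1) * sqrt (gram n f g)"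
    if fg: "\<forall>i<n. f i \<in> L2 a b \<and> g i \<in> L2 a b" and N: "N \<le> N'" for n f g N N'
  proof -
    have f: "\<And>i. i < n \<Longrightarrow> f i \<in> L2 a b" and g: "\<And>i. i < n \<Longrightarrow> g i \<in> L2 a b" using fg by auto
    let ?r = "annulus_norm n f g"
    have "\<bar>\<Sum>m\<in>{N..<N'}. \<integral>z. tens n f g z * piece m z \<partial>lborel\<bar> \<le> (\<Sum>m\<in>{N..<N'}. C / (real m + 1) * ?r m)"
      by (rule order_trans[OF sum_abs sum_mono]) (use C(2) fg in blast)
    also have "\<dots> = C * (\<Sum>m\<in>{N..<N'}. 1 / (real m + 1) * ?r m)" by (simp add: sum_distrib_left)
    also have "\<dots> \<le> C * sqrt (2 / (real N + 1) * (5 * gram n f g))"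
    proof (intro mult_left_mono C(1) real_le_rsqrt)
      have "(\<Sum>m\<in>{N..<N'}. 1 / (real m + 1) * ?r m)\<^sup>2 \<le> (\<Sum>m\<in>{N..<N'}. (1 / (real m + 1))\<^sup>2) * (\<Sum>m\<in>{N..<N'}. (?r m)\<^sup>2)"
        by (rule Cauchy_Schwarz_ineq_sum)
      also have "\<dots> \<le> 2 / (real N + 1) * (5 * gram n f g)"
      proof (intro mult_mono)
        have "(\<Sum>m\<in>{N..<N'}. (1 / (real m + 1))\<^sup>2) \<le> 2 / (real N + 1) - 2 / (real N' + 1)"
          using sum_inverse_squares_le[OF N] by (simp add: power_one_over)
        moreover have "0 \<le> 2 / (real N' + 1)" by simp
        ultimately show "(\<Sum>m\<in>{N..<N'}. (1 / (real m + 1))\<^sup>2) \<le> 2 / (real N + 1)" by linarith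
        have "(\<Sum>m\<in>{N..<N'}. (?r m)\<^sup>2) \<le> (\<Sum>m<N'. (?r m)\<^sup>2)" by (rule sum_mono2) auto
        then show "(\<Sum>m\<in>{N..<N'}. (?r m)\<^sup>2) \<le> 5 * gram n f g" using annulus_norm_sum_squares[of n f g, OF f g, of N'] by linarith
      qed (auto intro!: sum_nonneg)
      finally show "(\<Sum>m\<in>{N..<N'}. 1 / (real m + 1) * ?r m)\<^sup>2 \<le> 2 / (real N + 1) * (5 * gram n f g)" .
    qed
    also have "2 / (real N + 1) * (5 * gram n f g) = 10 / (real N + 1) * gram n f g" by simp
    also have "C * sqrt (10 / (real N + 1) * gram n f g) = (C * sqrt 10) / sqrt (real N + 1) * sqrt (gram n f g)"
      by (simp add: real_sqrt_mult real_sqrt_divide)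
    finally show ?thesis .
  qed
  moreover have "C * sqrt 10 \<ge> 0" using C(1) by simp
  ultimately show ?thesis by blast
qed

section \<open>The cross term between the two half-intervals\<close>

context
  assumes a0: "a < 0" and b0: "0 < b"
begin

lemma L2_left: "f \<in> L2 a 0 \<Longrightarrow> f \<in> L2 a b" and L2_right: "f \<in> L2 0 b \<Longrightarrow> f \<in> L2 a b"
  using a0 b0 by (auto intro: L2_mono)

text \<open>Partial sums multiply the kernel by a factor in \<open>[0, 1]\<close> that is eventually
  1 at every point of the open quadrant \<open>s < 0 < t\<close>, where the tensor lives. The
  integrable cross term itself dominates.\<close>

lemma cross_limit:
  assumes f: "\<And>i. i < n \<Longrightarrow> f i \<in> L2 a 0" and g: "\<And>i. i < n \<Longrightarrow> g i \<in> L2 0 b"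
  shows "(\<lambda>N. \<Sum>m<N. \<integral>z. tens n f g z * piece m z \<partial>lborel) \<longlonglongrightarrow> (\<Sum>i<n. J (f i) \<bullet> J (g i))"
proof -
  have f': "\<And>i. i < n \<Longrightarrow> f i \<in> L2 a b" and g': "\<And>i. i < n \<Longrightarrow> g i \<in> L2 a b"
    using f g L2_left L2_right by auto
  have ufz: "tens n f g z = (\<Sum>i<n. f i (fst z) * g i (snd z))" for z
    using f' g' by (subst tens_def) auto
  have supp: "fst z < 0 \<and> 0 < snd z \<and> 0 < l1 z \<and> l1 z < b - a \<and> fst z - snd z = - l1 z" if nz: "tens n f g z \<noteq> 0" for z
  proof -
    have "\<exists>i<n. f i (fst z) * g i (snd z) \<noteq> 0"
    proof (rule ccontr)
      assume "\<not> (\<exists>i<n. f i (fst z) * g i (snd z) \<noteq> 0)"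
      then have "tens n f g z = 0" unfolding ufz by (intro sum.neutral) auto
      with nz show False by simp
    qed
    then obtain i where i: "i < n" "f i (fst z) \<noteq> 0" "g i (snd z) \<noteq> 0" by auto
    then have "fst z \<in> {a<..<0}" "snd z \<in> {0<..<b}" using L2_outside[OF f] L2_outside[OF g] by blast+
    then show ?thesis by (auto simp: l1_def)
  qed
  have each: "integrable lborel (\<lambda>z. f i (fst z) * g i (snd z) * B (fst z - snd z))"
    "B_form B (f i) (g i) = (\<integral>z. f i (fst z) * g i (snd z) * B (fst z - snd z) \<partial>lborel)" if "i < n" for i
    using kernel_form_bound(1)[OF B_measurable B_set_integrable f'[OF that] g'[OF that] order_refl]
    by (simp_all add: lborel_prod split_beta' B_form_def)
  have sum_eq: "(\<Sum>i<n. f i (fst z) * g i (snd z) * B (fst z - snd z)) = tens n f g z * B (l1 z)" for z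
  proof (cases "tens n f g z = 0")
    case True
    then show ?thesis unfolding ufz by (simp add: sum_distrib_right[symmetric])
  next
    case False
    from supp[OF this] have "B (fst z - snd z) = B (l1 z)" using even[of "l1 z"] by auto
    then show ?thesis unfolding ufz by (simp add: sum_distrib_right)
  qed
  have int: "integrable lborel (\<lambda>z. tens n f g z * B (l1 z))"
    unfolding sum_eq[symmetric] using each(1) by (intro Bochner_Integration.integrable_sum) auto
  have target: "(\<Sum>i<n. J (f i) \<bullet> J (g i)) = (\<integral>z. tens n f g z * B (l1 z) \<partial>lborel)"
  proof -
    have "(\<Sum>i<n. J (f i) \<bullet> J (g i)) = (\<Sum>i<n. \<integral>z. f i (fst z) * g i (snd z) * B (fst z - snd z) \<partial>lborel)"
      by (intro sum.cong refl) (simp add: J_inner f' g' each(2))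
    also have "\<dots> = (\<integral>z. (\<Sum>i<n. f i (fst z) * g i (snd z) * B (fst z - snd z)) \<partial>lborel)"
      using each(1) by (intro Bochner_Integration.integral_sum[symmetric]) auto
    finally show ?thesis unfolding sum_eq .
  qed
  have partial: "(\<Sum>m<N. \<integral>z. tens n f g z * piece m z \<partial>lborel)
      = (\<integral>z. tens n f g z * (B (l1 z) * (hat (l1 z / u 0) - hat (l1 z / u N))) \<partial>lborel)" for N
  proof -
    have "(\<Sum>m<N. \<integral>z. tens n f g z * piece m z \<partial>lborel) = (\<integral>z. (\<Sum>m<N. tens n f g z * piece m z) \<partial>lborel)"
      by (rule Bochner_Integration.integral_sum[symmetric])
        (rule tens_times_integrable[OF f' g' piece_measurable piece_bound])
    then show ?thesis by (simp add: sum_distrib_left[symmetric] piece_sum)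
  qed
  have ufm[measurable]: "tens n f g \<in> borel_measurable borel" using tens_integrable[of n f g, OF f' g'] by auto
  have [measurable]: "hat \<in> borel_measurable borel" unfolding hat_def by measurable
  have b1: "\<bar>hat (l1 z / u 0) - hat (l1 z / u N)\<bar> \<le> 1" for z N
    using hat_simps(3,4)[of "l1 z / u 0"] hat_simps(3,4)[of "l1 z / u N"] by linarith
  show ?thesis unfolding partial target
  proof (rule integral_dominated_convergence[where w = "\<lambda>z. \<bar>tens n f g z * B (l1 z)\<bar>"])
    show "integrable lborel (\<lambda>z. \<bar>tens n f g z * B (l1 z)\<bar>)" using int by (rule integrable_abs)
    show "AE z in lborel. (\<lambda>N. tens n f g z * (B (l1 z) * (hat (l1 z / u 0) - hat (l1 z / u N)))) \<longlonglongrightarrow> tens n f g z * B (l1 z)"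
    proof (rule AE_I2)
      fix z
      show "(\<lambda>N. tens n f g z * (B (l1 z) * (hat (l1 z / u 0) - hat (l1 z / u N)))) \<longlonglongrightarrow> tens n f g z * B (l1 z)"
      proof (cases "tens n f g z = 0")
        case False
        note s = supp[OF this]
        have "(\<lambda>N. u N) \<longlonglongrightarrow> 0" unfolding u_def by real_asymp
        then have "\<forall>\<^sub>F N in sequentially. u N < l1 z / 2" using s by (intro order_tendstoD) auto
        then have ev: "\<forall>\<^sub>F N in sequentially. tens n f g z * (B (l1 z) * (hat (l1 z / u 0) - hat (l1 z / u N))) = tens n f g z * B (l1 z)"
        proof eventually_elim
          case (elim N)
          have "hat (l1 z / u N) = 0" using elim u_pos[of N] by (intro hat_simps) (simp add: field_simps)
          moreover have "hat (l1 z / u 0) = 1" using s ab by (intro hat_simps) (simp add: u_def)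
          ultimately show ?case by simp
        qed
        then show ?thesis by (rule tendsto_eventually)
      qed simp
    qed
    show "AE z in lborel. norm (tens n f g z * (B (l1 z) * (hat (l1 z / u 0) - hat (l1 z / u N)))) \<le> \<bar>tens n f g z * B (l1 z)\<bar>" for N
    proof (rule AE_I2)
      fix z
      show "norm (tens n f g z * (B (l1 z) * (hat (l1 z / u 0) - hat (l1 z / u N)))) \<le> \<bar>tens n f g z * B (l1 z)\<bar>"
        using mult_left_mono[OF b1[of z N], of "\<bar>tens n f g z * B (l1 z)\<bar>"] by (simp add: abs_mult mult_ac)
    qed
  qed measurable
qed

text \<open>\<open>N\<close> is kept free: \<open>N = 0\<close> gives the Hilbert-Schmidt bound, and
  large \<open>N\<close> gives the trivial intersection.\<close>

lemma cross_tail: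
  "\<exists>C\<ge>0. \<forall>n f g N. (\<forall>i<n. f i \<in> L2 a 0 \<and> g i \<in> L2 0 b) \<longrightarrow>
    \<bar>(\<Sum>i<n. J (f i) \<bullet> J (g i)) - (\<Sum>m<N. \<integral>z. tens n f g z * piece m z \<partial>lborel)\<bar> \<le> C / sqrt (real N + 1) * sqrt (gram n f g)"
proof -
  obtain C where Cnn: "C \<ge> 0" and C': "\<forall>n f g. (\<forall>i<n. f i \<in> L2 a b \<and> g i \<in> L2 a b) \<longrightarrow>
    (\<forall>N N'. N \<le> N' \<longrightarrow> \<bar>\<Sum>m\<in>{N..<N'}. \<integral>z. tens n f g z * piece m z \<partial>lborel\<bar> \<le> C / sqrt (real N + 1) * sqrt (gram n f g))"
    using pieces_dual by (elim exE conjE)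
  have C2: "\<bar>\<Sum>m\<in>{N..<N'}. \<integral>z. tens n f g z * piece m z \<partial>lborel\<bar> \<le> C / sqrt (real N + 1) * sqrt (gram n f g)"
    if "\<forall>i<n. f i \<in> L2 a b \<and> g i \<in> L2 a b" "N \<le> N'" for n f g N N' using C' that by blast
  note C = Cnn C2
  have "\<bar>(\<Sum>i<n. J (f i) \<bullet> J (g i)) - (\<Sum>m<N. \<integral>z. tens n f g z * piece m z \<partial>lborel)\<bar> \<le> C / sqrt (real N + 1) * sqrt (gram n f g)"
    if fg: "\<forall>i<n. f i \<in> L2 a 0 \<and> g i \<in> L2 0 b" for n f g N
  proof -
    let ?I = "\<lambda>m. \<integral>z. tens n f g z * piece m z \<partial>lborel"
    have fg': "\<forall>i<n. f i \<in> L2 a b \<and> g i \<in> L2 a b" using fg L2_left L2_right by auto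
    have "(\<lambda>N'. \<bar>(\<Sum>m<N'. ?I m) - (\<Sum>m<N. ?I m)\<bar>) \<longlonglongrightarrow> \<bar>(\<Sum>i<n. J (f i) \<bullet> J (g i)) - (\<Sum>m<N. ?I m)\<bar>"
      by (intro tendsto_intros cross_limit) (use fg in auto)
    moreover have "\<bar>(\<Sum>m<N'. ?I m) - (\<Sum>m<N. ?I m)\<bar> \<le> C / sqrt (real N + 1) * sqrt (gram n f g)" if N': "N' \<ge> N" for N'
    proof -
      have "(\<Sum>m<N'. ?I m) = (\<Sum>m<N. ?I m) + (\<Sum>m\<in>{N..<N'}. ?I m)"
        using N' sum.atLeastLessThan_concat[of 0 N N' ?I] by (simp add: atLeast0LessThan)
      then show ?thesis using C(2)[OF fg' N'] by simp
    qed
    ultimately show ?thesis by (intro LIMSEQ_le_const2) auto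
  qed
  with C(1) show ?thesis by blast
qed

text \<open>For functions this is \<open>cross_tail\<close> with \<open>N = 0\<close>. Both sides
  are continuous in the finitely many vectors, so the bound passes to the closures.\<close>

lemma hilbert_schmidt_bound:
  "\<exists>C. \<forall>(n::nat) x y. (\<forall>i<n. x i \<in> closure (J ` L2 a 0) \<and> y i \<in> closure (J ` L2 0 b)) \<longrightarrow>
    \<bar>\<Sum>i<n. x i \<bullet> y i\<bar> \<le> C * sqrt (\<Sum>i<n. \<Sum>j<n. (x i \<bullet> x j) * (y i \<bullet> y j))"
proof -
  obtain C where Cnn: "C \<ge> 0" and C': "\<forall>n f g N. (\<forall>i<n. f i \<in> L2 a 0 \<and> g i \<in> L2 0 b) \<longrightarrow>
    \<bar>(\<Sum>i<n. J (f i) \<bullet> J (g i)) - (\<Sum>m<N. \<integral>z. tens n f g z * piece m z \<partial>lborel)\<bar> \<le> C / sqrt (real N + 1) * sqrt (gram n f g)"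
    using cross_tail by (elim exE conjE)
  have C2: "\<bar>(\<Sum>i<n. J (f i) \<bullet> J (g i)) - (\<Sum>m<N. \<integral>z. tens n f g z * piece m z \<partial>lborel)\<bar> \<le> C / sqrt (real N + 1) * sqrt (gram n f g)"
    if "\<forall>i<n. f i \<in> L2 a 0 \<and> g i \<in> L2 0 b" for n f g N using C' that by blast
  note C = Cnn C2
  have "\<bar>\<Sum>i<n. x i \<bullet> y i\<bar> \<le> C * sqrt (\<Sum>i<n. \<Sum>j<n. (x i \<bullet> x j) * (y i \<bullet> y j))"
    if xy: "\<forall>i<n. x i \<in> closure (J ` L2 a 0) \<and> y i \<in> closure (J ` L2 0 b)" for n :: nat and x y :: "nat \<Rightarrow> 'h"
  proof -
    have "\<exists>F. i < n \<longrightarrow> (\<forall>k. F k \<in> L2 a 0) \<and> (\<lambda>k. J (F k)) \<longlonglongrightarrow> x i" for i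
      using closure_image_sequence[of "x i" J "L2 a 0"] xy by metis
    then obtain F where F: "\<And>i k. i < n \<Longrightarrow> F i k \<in> L2 a 0" "\<And>i. i < n \<Longrightarrow> (\<lambda>k. J (F i k)) \<longlonglongrightarrow> x i" by metis
    have "\<exists>F. i < n \<longrightarrow> (\<forall>k. F k \<in> L2 0 b) \<and> (\<lambda>k. J (F k)) \<longlonglongrightarrow> y i" for i
      using closure_image_sequence[of "y i" J "L2 0 b"] xy by metis
    then obtain G' where G': "\<And>i k. i < n \<Longrightarrow> G' i k \<in> L2 0 b" "\<And>i. i < n \<Longrightarrow> (\<lambda>k. J (G' i k)) \<longlonglongrightarrow> y i" by metis
    have le: "\<bar>\<Sum>i<n. J (F i k) \<bullet> J (G' i k)\<bar>
        \<le> C * sqrt (\<Sum>i<n. \<Sum>j<n. (J (F i k) \<bullet> J (F j k)) * (J (G' i k) \<bullet> J (G' j k)))" for k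
    proof -
      have fg: "\<forall>i<n. F i k \<in> L2 a 0 \<and> G' i k \<in> L2 0 b" using F(1) G'(1) by blast
      have f': "\<And>i. i < n \<Longrightarrow> F i k \<in> L2 a b" and g': "\<And>i. i < n \<Longrightarrow> G' i k \<in> L2 a b"
        using fg L2_left L2_right by auto
      show ?thesis using C(2)[of n "\<lambda>i. F i k" "\<lambda>i. G' i k" 0, OF fg] by (simp add: gram_def[OF f' g'])
    qed
    have "(\<lambda>k. \<bar>\<Sum>i<n. J (F i k) \<bullet> J (G' i k)\<bar>) \<longlonglongrightarrow> \<bar>\<Sum>i<n. x i \<bullet> y i\<bar>"
      by (intro tendsto_intros F G') auto
    moreover have "(\<lambda>k. C * sqrt (\<Sum>i<n. \<Sum>j<n. (J (F i k) \<bullet> J (F j k)) * (J (G' i k) \<bullet> J (G' j k))))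
        \<longlonglongrightarrow> C * sqrt (\<Sum>i<n. \<Sum>j<n. (x i \<bullet> x j) * (y i \<bullet> y j))"
      by (intro tendsto_intros F G') auto
    ultimately show ?thesis by (rule LIMSEQ_le) (use le in auto)
  qed
  then show ?thesis by (intro exI[of _ C] allI impI) blast
qed

lemma gram_single:
  assumes "F \<in> L2 a b" "H \<in> L2 a b"
  shows "sqrt (gram 1 (\<lambda>_. F) (\<lambda>_. H)) = norm (J F) * norm (J H)"
  using assms by (subst gram_def) (auto simp: real_sqrt_mult norm_eq_sqrt_inner)

lemma tens_single:
  assumes "F \<in> L2 a b" "H \<in> L2 a b"
  shows "tens 1 (\<lambda>_. F) (\<lambda>_. H) z = F (fst z) * H (snd z)"
  using assms by (subst tens_def) auto

text \<open>The piece is cut at the line \<open>s = 0\<close>. The thin strip is small uniformly in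
  \<open>k\<close>, since the norms are bounded. On the rest \<open>s\<close> is negative, where
  \<open>H k\<close> vanishes, so \<open>F k\<close> may be replaced by \<open>F k - H k\<close>,
  whose image tends to \<open>x - x = 0\<close>. The width of the strip is fixed before
  \<open>k\<close> grows.\<close>

lemma piece_vanishing:
  assumes F: "\<And>k. F k \<in> L2 a 0" "(\<lambda>k. J (F k)) \<longlonglongrightarrow> x" and H: "\<And>k. H k \<in> L2 0 b" "(\<lambda>k. J (H k)) \<longlonglongrightarrow> x"
  shows "(\<lambda>k. \<integral>z. tens 1 (\<lambda>_. F k) (\<lambda>_. H k) z * piece m z \<partial>lborel) \<longlonglongrightarrow> 0"
proof (rule LIMSEQ_I)
  fix r :: real assume r: "0 < r"
  have F': "F k \<in> L2 a b" and H': "H k \<in> L2 a b" for k using F(1) H(1) L2_left L2_right by auto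
  have "(\<lambda>k. norm (J (F k)) * norm (J (H k))) \<longlonglongrightarrow> norm x * norm x" by (intro tendsto_intros F H)
  then have "Bseq (\<lambda>k. norm (J (F k)) * norm (J (H k)))" by (intro convergent_imp_Bseq convergentI)
  then obtain D where D: "D > 0" "\<And>k. norm (J (F k)) * norm (J (H k)) \<le> D"
    unfolding Bseq_def by (metis abs_of_nonneg mult_nonneg_nonneg norm_ge_zero real_norm_def)
  define \<eta> where "\<eta> = r / (2 * D)"
  have \<eta>: "\<eta> > 0" "\<eta> * D = r / 2" using r D by (auto simp: \<eta>_def)
  have q: "0 < 2 * u m" using u_pos by simp
  have supp: "\<bar>fst z\<bar> \<le> 2 * u m \<and> \<bar>snd z\<bar> \<le> 2 * u m" if "piece m z \<noteq> 0" for z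
    using piece_support[OF that] by (auto simp: l1_def)
  obtain \<delta> where \<delta>: "\<delta> > 0" "\<And>n f g. (\<forall>i<n. f i \<in> L2 a b \<and> g i \<in> L2 a b) \<Longrightarrow>
    \<bar>\<integral>z. tens n f g z * (piece m z * max 0 (1 - \<bar>fst z\<bar> / \<delta>)) \<partial>lborel\<bar> \<le> \<eta> * sqrt (gram n f g)"
    using thin_strip[OF piece_bound piece_lipschitz q _ \<eta>(1), of m] supp by blast
  \<comment> \<open>For \<open>s < 0\<close> this complements the tent of the strip to 1, and it
    vanishes for \<open>s >= 0\<close>, where \<open>F k\<close> is zero anyway. A sharp cut would
    destroy the Lipschitz property.\<close>
  define ct where "ct s = max 0 (min 1 (- s / \<delta>))" for s
  have ctlip: "plane_lipschitz (1 / \<delta>) (\<lambda>z. ct (fst z))"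
  proof (rule plane_lipschitz_fst)
    fix x y :: real
    have "\<bar>ct x - ct y\<bar> \<le> \<bar>x / \<delta> - y / \<delta>\<bar>" unfolding ct_def by linarith
    also have "\<dots> = 1 / \<delta> * \<bar>x - y\<bar>" using \<delta>(1) by (simp add: diff_divide_distrib[symmetric])
    finally show "\<bar>ct x - ct y\<bar> \<le> 1 / \<delta> * \<bar>x - y\<bar>" .
  qed (use \<delta> in simp)
  have ctb: "\<bar>ct (fst z)\<bar> \<le> 1" for z :: "real \<times> real" by (auto simp: ct_def)
  define k2 where "k2 z = piece m z * ct (fst z)" for z
  have k2lip: "plane_lipschitz (7 * amp m / u m * 1 + amp m * (1 / \<delta>)) k2"
    unfolding k2_def[abs_def] by (rule plane_lipschitz_mult[OF piece_lipschitz piece_bound ctlip ctb])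
  have k2b: "\<bar>k2 z\<bar> \<le> amp m" for z
    using mult_mono[OF piece_bound[of m z] ctb[of z]] amp_nonneg by (simp add: abs_mult k2_def)
  have k2s: "\<bar>fst z\<bar> \<le> 2 * u m \<and> \<bar>snd z\<bar> \<le> 2 * u m" if "k2 z \<noteq> 0" for z
    using supp[of z] that by (auto simp: k2_def)
  have k2m: "k2 \<in> borel_measurable borel" by (rule plane_lipschitz_measurable[OF k2lip])
  \<comment> \<open>Any smoothing scale serves: \<open>m\<close> and \<delta> are fixed, and only
    \<open>k\<close> moves.\<close>
  have v: "0 < e0 / 2" "e0 / 2 < e0" using e0 by auto
  have u2: "0 \<le> 2 * u m" using u_pos[of m] by simp
  define C2 where "C2 = dual_const * max (amp m) (16 * (7 * amp m / u m * 1 + amp m * (1 / \<delta>)) * (e0 / 2)) *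
    sqrt (4 * (2 * u m + 2 * (e0 / 2)) * (2 * u m + 2 * (e0 / 2))) * L (e0 / 2) powr (\<alpha> - 1)"
  have FH: "(\<lambda>x. F k x + (-1) * H k x) \<in> L2 a b" for k by (intro L2_add L2_scale F' H')
  have JFH: "J (\<lambda>x. F k x + (-1) * H k x) = J (F k) - J (H k)" for k
    using J_add[OF F'[of k] L2_scale[OF H'[of k], of "-1"]] J_scale[OF H'[of k], of "-1"] by simp
  have k2_le: "\<bar>\<integral>z. tens 1 (\<lambda>_. F k) (\<lambda>_. H k) z * k2 z \<partial>lborel\<bar> \<le> C2 * (norm (J (F k) - J (H k)) * norm (J (H k)))" for k
  proof -
    have "tens 1 (\<lambda>_. F k) (\<lambda>_. H k) z * k2 z = tens 1 (\<lambda>_. (\<lambda>x. F k x + (-1) * H k x)) (\<lambda>_. H k) z * k2 z" for z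
    proof (cases "fst z < 0")
      case True
      then have "H k (fst z) = 0" using L2_outside[OF H(1)] by auto
      then show ?thesis unfolding tens_single[OF F' H'] tens_single[OF FH H'] by simp
    next
      case False
      then have "- fst z / \<delta> \<le> 0" using \<delta>(1) by (simp add: divide_nonpos_pos)
      then have "ct (fst z) = 0" by (simp add: ct_def)
      then show ?thesis by (simp add: k2_def)
    qed
    then have "(\<integral>z. tens 1 (\<lambda>_. F k) (\<lambda>_. H k) z * k2 z \<partial>lborel)
        = (\<integral>z. tens 1 (\<lambda>_. (\<lambda>x. F k x + (-1) * H k x)) (\<lambda>_. H k) z * k2 z \<partial>lborel)"
      by (rule Bochner_Integration.integral_cong[OF refl])
    also have "\<bar>\<dots>\<bar> \<le> C2 * sqrt (gram 1 (\<lambda>_. (\<lambda>x. F k x + (-1) * H k x)) (\<lambda>_. H k))"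
      unfolding C2_def by (rule lipschitz_dual_bounded[OF k2b k2lip v u2 u2 k2s FH H'])
    finally show ?thesis unfolding gram_single[OF FH H'] JFH .
  qed
  have "(\<lambda>k. C2 * (norm (J (F k) - J (H k)) * norm (J (H k)))) \<longlonglongrightarrow> C2 * (norm (x - x) * norm x)"
    by (intro tendsto_intros F H)
  then have "(\<lambda>k. C2 * (norm (J (F k) - J (H k)) * norm (J (H k)))) \<longlonglongrightarrow> 0" by simp
  then have "\<forall>\<^sub>F k in sequentially. C2 * (norm (J (F k) - J (H k)) * norm (J (H k))) < r / 2"
    using r by (intro order_tendstoD) auto
  then obtain N where N: "\<And>k. k \<ge> N \<Longrightarrow> C2 * (norm (J (F k) - J (H k)) * norm (J (H k))) < r / 2"
    unfolding eventually_sequentially by blast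
  show "\<exists>no. \<forall>k\<ge>no. norm ((\<integral>z. tens 1 (\<lambda>_. F k) (\<lambda>_. H k) z * piece m z \<partial>lborel) - 0) < r"
  proof (intro exI[of _ N] allI impI)
    fix k assume k: "k \<ge> N"
    let ?tens = "tens 1 (\<lambda>_. F k) (\<lambda>_. H k)" and ?k1 = "\<lambda>z. piece m z * max 0 (1 - \<bar>fst z\<bar> / \<delta>)"
    have split: "?tens z * piece m z = ?tens z * ?k1 z + ?tens z * k2 z" for z
    proof (cases "fst z < 0")
      case True
      then have "fst z / \<delta> \<le> 0" using \<delta>(1) by (simp add: divide_nonpos_pos)
      then have "max 0 (1 - \<bar>fst z\<bar> / \<delta>) + ct (fst z) = 1" using True \<delta>(1) by (auto simp: ct_def max_def min_def)
      then have "piece m z = ?k1 z + k2 z" by (simp add: k2_def flip: distrib_left)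
      then show ?thesis by (metis distrib_left)
    next
      case False
      then have "F k (fst z) = 0" using L2_outside[OF F(1)] by auto
      then show ?thesis unfolding tens_single[OF F' H'] by simp
    qed
    have k1b: "\<bar>?k1 z\<bar> \<le> amp m" for z
    proof -
      have "\<bar>max 0 (1 - \<bar>fst z\<bar> / \<delta>)\<bar> \<le> 1" using \<delta>(1) by auto
      from mult_mono[OF piece_bound[of m z] this] show ?thesis using amp_nonneg by (simp add: abs_mult)
    qed
    have [measurable]: "fst \<in> borel_measurable (borel :: (real \<times> real) measure)" by (simp add: borel_measurable_continuous_onI continuous_on_fst)
    have k1m: "?k1 \<in> borel_measurable borel" by measurable
    have "(\<integral>z. ?tens z * piece m z \<partial>lborel) = (\<integral>z. ?tens z * ?k1 z \<partial>lborel) + (\<integral>z. ?tens z * k2 z \<partial>lborel)"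
      unfolding split
      by (rule Bochner_Integration.integral_add)
        (rule tens_times_integrable[OF F' H' k1m k1b] tens_times_integrable[OF F' H' k2m k2b])+
    moreover have "\<bar>\<integral>z. ?tens z * ?k1 z \<partial>lborel\<bar> \<le> r / 2"
    proof -
      have "\<bar>\<integral>z. ?tens z * ?k1 z \<partial>lborel\<bar> \<le> \<eta> * (norm (J (F k)) * norm (J (H k)))"
        using \<delta>(2)[of 1 "\<lambda>_. F k" "\<lambda>_. H k"] F' H' gram_single[OF F' H'] by simp
      also have "\<dots> \<le> \<eta> * D" using D(2) \<eta>(1) by (intro mult_left_mono) auto
      finally show ?thesis using \<eta>(2) by simp
    qed
    ultimately show "norm ((\<integral>z. ?tens z * piece m z \<partial>lborel) - 0) < r"
      using k2_le[of k] N[OF k] by simp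
  qed
qed

text \<open>For fixed \<open>N\<close> the limit in \<open>k\<close> removes the first
  \<open>N\<close> pieces and leaves the squared norm of \<open>x\<close> bounded by
  \<open>C / sqrt (real N + 1)\<close> times itself; afterwards \<open>N\<close> tends to
  infinity.\<close>

lemma trivial_intersection: "closure (J ` L2 a 0) \<inter> closure (J ` L2 0 b) \<subseteq> {0}"
proof
  fix x assume x: "x \<in> closure (J ` L2 a 0) \<inter> closure (J ` L2 0 b)"
  then have x1: "x \<in> closure (J ` L2 a 0)" and x2: "x \<in> closure (J ` L2 0 b)" by auto
  obtain F where F: "\<And>k. F k \<in> L2 a 0" "(\<lambda>k. J (F k)) \<longlonglongrightarrow> x" by (rule closure_image_sequence[OF x1]) (rule that)
  obtain H where H: "\<And>k. H k \<in> L2 0 b" "(\<lambda>k. J (H k)) \<longlonglongrightarrow> x" by (rule closure_image_sequence[OF x2]) (rule that)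
  have F': "F k \<in> L2 a b" and H': "H k \<in> L2 a b" for k using F(1) H(1) L2_left L2_right by auto
  obtain C where Cnn: "C \<ge> 0" and C': "\<forall>n f g N. (\<forall>i<n. f i \<in> L2 a 0 \<and> g i \<in> L2 0 b) \<longrightarrow>
    \<bar>(\<Sum>i<n. J (f i) \<bullet> J (g i)) - (\<Sum>m<N. \<integral>z. tens n f g z * piece m z \<partial>lborel)\<bar> \<le> C / sqrt (real N + 1) * sqrt (gram n f g)"
    using cross_tail by (elim exE conjE)
  have C2: "\<bar>(\<Sum>i<n. J (f i) \<bullet> J (g i)) - (\<Sum>m<N. \<integral>z. tens n f g z * piece m z \<partial>lborel)\<bar> \<le> C / sqrt (real N + 1) * sqrt (gram n f g)"
    if "\<forall>i<n. f i \<in> L2 a 0 \<and> g i \<in> L2 0 b" for n f g N using C' that by blast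
  note C = Cnn C2
  have N: "(norm x)\<^sup>2 \<le> C / sqrt (real N + 1) * (norm x * norm x)" for N
  proof (rule LIMSEQ_le)
    let ?P = "\<lambda>k. \<Sum>m<N. \<integral>z. tens 1 (\<lambda>_. F k) (\<lambda>_. H k) z * piece m z \<partial>lborel"
    have "?P \<longlonglongrightarrow> (\<Sum>m<N. 0)" by (intro tendsto_sum piece_vanishing[OF F H])
    then have P: "?P \<longlonglongrightarrow> 0" by simp
    have "(\<lambda>k. J (F k) \<bullet> J (H k) - ?P k) \<longlonglongrightarrow> x \<bullet> x - 0" by (intro tendsto_intros F H P)
    then show "(\<lambda>k. J (F k) \<bullet> J (H k) - ?P k) \<longlonglongrightarrow> (norm x)\<^sup>2" by (simp add: power2_norm_eq_inner)
    show "(\<lambda>k. C / sqrt (real N + 1) * (norm (J (F k)) * norm (J (H k)))) \<longlonglongrightarrow> C / sqrt (real N + 1) * (norm x * norm x)"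
      by (intro tendsto_intros F H) auto
    show "\<exists>k0. \<forall>k\<ge>k0. J (F k) \<bullet> J (H k) - ?P k \<le> C / sqrt (real N + 1) * (norm (J (F k)) * norm (J (H k)))"
    proof (intro exI[of _ 0] allI impI)
      fix k
      have "\<forall>i<(1::nat). F k \<in> L2 a 0 \<and> H k \<in> L2 0 b" using F(1) H(1) by blast
      from C(2)[of 1 "\<lambda>_. F k" "\<lambda>_. H k" N, OF this]
      show "J (F k) \<bullet> J (H k) - ?P k \<le> C / sqrt (real N + 1) * (norm (J (F k)) * norm (J (H k)))"
        unfolding gram_single[OF F' H'] by simp
    qed
  qed
  have "(\<lambda>N. C / sqrt (real N + 1) * (norm x * norm x)) \<longlonglongrightarrow> 0 * (norm x * norm x)"
    by (intro tendsto_mult tendsto_const) real_asymp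
  then have "(norm x)\<^sup>2 \<le> 0 * (norm x * norm x)" by (rule LIMSEQ_le_const) (use N in auto)
  then show "x \<in> {0}" by simp
qed

end

end

section \<open>Separability and the decomposition\<close>

text \<open>Lists encode rational combinations: they form a countable type, and concatenation is
  addition. The closure of the combinations is a real subspace by approximating scalars.\<close>

lemma countable_dense_of_countable_span:
  fixes v :: "nat \<Rightarrow> 'a::real_normed_vector"
  assumes "closure (span (range v)) = UNIV"
  shows "\<exists>A. countable A \<and> closure A = (UNIV :: 'a set)"
proof -
  define S where "S xs = (\<Sum>(q, i)\<leftarrow>xs. of_rat q *\<^sub>R v i)" for xs :: "(rat \<times> nat) list"
  define A where "A = range S"
  have add: "S xs + S ys = S (xs @ ys)" for xs ys by (simp add: S_def)
  have scale: "of_rat p *\<^sub>R S xs = S (map (\<lambda>(q, i). (p * q, i)) xs)" for p xs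
    by (induction xs) (auto simp: S_def scaleR_add_right of_rat_mult)
  have "subspace (closure A)"
  proof (rule subspaceI)
    have "S [] \<in> A" by (simp add: A_def)
    then show "0 \<in> closure A" using closure_subset by (auto simp: S_def)
    fix x y assume "x \<in> closure A" "y \<in> closure A"
    then obtain X Y where X: "\<And>n. X n \<in> A" "X \<longlonglongrightarrow> x" and Y: "\<And>n. Y n \<in> A" "Y \<longlonglongrightarrow> y"
      unfolding closure_sequential by metis
    have "X n + Y n \<in> A" for n using X(1)[of n] Y(1)[of n] add by (auto simp: A_def)
    moreover have "(\<lambda>n. X n + Y n) \<longlonglongrightarrow> x + y" by (intro tendsto_intros X Y)
    ultimately show "x + y \<in> closure A"
      unfolding closure_sequential by (intro exI[of _ "\<lambda>n. X n + Y n"]) blast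
  next
    fix c :: real and x assume "x \<in> closure A"
    then obtain X where X: "\<And>n. X n \<in> A" "X \<longlonglongrightarrow> x" unfolding closure_sequential by metis
    have "\<exists>q. c < of_rat q \<and> of_rat q < c + 1 / real (Suc n)" for n
      by (rule of_rat_dense) simp
    then obtain q where q: "\<And>n. c < of_rat (q n)" "\<And>n. of_rat (q n) < c + 1 / real (Suc n)" by metis
    have "(\<lambda>n. of_rat (q n) :: real) \<longlonglongrightarrow> c"
    proof (rule tendsto_sandwich[of "\<lambda>_. c"])
      show "\<forall>\<^sub>F n in sequentially. c \<le> of_rat (q n)" using q(1) by (simp add: less_imp_le)
      show "\<forall>\<^sub>F n in sequentially. of_rat (q n) \<le> c + 1 / real (Suc n)" using q(2) by (simp add: less_imp_le)
      show "(\<lambda>n. c + 1 / real (Suc n)) \<longlonglongrightarrow> c" by real_asymp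
    qed simp
    then have "(\<lambda>n. of_rat (q n) *\<^sub>R X n) \<longlonglongrightarrow> c *\<^sub>R x" by (intro tendsto_scaleR X)
    moreover have "of_rat (q n) *\<^sub>R X n \<in> A" for n using X(1)[of n] scale by (auto simp: A_def)
    ultimately show "c *\<^sub>R x \<in> closure A"
      unfolding closure_sequential by (intro exI[of _ "\<lambda>n. of_rat (q n) *\<^sub>R X n"]) blast
  qed
  moreover have "range v \<subseteq> closure A"
  proof
    fix x assume "x \<in> range v"
    then obtain i where "x = v i" by auto
    then have "x = S [(1, i)]" by (simp add: S_def)
    then show "x \<in> closure A" using subsetD[OF closure_subset, of "S [(1, i)]" A] by (simp add: A_def)
  qed
  ultimately have "span (range v) \<subseteq> closure A" by (simp add: span_minimal)
  then have "closure (span (range v)) \<subseteq> closure A" by (simp add: closure_minimal)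
  then have "closure A = UNIV" using assms by blast
  moreover have "countable A" by (simp add: A_def)
  ultimately show ?thesis by blast
qed

text \<open>A countable generator closed under finite intersections, as needed to reach all Borel
  sets from countably many vectors.\<close>

lemma borel_eq_rational_atMost: "(borel :: real measure) = sigma UNIV (range (\<lambda>q::rat. {..of_rat q}))"
proof (rule borel_eq_sigmaI1[OF borel_eq_atMost])
  fix X :: "real set" assume "X \<in> range (\<lambda>i. {..i})"
  then obtain x where X: "X = {..x}" by auto
  have "X = (\<Inter>q\<in>{q. x < of_rat q}. {..of_rat q})"
  proof (intro equalityI subsetI)
    fix y :: real assume y: "y \<in> (\<Inter>q\<in>{q. x < of_rat q}. {..of_rat q})"
    show "y \<in> X"
    proof (rule ccontr)
      assume "y \<notin> X"
      then have "x < y" by (simp add: X)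
      then obtain q where "x < of_rat q" "of_rat q < y" using of_rat_dense by blast
      then show False using y by force
    qed
  qed (auto simp: X)
  moreover have "(\<Inter>q\<in>{q. x < of_rat q}. {..of_rat q :: real}) \<in> sets (sigma UNIV (range (\<lambda>q::rat. {..of_rat q})))"
  proof (rule sets.countable_INT'')
    show "UNIV \<in> sets (sigma (UNIV :: real set) (range (\<lambda>q::rat. {..of_rat q})))"
      by (metis sets.top space_measure_of_conv)
    show "\<And>q. {..of_rat q :: real} \<in> sets (sigma UNIV (range (\<lambda>q::rat. {..of_rat q})))"
      by (auto intro!: sigma_sets.Basic)
  qed (rule countableI_type)
  ultimately show "X \<in> sets (sigma UNIV (range (\<lambda>q::rat. {..of_rat q})))" by simp
qed auto

section \<open>Separability of the completion\<close>

context log_kernel_completion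
begin

definition form_const :: real where "form_const = (\<integral>t. indicator {-(b-a)..b-a} t * \<bar>B t\<bar> \<partial>lborel)"

lemma norm_J_le: "f \<in> L2 a b \<Longrightarrow> (norm (J f))\<^sup>2 \<le> form_const * (\<integral>x. (f x)\<^sup>2 \<partial>lborel)"
  using B_form_bound[OF B_measurable B_set_integrable _ order_refl, of f a b]
  by (simp add: power2_norm_eq_inner J_inner form_const_def)

text \<open>Dominated convergence in the square norm, carried over by
  \<open>norm_J_le\<close>.\<close>

lemma J_tendsto:
  assumes F: "\<And>n. F n \<in> borel_measurable borel" and f: "f \<in> borel_measurable borel" and g: "g \<in> L2 a b"
    and le: "\<And>n x. \<bar>F n x\<bar> \<le> \<bar>g x\<bar>" and lim: "\<And>x. (\<lambda>n. F n x) \<longlonglongrightarrow> f x"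
  shows "(\<lambda>n. J (F n)) \<longlonglongrightarrow> J f"
proof -
  have fle: "\<bar>f x\<bar> \<le> \<bar>g x\<bar>" for x
    by (rule LIMSEQ_le_const2[OF tendsto_rabs[OF lim[of x]]]) (use le in auto)
  have FL: "F n \<in> L2 a b" for n by (rule L2_bounded[OF F g le])
  have fL: "f \<in> L2 a b" by (rule L2_bounded[OF f g fle])
  note [measurable] = F f L2_measurable[OF g]
  have d: "J (F n) - J f = J (\<lambda>x. F n x + (-1) * f x)" for n
    using J_add[OF FL[of n] L2_scale[OF fL, of "-1"]] J_scale[OF fL, of "-1"] by simp
  have "(\<lambda>n. \<integral>x. (F n x + (-1) * f x)\<^sup>2 \<partial>lborel) \<longlonglongrightarrow> (\<integral>x. 0 \<partial>(lborel :: real measure))"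
  proof (rule integral_dominated_convergence[where w = "\<lambda>x. 4 * (g x)\<^sup>2"])
    show "integrable lborel (\<lambda>x. 4 * (g x)\<^sup>2)" using L2_square_integrable[OF g] by simp
    show "AE x in lborel. (\<lambda>n. (F n x + (-1) * f x)\<^sup>2) \<longlonglongrightarrow> 0"
    proof (rule AE_I2)
      fix x
      have "(\<lambda>n. (F n x + (-1) * f x)\<^sup>2) \<longlonglongrightarrow> (f x + (-1) * f x)\<^sup>2" by (intro tendsto_intros lim)
      then show "(\<lambda>n. (F n x + (-1) * f x)\<^sup>2) \<longlonglongrightarrow> 0" by simp
    qed
    show "AE x in lborel. norm ((F n x + (-1) * f x)\<^sup>2) \<le> 4 * (g x)\<^sup>2" for n
    proof (rule AE_I2)
      fix x
      have "\<bar>F n x + (-1) * f x\<bar> \<le> 2 * \<bar>g x\<bar>" using le[of n x] fle[of x] by linarith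
      then have "\<bar>F n x + (-1) * f x\<bar>\<^sup>2 \<le> (2 * \<bar>g x\<bar>)\<^sup>2" by (rule power_mono) simp
      then show "norm ((F n x + (-1) * f x)\<^sup>2) \<le> 4 * (g x)\<^sup>2" by (simp add: power_mult_distrib)
    qed
  qed measurable
  then have "(\<lambda>n. form_const * (\<integral>x. (F n x + (-1) * f x)\<^sup>2 \<partial>lborel)) \<longlonglongrightarrow> form_const * 0"
    by (intro tendsto_mult tendsto_const) simp
  then have lim0: "(\<lambda>n. form_const * (\<integral>x. (F n x + (-1) * f x)\<^sup>2 \<partial>lborel)) \<longlonglongrightarrow> 0" by simp
  have "(\<lambda>n. (norm (J (F n) - J f))\<^sup>2) \<longlonglongrightarrow> 0"
  proof (rule Lim_null_comparison[OF _ lim0])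
    show "\<forall>\<^sub>F n in sequentially. norm ((norm (J (F n) - J f))\<^sup>2) \<le> form_const * (\<integral>x. (F n x + (-1) * f x)\<^sup>2 \<partial>lborel)"
    proof (rule always_eventually, rule allI)
      fix n
      have "(\<lambda>x. F n x + (-1) * f x) \<in> L2 a b" by (intro L2_add L2_scale FL fL)
      from norm_J_le[OF this] show "norm ((norm (J (F n) - J f))\<^sup>2) \<le> form_const * (\<integral>x. (F n x + (-1) * f x)\<^sup>2 \<partial>lborel)"
        unfolding d by simp
    qed
  qed
  from tendsto_real_sqrt[OF this] have "(\<lambda>n. norm (J (F n) - J f)) \<longlonglongrightarrow> 0" by simp
  then have "(\<lambda>n. J (F n) - J f) \<longlonglongrightarrow> 0" by (rule tendsto_norm_zero_cancel)
  then show ?thesis by (rule LIM_zero_cancel)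
qed

lemma J_minus: "f \<in> L2 a b \<Longrightarrow> g \<in> L2 a b \<Longrightarrow> J (\<lambda>x. f x - g x) = J f - J g"
  using J_add[of f "\<lambda>x. (-1) * g x"] L2_scale[of g a b "-1"] J_scale[of g "-1"] by simp

text \<open>From half-lines to Borel sets by disjoint unions and complements, then to nonnegative
  functions by monotone approximation, then to differences. Every limit on the way is dominated, so
  \<open>J\<close> preserves it and \<open>W\<close> is not left.\<close>

lemma J_in_closed_subspace:
  assumes W: "subspace W" "closed W"
    and gen: "\<And>q::rat. J (indicator ({..of_rat q} \<inter> {a<..<b})) \<in> W"
    and f: "f \<in> L2 a b"
  shows "J f \<in> W"
proof -
  let ?I = "{a<..<b}"
  have g1: "(indicator ?I :: real \<Rightarrow> real) \<in> L2 a b" by (rule L2_indicator) auto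
  have Ia: "(indicator (A \<inter> ?I) :: real \<Rightarrow> real) \<in> L2 a b" if "A \<in> sets borel" for A
    by (rule L2_indicator) (use that in auto)
  have sets: "J (indicator (A \<inter> ?I)) \<in> W" if A: "A \<in> sets borel" for A
  proof -
    have "Int_stable (range (\<lambda>q::rat. {..of_rat q :: real}))"
    proof (rule Int_stableI)
      fix X Y :: "real set"
      assume "X \<in> range (\<lambda>q::rat. {..of_rat q})" "Y \<in> range (\<lambda>q::rat. {..of_rat q})"
      then obtain p q :: rat where "X = {..of_rat p}" "Y = {..of_rat q}" by auto
      then have "X \<inter> Y = {..of_rat (min p q)}" by (auto simp: min_def of_rat_less_eq)
      then show "X \<inter> Y \<in> range (\<lambda>q::rat. {..of_rat q})" by blast
    qed
    moreover have "range (\<lambda>q::rat. {..of_rat q :: real}) \<subseteq> Pow UNIV" by simp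
    moreover have "A \<in> sigma_sets UNIV (range (\<lambda>q::rat. {..of_rat q}))"
      using A by (subst (asm) borel_eq_rational_atMost) simp
    ultimately show ?thesis
    proof (induction rule: sigma_sets_induct_disjoint)
      case (basic X)
      then show ?case using gen by auto
    next
      case empty
      have "(indicator ({} \<inter> ?I) :: real \<Rightarrow> real) = (\<lambda>x. 0)" by (simp add: fun_eq_iff)
      then show ?case using J_zero subspace_0[OF W(1)] by simp
    next
      case (compl X)
      have Xb: "X \<in> sets borel" using compl(1) by (subst borel_eq_rational_atMost) simp
      obtain q :: rat where "b < of_rat q" using of_rat_dense[of b "b + 1"] by auto
      then have "{..of_rat q} \<inter> ?I = ?I" by auto
      then have JI: "J (indicator ?I) \<in> W" using gen[of q] by simp
      have "(indicator ((UNIV - X) \<inter> ?I) :: real \<Rightarrow> real) = (\<lambda>x. indicator ?I x - indicator (X \<inter> ?I) x)"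
        by (auto simp: fun_eq_iff indicator_def)
      then have "J (indicator ((UNIV - X) \<inter> ?I)) = J (indicator ?I) - J (indicator (X \<inter> ?I))"
        using J_minus[OF g1 Ia[OF Xb]] by simp
      then show ?case using JI compl W(1) by (simp add: subspace_diff)
    next
      case (union X)
      have Xb: "X i \<in> sets borel" for i using union(2) by (subst borel_eq_rational_atMost) auto
      define F where "F n = (\<lambda>x. \<Sum>i<n. 1 * indicator (X i \<inter> ?I) x :: real)" for n
      have lim: "(\<lambda>n. J (F n)) \<longlonglongrightarrow> J (indicator ((\<Union>i. X i) \<inter> ?I))"
      proof (rule J_tendsto[where g = "indicator ?I"])
        show "F n \<in> borel_measurable borel" for n unfolding F_def using Xb by measurable
        show "indicator ((\<Union>i. X i) \<inter> ?I) \<in> borel_measurable borel" using Xb by measurable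
        show "indicator ?I \<in> L2 a b" by (rule g1)
        have single: "F n x = (if \<exists>i<n. x \<in> X i \<inter> ?I then 1 else 0)" for n x
        proof (cases "\<exists>i<n. x \<in> X i \<inter> ?I")
          case True
          then obtain i where i: "i < n" "x \<in> X i \<inter> ?I" by blast
          have "F n x = (\<Sum>j<n. if j = i then 1 else 0)"
            unfolding F_def using union(1) i by (intro sum.cong refl) (auto simp: indicator_def disjoint_family_on_def)
          then show ?thesis using True i by simp
        next
          case False
          then show ?thesis unfolding F_def by (auto intro!: sum.neutral)
        qed
        show "\<bar>F n x\<bar> \<le> \<bar>indicator ?I x\<bar>" for n x unfolding single by (auto simp: indicator_def)
        show "(\<lambda>n. F n x) \<longlonglongrightarrow> indicator ((\<Union>i. X i) \<inter> ?I) x" for x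
        proof (cases "x \<in> (\<Union>i. X i) \<inter> ?I")
          case True
          then obtain i where i: "x \<in> X i \<inter> ?I" by blast
          have "\<forall>\<^sub>F n in sequentially. F n x = 1"
            using eventually_gt_at_top[of i] by eventually_elim (use i in \<open>auto simp: single\<close>)
          then show ?thesis using True by (auto intro: tendsto_eventually)
        next
          case False
          then have "F n x = 0" for n by (auto simp: single)
          then show ?thesis using False by simp
        qed
      qed
      have "J (F n) \<in> W" for n
      proof -
        have "J (F n) = (\<Sum>i<n. 1 *\<^sub>R J (indicator (X i \<inter> ?I)))"
          unfolding F_def using Ia Xb by (intro J_sum) auto
        then show ?thesis using union(3) W(1) by (auto intro!: subspace_sum)
      qed
      then show ?case using closed_sequentially[OF W(2) _ lim] by blast
    qed
  qed
  have pos: "J f \<in> W" if fL: "f \<in> L2 a b" and f0: "\<And>x. 0 \<le> f x" for f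
  proof -
    \<comment> \<open>The induction runs over all nonnegative Borel functions, hence membership in
      \<open>L2\<close> is carried as a premise. The ingredients inherit it from the function built
      from them, by domination or, for a nonzero multiple, by scaling.\<close>
    have "(\<lambda>x. indicator ?I x * f x) \<in> L2 a b \<longrightarrow> J (\<lambda>x. indicator ?I x * f x) \<in> W"
      using L2_measurable[OF fL] f0
    proof (induction rule: borel_measurable_induct_real)
      case (set A)
      have "(\<lambda>x. indicator ?I x * indicator A x :: real) = indicator (A \<inter> ?I)"
        by (auto simp: fun_eq_iff indicator_def)
      then show ?case using sets[of A] set by simp
    next
      case (mult u c)
      show ?case
      proof (intro impI)
        assume cu: "(\<lambda>x. indicator ?I x * (c * u x)) \<in> L2 a b"
        show "J (\<lambda>x. indicator ?I x * (c * u x)) \<in> W"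
        proof (cases "c = 0")
          case True
          then show ?thesis using J_zero subspace_0[OF W(1)] by simp
        next
          case False
          have "(\<lambda>x. (1 / c) * (indicator ?I x * (c * u x))) \<in> L2 a b" by (rule L2_scale[OF cu])
          then have u: "(\<lambda>x. indicator ?I x * u x) \<in> L2 a b" using False by simp
          have "J (\<lambda>x. c * (indicator ?I x * u x)) = c *\<^sub>R J (\<lambda>x. indicator ?I x * u x)" by (rule J_scale[OF u])
          then show ?thesis using mult u W(1) by (simp add: subspace_scale mult.left_commute)
        qed
      qed
    next
      case (add u v)
      show ?case
      proof (intro impI)
        assume uv: "(\<lambda>x. indicator ?I x * (v x + u x)) \<in> L2 a b"
        have [measurable]: "u \<in> borel_measurable borel" "v \<in> borel_measurable borel" using add by auto
        have u: "(\<lambda>x. indicator ?I x * u x) \<in> L2 a b"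
          by (rule L2_bounded[OF _ uv]) (use add in \<open>auto simp: indicator_def\<close>)
        have v: "(\<lambda>x. indicator ?I x * v x) \<in> L2 a b"
          by (rule L2_bounded[OF _ uv]) (use add in \<open>auto simp: indicator_def\<close>)
        show "J (\<lambda>x. indicator ?I x * (v x + u x)) \<in> W"
          using J_add[OF v u] add u v W(1) by (simp add: subspace_add distrib_left)
      qed
    next
      case (seq U)
      show ?case
      proof (intro impI)
        assume fI: "(\<lambda>x. indicator ?I x * f x) \<in> L2 a b"
        have lim0: "(\<lambda>i. U i x) \<longlonglongrightarrow> f x" for x using seq by simp
        have U0: "0 \<le> U i x" for i x using seq by blast
        have Um[measurable]: "U i \<in> borel_measurable borel" for i using seq(1) by auto
        have Ule: "U i x \<le> f x" for i x
          using incseq_le[OF _ lim0[of x], of i] \<open>incseq U\<close> by (simp add: incseq_def le_fun_def)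
        have le: "\<bar>indicator ?I x * U i x\<bar> \<le> \<bar>indicator ?I x * f x\<bar>" for i x
          using Ule[of i x] U0[of i x] by (auto simp: indicator_def)
        have UL: "(\<lambda>x. indicator ?I x * U i x) \<in> L2 a b" for i by (rule L2_bounded[OF _ fI le]) measurable
        have lim: "(\<lambda>i. J (\<lambda>x. indicator ?I x * U i x)) \<longlonglongrightarrow> J (\<lambda>x. indicator ?I x * f x)"
        proof (rule J_tendsto[OF _ _ fI le])
          show "(\<lambda>i. indicator ?I x * U i x) \<longlonglongrightarrow> indicator ?I x * f x" for x
            by (intro tendsto_intros lim0)
          show "(\<lambda>x. indicator ?I x * f x) \<in> borel_measurable borel" by (rule L2_measurable[OF fI])
        qed measurable
        have "J (\<lambda>x. indicator ?I x * U i x) \<in> W" for i using seq.IH UL by blast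
        then show "J (\<lambda>x. indicator ?I x * f x) \<in> W"
          using closed_sequentially[OF W(2) _ lim] by blast
      qed
    qed
    moreover have "(\<lambda>x. indicator ?I x * f x) = f"
      using L2_outside[OF fL] by (auto simp: fun_eq_iff indicator_def)
    ultimately show ?thesis using fL by simp
  qed
  have [measurable]: "f \<in> borel_measurable borel" by (rule L2_measurable[OF f])
  have p: "(\<lambda>x. max 0 (f x)) \<in> L2 a b" by (rule L2_bounded[OF _ f]) auto
  have n: "(\<lambda>x. max 0 (- f x)) \<in> L2 a b" by (rule L2_bounded[OF _ f]) auto
  have "f = (\<lambda>x. max 0 (f x) - max 0 (- f x))" by (auto simp: fun_eq_iff)
  then have "J f = J (\<lambda>x. max 0 (f x)) - J (\<lambda>x. max 0 (- f x))" using J_minus[OF p n] by simp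
  then show ?thesis using pos[OF p] pos[OF n] W(1) by (simp add: subspace_diff)
qed

lemma separable: "\<exists>A. countable A \<and> closure A = (UNIV :: 'h set)"
proof -
  obtain q :: "nat \<Rightarrow> rat" where q: "surj q" using surj_nat_to_rat_surj by blast
  define v where "v n = J (indicator ({..of_rat (q n)} \<inter> {a<..<b}))" for n
  define W where "W = closure (span (range v))"
  have W: "subspace W" "closed W" by (simp_all add: W_def subspace_closure_of_subspace)
  have "J (indicator ({..of_rat r} \<inter> {a<..<b})) \<in> W" for r :: rat
  proof -
    obtain n where "q n = r" using q by (metis surjD)
    then have "J (indicator ({..of_rat r} \<inter> {a<..<b})) = v n" by (simp add: v_def)
    then show ?thesis unfolding W_def using closure_subset span_base by (metis rangeI subsetD)
  qed
  then have "J ` L2 a b \<subseteq> W" using J_in_closed_subspace[OF W] by blast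
  then have "closure (J ` L2 a b) \<subseteq> W" using W(2) by (rule closure_minimal)
  then have "W = UNIV" using G by (auto simp: is_G_def)
  then show ?thesis using countable_dense_of_countable_span[of v] by (simp add: W_def)
qed

lemma G_sub_subspace:
  assumes "a \<le> c" "d \<le> b"
  shows "subspace (G_sub J c d)"
  unfolding G_sub_def
proof (rule subspace_closure_of_subspace, rule subspaceI)
  have L: "f \<in> L2 c d \<Longrightarrow> f \<in> L2 a b" for f by (erule L2_mono[OF _ assms])
  show "0 \<in> J ` L2 c d" using J_zero L2_zero by (metis image_eqI)
  fix x y and r :: real assume "x \<in> J ` L2 c d" "y \<in> J ` L2 c d"
  then obtain f g where fg: "f \<in> L2 c d" "g \<in> L2 c d" "x = J f" "y = J g" by auto
  show "x + y \<in> J ` L2 c d"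
    using J_add[OF L[OF fg(1)] L[OF fg(2)]] L2_add[OF fg(1,2)] fg(3,4) by (metis image_eqI)
  show "r *\<^sub>R x \<in> J ` L2 c d"
    using J_scale[OF L[OF fg(1)]] L2_scale[OF fg(1)] fg(3) by (metis image_eqI)
qed

lemma sum_dense:
  assumes "a < 0" "0 < b"
  shows "closure {x + y | x y. x \<in> G_sub J a 0 \<and> y \<in> G_sub J 0 b} = UNIV"
proof -
  have "J ` L2 a b \<subseteq> {x + y | x y. x \<in> G_sub J a 0 \<and> y \<in> G_sub J 0 b}"
  proof
    fix x assume "x \<in> J ` L2 a b"
    then obtain f where f: "f \<in> L2 a b" "x = J f" by auto
    have [measurable]: "f \<in> borel_measurable borel" by (rule L2_measurable[OF f(1)])
    define f1 where "f1 x = indicator {..<0} x * f x" for x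
    define f2 where "f2 x = indicator {0<..} x * f x" for x
    \<comment> \<open>The point 0 lies in neither open half. Its part is a null function, which
      \<open>J\<close> sends to zero.\<close>
    define f0 where "f0 x = indicator {0} x * f x" for x
    have m[measurable]: "f1 \<in> borel_measurable borel" "f2 \<in> borel_measurable borel" "f0 \<in> borel_measurable borel"
      unfolding f1_def f2_def f0_def by measurable
    have le: "\<bar>f1 x\<bar> \<le> \<bar>f x\<bar>" "\<bar>f2 x\<bar> \<le> \<bar>f x\<bar>" "\<bar>f0 x\<bar> \<le> \<bar>f x\<bar>" for x
      by (auto simp: f1_def f2_def f0_def indicator_def)
    have L: "f1 \<in> L2 a b" "f2 \<in> L2 a b" "f0 \<in> L2 a b" using L2_bounded[OF _ f(1)] m le by auto
    have "f1 \<in> L2 a 0" "f2 \<in> L2 0 b"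
      using L L2_outside[OF f(1)] by (auto simp: L2_def f1_def f2_def indicator_def)
    moreover have "J f0 = 0"
    proof -
      have "(\<integral>x. (f0 x)\<^sup>2 \<partial>lborel) = (\<integral>x. 0 \<partial>(lborel :: real measure))"
      proof (rule Bochner_Integration.integral_cong_AE)
        show "AE x in lborel. (f0 x)\<^sup>2 = 0"
          using AE_lborel_singleton[of 0] by eventually_elim (simp add: f0_def)
      qed measurable
      then show ?thesis using norm_J_le[OF L(3)] by simp
    qed
    moreover have "J f = J f1 + J f2 + J f0"
    proof -
      have "f = (\<lambda>x. (f1 x + f2 x) + f0 x)" by (auto simp: fun_eq_iff f1_def f2_def f0_def indicator_def)
      then have "J f = J (\<lambda>x. (f1 x + f2 x) + f0 x)" by simp
      also have "\<dots> = J (\<lambda>x. f1 x + f2 x) + J f0" by (rule J_add[OF L2_add[OF L(1,2)] L(3)])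
      finally show ?thesis using J_add[OF L(1,2)] by simp
    qed
    ultimately have "x = J f1 + J f2" "J f1 \<in> G_sub J a 0" "J f2 \<in> G_sub J 0 b"
      using f(2) by (auto simp: G_sub_def intro!: subsetD[OF closure_subset])
    then show "x \<in> {x + y | x y. x \<in> G_sub J a 0 \<and> y \<in> G_sub J 0 b}" by blast
  qed
  then have "closure (J ` L2 a b) \<subseteq> closure {x + y | x y. x \<in> G_sub J a 0 \<and> y \<in> G_sub J 0 b}" by (rule closure_mono)
  then show ?thesis using G by (auto simp: is_G_def)
qed

theorem fhs_decomposition:
  assumes a0: "a < 0" and b0: "0 < b"
  shows "fhs_direct_sum (fhs_class (norm :: 'h \<Rightarrow> real)) (G_sub J a 0) (G_sub J 0 b)"
proof -
  obtain A :: "'h set" where A: "countable A" "closure A = UNIV" using separable by blast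
  obtain C where C': "\<forall>(n::nat) x y. (\<forall>i<n. x i \<in> closure (J ` L2 a 0) \<and> y i \<in> closure (J ` L2 0 b)) \<longrightarrow>
    \<bar>\<Sum>i<n. x i \<bullet> y i\<bar> \<le> C * sqrt (\<Sum>i<n. \<Sum>j<n. (x i \<bullet> x j) * (y i \<bullet> y j))"
    using hilbert_schmidt_bound[OF a0 b0] by (elim exE)
  show ?thesis
  proof (rule fhs_direct_sum_if_hilbert_schmidt[OF _ _ _ _ A sum_dense[OF a0 b0], where M = C])
    show "subspace (G_sub J a 0)" "subspace (G_sub J 0 b)" using a0 b0 by (auto intro: G_sub_subspace)
    show "closed (G_sub J a 0)" "closed (G_sub J 0 b)" by (simp_all add: G_sub_def)
    show "G_sub J a 0 \<inter> G_sub J 0 b \<subseteq> {0}" using trivial_intersection[OF a0 b0] by (simp add: G_sub_def)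
    fix n and x y :: "nat \<Rightarrow> 'h"
    assume "\<And>i. i < n \<Longrightarrow> x i \<in> G_sub J a 0" "\<And>i. i < n \<Longrightarrow> y i \<in> G_sub J 0 b"
    then show "\<bar>\<Sum>i<n. x i \<bullet> y i\<bar> \<le> C * sqrt (\<Sum>i<n. \<Sum>j<n. (x i \<bullet> x j) * (y i \<bullet> y j))"
      using C' by (simp add: G_sub_def)
  qed
qed

end

theorem proposition9p10:
  fixes \<alpha> T :: real
    and B :: "real \<Rightarrow> real"
    and J :: "(real \<Rightarrow> real) \<Rightarrow> 'h::{real_inner, complete_space}"
  assumes "1 < \<alpha>"
    and "\<And>t. t \<noteq> 0 \<Longrightarrow> B (- t) = B t"
    and "\<And>t. 0 < t \<Longrightarrow> 0 \<le> B t"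
    and "antimono_on {0<..} B"
    and "convex_on {0<..} B"
    and "\<exists>\<epsilon>>0. \<forall>t\<in>{0<..<\<epsilon>}. B t = 1 / (t * ln (1 / t) powr \<alpha>)"
    and "0 < T"
    and "is_G B (- T) T J"
  shows "fhs_direct_sum (fhs_class (norm :: 'h \<Rightarrow> real)) (G_sub J (- T) 0) (G_sub J 0 T)"
proof -
  obtain \<epsilon> where \<epsilon>: "\<epsilon> > 0" "\<forall>t\<in>{0<..<\<epsilon>}. B t = 1 / (t * ln (1 / t) powr \<alpha>)" using assms(6) by blast
  \<comment> \<open>Half of \<epsilon> makes the formula valid up to \<open>2 * e0\<close>; the
    exponential gives \<open>3 * \<alpha> <= ln (1 / e0)\<close>.\<close>
  define e0 where "e0 = min (\<epsilon> / 2) (exp (- (3 * \<alpha>)))"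
  have e0: "0 < e0" "2 * e0 \<le> \<epsilon>" "e0 \<le> exp (- (3 * \<alpha>))" using \<epsilon>(1) by (auto simp: e0_def)
  have "ln e0 \<le> - (3 * \<alpha>)" using e0 by (metis exp_gt_zero ln_exp ln_le_cancel_iff)
  then have "3 * \<alpha> \<le> ln (1 / e0)" using e0 by (simp add: ln_div)
  interpret log_kernel_completion \<alpha> e0 B "- T" T J
    by unfold_locales
      (use assms e0 \<epsilon>(2) \<open>3 * \<alpha> \<le> ln (1 / e0)\<close> in \<open>auto simp: monotone_on_def\<close>)
  show ?thesis by (rule fhs_decomposition) (use assms(7) in auto)
qed

end
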